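(* Let $\Gamma$ be a group and let $\rho:\Gamma\to\mathrm{Diff}^\omega(\mathbb{S}^1)$ be a non elementary representation preserving a real analytic volume form on $\mathcal{C}=\mathbb{S}^1\times\mathbb{S}^1\setminus\Delta$. Then $\rho$ is analytically Fuchsian.
   Context: $\mathrm{Diff}^\omega(\mathbb{S}^1)$ is the group of orientation-preserving real analytic diffeomorphisms of $\mathbb{S}^1$; $\Delta$ is the diagonal. $\mathrm{PSL}(2,\mathbb{R})$ is identified with its image in $\mathrm{Diff}^\omega(\mathbb{S}^1)$ under the projective action on $\mathbb{S}^1\approx\mathbb{R}\mathbb{P}^1$. $\rho$ is non elementary if $\rho(\Gamma)$ has no finite orbit on $\mathbb{S}^1$. $\rho$ preserves the volume form $\omega(x,y)\,dx\wedge dy$ (with $\omega>0$) if every $f\in\rho(\Gamma)$ satisfies $\omega(f(x),f(y))f'(x)f'(y)=\omega(x,y)$ for all $x\neq y$. $\rho$ is analytically Fuchsian if there is $h\in\mathrm{Diff}^\omega(\mathbb{S}^1)$ with $h^{-1}\rho(\Gamma)h\subset\mathrm{PSL}(2,\mathbb{R})$. *)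

theory Defs
  imports "HOL-Analysis.Analysis" "HOL-Algebra.Bij"
begin

definition real_analytic_at :: "(real \<Rightarrow> real) \<Rightarrow> real \<Rightarrow> bool" where
  "real_analytic_at F t \<longleftrightarrow>
     (\<exists>a r. 0 < r \<and> (\<forall>h. \<bar>h\<bar> < r \<longrightarrow> (\<lambda>n. a n * h ^ n) sums F (t + h)))"

definition real_analytic2_at :: "(real \<Rightarrow> real \<Rightarrow> real) \<Rightarrow> real \<Rightarrow> real \<Rightarrow> bool" where
  "real_analytic2_at F s t \<longleftrightarrow>
     (\<exists>a r. 0 < r \<and> (\<forall>h k. \<bar>h\<bar> < r \<longrightarrow> \<bar>k\<bar> < r \<longrightarrow>
        ((\<lambda>(m, n). a m n * h ^ m * k ^ n) has_sum F (s + h) (t + k)) (UNIV :: (nat \<times> nat) set)))"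

abbreviation circle :: "complex set" where
  "circle \<equiv> sphere 0 1"

text \<open>
  The analytic structure and the orientation of the circle are those for which
  \<open>cis\<close> is an orientation preserving, locally diffeomorphic covering by the line.
  Since the line is simply connected, every continuous circle map has a continuous lift
  to the line, any two lifts differ by a constant, and the map is real analytic
  exactly when its lifts are.
\<close>

definition circle_lift :: "(real \<Rightarrow> real) \<Rightarrow> (complex \<Rightarrow> complex) \<Rightarrow> bool" where
  "circle_lift F f \<longleftrightarrow> continuous_on UNIV F \<and> (\<forall>t. f (cis t) = cis (F t))"

definition circle_analytic :: "(complex \<Rightarrow> complex) \<Rightarrow> bool" where
  "circle_analytic f \<longleftrightarrow> (\<exists>F. circle_lift F f \<and> (\<forall>t. real_analytic_at F t))"

definition orientation_preserving :: "(complex \<Rightarrow> complex) \<Rightarrow> bool" where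
  "orientation_preserving f \<longleftrightarrow> (\<exists>F. circle_lift F f \<and> strict_mono F)"

text \<open>
  Elements are represented as functions that are \<open>undefined\<close> off the circle
  (the convention of \<^const>\<open>BijGroup\<close>), so that equality is equality of circle maps.
\<close>

definition Diff_omega :: "(complex \<Rightarrow> complex) monoid" where
  "Diff_omega = BijGroup circle \<lparr>carrier :=
     {f \<in> Bij circle. circle_analytic f \<and> circle_analytic (inv_into circle f)
        \<and> orientation_preserving f}\<rparr>"

text \<open>
  The derivative of a circle map with respect to the angular coordinate \<open>\<theta>\<close>
  (where \<open>z = cis \<theta>\<close>, so \<open>d\<theta> = dz / (\<i> z)\<close>).  It is
  the derivative of any lift, see \<open>circle_deriv_lift\<close>.
\<close>

definition circle_deriv :: "(complex \<Rightarrow> complex) \<Rightarrow> complex \<Rightarrow> real" where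
  "circle_deriv f z =
     Re (vector_derivative (\<lambda>t. f (cis t)) (at (Arg z)) / (\<i> * f z))"

lemma circle_deriv_lift:
  assumes "circle_lift F f" and "(F has_real_derivative d) (at t)"
  shows "circle_deriv f (cis t) = d"
proof -
  have f: "f (cis s) = cis (F s)" for s
    using assms(1) by (auto simp: circle_lift_def)
  define u where "u = Arg (cis t)"
  have cu: "cis u = cis t" by (simp add: u_def cis_Arg sgn_div_norm)
  then obtain n :: int where n: "t = u + 2 * pi * n"
    by (metis cis_conv_exp complex_eq_cancel_iff2 exp_eq  sin_cos_eq_iff cis.sel)
  have F': "((\<lambda>s. F (s + 2 * pi * n)) has_real_derivative d) (at u)"
    using assms(2) n DERIV_shift[of F d u "2 * pi * n"] by simp
  have g: "(\<lambda>s. f (cis s)) = (\<lambda>s. cis (F (s + 2 * pi * n)))"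
  proof
    fix s
    have "cis (s + 2 * pi * n) = cis s"
      by (simp flip: cis_mult)
    then show "f (cis s) = cis (F (s + 2 * pi * n))" using f by metis
  qed
  have "((\<lambda>s. cis (F (s + 2 * pi * n))) has_vector_derivative d *\<^sub>R (\<i> * cis (F t))) (at u)"
    unfolding has_vector_derivative_def
    using has_derivative_cis[OF F'[unfolded has_field_derivative_def]]
    by (simp add: n scaleR_conv_of_real algebra_simps)
  then have "vector_derivative (\<lambda>s. f (cis s)) (at u) = d *\<^sub>R (\<i> * cis (F t))"
    unfolding g by (rule vector_derivative_at)
  then show ?thesis
    unfolding circle_deriv_def u_def[symmetric] by (simp add: f scaleR_conv_of_real)
qed

text \<open>
  The identification of the real projective line with the circle: the line spanned by
  \<open>(u, v)\<close> corresponds to \<open>(u + \<i> v)\<^sup>2 / (u\<^sup>2 + v\<^sup>2)\<close>.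
  Each matrix of determinant one then acts on the circle by exactly one extensional
  function, see \<open>PSL2R_action\<close>.
\<close>

definition line_to_circle :: "real ^ 2 \<Rightarrow> complex" where
  "line_to_circle v = (sgn (Complex (v $ 1) (v $ 2)))\<^sup>2"

definition PSL2R :: "(complex \<Rightarrow> complex) set" where
  "PSL2R = {f \<in> extensional circle. \<exists>A :: real ^ 2 ^ 2. det A = 1 \<and>
     (\<forall>v. v \<noteq> 0 \<longrightarrow> f (line_to_circle v) = line_to_circle (A *v v))}"

lemma line_to_circle_eq_iff:
  assumes "v \<noteq> 0" "w \<noteq> 0"
  shows "line_to_circle v = line_to_circle w \<longleftrightarrow> (\<exists>c. c \<noteq> 0 \<and> w = c *\<^sub>R v)"
proof
  let ?z = "\<lambda>v::real^2. Complex (v $ 1) (v $ 2)"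
  have inj: "?z x = ?z y \<longleftrightarrow> x = y" for x y :: "real^2"
    by (auto simp: vec_eq_iff forall_2)
  have sc: "?z (c *\<^sub>R x) = c *\<^sub>R ?z x" for c x
    by (simp add: complex_eq_iff)
  have nz: "?z x \<noteq> 0" if "x \<noteq> 0" for x
    using inj[of x 0] that by (auto simp: zero_complex.code)
  {
    assume "line_to_circle v = line_to_circle w"
    then have "sgn (?z w) = sgn (?z v) \<or> sgn (?z w) = - sgn (?z v)"
      by (metis line_to_circle_def power2_eq_iff)
    then obtain e :: real where e: "e \<noteq> 0" "sgn (?z w) = e *\<^sub>R sgn (?z v)"
      by (metis scaleR_one scaleR_minus1_left zero_neq_neg_one zero_neq_one)
    have "?z w = norm (?z w) *\<^sub>R sgn (?z w)"
      using nz[OF assms(2)] by (simp add: sgn_div_norm)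
    also have "\<dots> = (norm (?z w) * e / norm (?z v)) *\<^sub>R ?z v"
      unfolding e(2) by (simp add: sgn_div_norm field_simps)
    finally have "w = (norm (?z w) * e / norm (?z v)) *\<^sub>R v"
      by (simp only: sc[symmetric] inj)
    moreover have "norm (?z w) * e / norm (?z v) \<noteq> 0"
      using nz assms e by simp
    ultimately show "\<exists>c. c \<noteq> 0 \<and> w = c *\<^sub>R v" by blast
  }
  assume "\<exists>c. c \<noteq> 0 \<and> w = c *\<^sub>R v"
  then obtain c where c: "c \<noteq> 0" "w = c *\<^sub>R v" by blast
  have "(sgn (?z w))\<^sup>2 = (sgn c)\<^sup>2 *\<^sub>R (sgn (?z v))\<^sup>2"
    unfolding c(2) sc sgn_scaleR by (simp add: power2_eq_square)
  also have "(sgn c)\<^sup>2 = 1" using c(1) by (simp add: sgn_if)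
  finally show "line_to_circle v = line_to_circle w"
    by (simp add: line_to_circle_def)
qed

lemma line_to_circle_image: "line_to_circle ` (- {0}) = circle"
proof
  show "line_to_circle ` (- {0}) \<subseteq> circle"
  proof
    fix z assume "z \<in> line_to_circle ` (- {0})"
    then obtain v where v: "v \<noteq> 0" "z = line_to_circle v" by blast
    have "Complex (v $ 1) (v $ 2) \<noteq> 0"
      using v(1) by (auto simp: vec_eq_iff forall_2 complex_eq_iff)
    then show "z \<in> circle"
      by (simp add: v(2) line_to_circle_def norm_power norm_sgn)
  qed
  show "circle \<subseteq> line_to_circle ` (- {0})"
  proof
    fix z :: complex assume "z \<in> circle"
    then have z: "norm z = 1" by simp
    let ?v = "vector [Re (csqrt z), Im (csqrt z)] :: real^2"
    have "norm (csqrt z) = 1" using z by simp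
    then have "sgn (csqrt z) = csqrt z" by (simp only: sgn_div_norm) simp
    moreover have "Complex (?v $ 1) (?v $ 2) = csqrt z"
      by (simp only: vector_2 complex_surj)
    ultimately have "line_to_circle ?v = z"
      by (simp only: line_to_circle_def power2_csqrt)
    moreover have "?v \<noteq> 0"
    proof
      assume "?v = 0"
      then have "?v $ 1 = 0" "?v $ 2 = 0" by simp_all
      then have "csqrt z = 0" by (simp only: vector_2 complex_eq_iff zero_complex.sel)
      then show False using z by simp
    qed
    ultimately show "z \<in> line_to_circle ` (- {0})" by force
  qed
qed

lemma PSL2R_action:
  fixes A :: "real ^ 2 ^ 2"
  assumes "det A = 1"
  shows "\<exists>!f. f \<in> extensional circle \<and>
           (\<forall>v. v \<noteq> 0 \<longrightarrow> f (line_to_circle v) = line_to_circle (A *v v))"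
proof -
  define p where "p z = (SOME v. v \<noteq> 0 \<and> line_to_circle v = z)" for z
  have p: "p z \<noteq> 0 \<and> line_to_circle (p z) = z" if "z \<in> circle" for z
  proof -
    have "\<exists>v. v \<noteq> 0 \<and> line_to_circle v = z"
      using that line_to_circle_image by (force simp: image_iff)
    then show ?thesis unfolding p_def by (rule someI_ex)
  qed
  have inv: "A *v v \<noteq> 0" if "v \<noteq> 0" for v
    using assms that invertible_det_nz[of A] matrix_left_invertible_ker[of A]
      invertible_left_inverse[of A] by auto
  let ?f = "\<lambda>z\<in>circle. line_to_circle (A *v p z)"
  have f: "?f (line_to_circle v) = line_to_circle (A *v v)" if v: "v \<noteq> 0" for v
  proof -
    have c: "line_to_circle v \<in> circle" using v line_to_circle_image by blast
    from p[OF c] obtain k where k: "k \<noteq> 0" "v = k *\<^sub>R p (line_to_circle v)"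
      using line_to_circle_eq_iff v by metis
    have "A *v v = k *\<^sub>R (A *v p (line_to_circle v))"
      by (subst k(2)) (simp add: scaleR_matrix_vector_assoc matrix_vector_mult_scaleR)
    then have "line_to_circle (A *v p (line_to_circle v)) = line_to_circle (A *v v)"
      using line_to_circle_eq_iff inv v p[OF c] k(1) by blast
    then show ?thesis using c by simp
  qed
  show ?thesis
  proof (rule ex1I[of _ ?f])
    show "?f \<in> extensional circle \<and>
        (\<forall>v. v \<noteq> 0 \<longrightarrow> ?f (line_to_circle v) = line_to_circle (A *v v))"
      using f by auto
    fix g assume g: "g \<in> extensional circle \<and>
        (\<forall>v. v \<noteq> 0 \<longrightarrow> g (line_to_circle v) = line_to_circle (A *v v))"
    show "g = ?f"
    proof (rule extensionalityI[of _ circle])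
      fix z :: complex assume "z \<in> circle"
      then show "g z = ?f z" using g p by (metis restrict_apply')
    qed (use g in auto)
  qed
qed

definition non_elementary :: "('g, 'm) monoid_scheme \<Rightarrow> ('g \<Rightarrow> complex \<Rightarrow> complex) \<Rightarrow> bool" where
  "non_elementary \<Gamma> \<rho> \<longleftrightarrow> \<not> (\<exists>x\<in>circle. finite {f x |f. f \<in> \<rho> ` carrier \<Gamma>})"

text \<open>
  The form \<open>\<omega>(x,y) dx \<and> dy\<close> is given by its density in angular coordinates;
  only the values of \<open>\<omega>\<close> at pairs of distinct points of the circle matter.
\<close>

definition analytic_volume_form :: "(complex \<Rightarrow> complex \<Rightarrow> real) \<Rightarrow> bool" where
  "analytic_volume_form \<omega> \<longleftrightarrow>
     (\<forall>x\<in>circle. \<forall>y\<in>circle. x \<noteq> y \<longrightarrow> 0 < \<omega> x y) \<and>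
     (\<forall>s t. cis s \<noteq> cis t \<longrightarrow> real_analytic2_at (\<lambda>s t. \<omega> (cis s) (cis t)) s t)"

definition preserves_volume_form ::
  "('g, 'm) monoid_scheme \<Rightarrow> ('g \<Rightarrow> complex \<Rightarrow> complex) \<Rightarrow> (complex \<Rightarrow> complex \<Rightarrow> real) \<Rightarrow> bool"
where
  "preserves_volume_form \<Gamma> \<rho> \<omega> \<longleftrightarrow>
     (\<forall>f \<in> \<rho> ` carrier \<Gamma>. \<forall>x\<in>circle. \<forall>y\<in>circle. x \<noteq> y \<longrightarrow>
        \<omega> (f x) (f y) * circle_deriv f x * circle_deriv f y = \<omega> x y)"

definition analytically_Fuchsian ::
  "('g, 'm) monoid_scheme \<Rightarrow> ('g \<Rightarrow> complex \<Rightarrow> complex) \<Rightarrow> bool" where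
  "analytically_Fuchsian \<Gamma> \<rho> \<longleftrightarrow>
     (\<exists>h \<in> carrier Diff_omega.
        (\<lambda>f. inv\<^bsub>Diff_omega\<^esub> h \<otimes>\<^bsub>Diff_omega\<^esub> f \<otimes>\<^bsub>Diff_omega\<^esub> h) ` \<rho> ` carrier \<Gamma> \<subseteq> PSL2R)"

end

theory Submission
  imports Defs "HOL-Complex_Analysis.Complex_Analysis"
begin

text \<open>
  Lift everything to the line: the group becomes a group \<open>H\<close> of diffeomorphisms commuting with
  \<open>t \<mapsto> t + 2\<pi>\<close> that preserves a density \<open>\<Omega> s t\<close>, and it suffices to find an analytic coordinate
  \<open>\<Phi>\<close> of the circle in which \<open>H\<close> is projective.

  If \<open>H\<close> acts freely it is abelian by Hoelder's theorem, and for \<open>f \<in> H\<close> moving every point of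
  the circle the length element \<open>sqrt (\<Omega> t (f t) * f' t) dt\<close> is \<open>H\<close>-invariant; arc length is then
  a coordinate in which \<open>H\<close> consists of rotations.

  Otherwise a ping-pong argument gives \<open>f \<in> H\<close> with two fixed points \<open>a\<close> and \<open>b\<close> on the circle.
  A primitive of \<open>\<Omega> a\<close> linearises \<open>f\<close> on the complement of \<open>a\<close>, with a multiplier different from 1,
  so this chart is onto the line and the dynamics of \<open>f\<close> force the (invariant, analytic) curvature
  of \<open>\<Omega> ds dt\<close> to be constant on \<open>s \<mapsto> (s, b)\<close>, hence on all \<open>s \<mapsto> (s, g b)\<close>, hence everywhere.
  Constant curvature means that the primitives of \<open>\<Omega> x\<close> and \<open>\<Omega> y\<close> have the same
  Schwarzian derivative, so they differ by a Moebius map: they are the charts of an \<open>H\<close>-invariant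
  projective structure. Three points with charts onto the line force its monodromy to be trivial.
\<close>

subsection \<open>Real analytic functions of one variable\<close>

text \<open>The case distinction is forced: any positive periodic function of \<open>t - s\<close>
  is a density invariant under all rotations, so for rotation-like groups the curvature need not be
  constant and need not yield a projective structure. The substitute is the graph of an element
  \<open>f\<close>, an \<open>H\<close>-invariant curve because \<open>H\<close> is abelian; read as
  a Lorentz metric, the form induces the length element on it.

  In the other case equal Schwarzians only give some projective structure on the circle, and such a
  structure may have non-trivial monodromy or wind several times. Completeness removes this
  obstacle: if the chart at \<open>x\<close> is onto the line, one full turn starting at
  \<open>x\<close> develops to exactly one turn of the projective line, so the monodromy fixes the
  image of \<open>x\<close>, and a projective map with three fixed points is the identity.
  Completeness is \<open>H\<close>-invariant, so one complete point gives infinitely many.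

  Analyticity does more than give the regularity of the result: it spreads constant curvature from
  an accumulating family of lines to all pairs, and projective relations from one arc to the whole
  circle.\<close>

lemma real_analytic_at_iff:
  "real_analytic_at F t \<longleftrightarrow>
     (\<exists>f. f analytic_on {of_real t} \<and> (\<forall>\<^sub>F x in nhds t. f (of_real x) = of_real (F x)))"
proof
  assume "real_analytic_at F t"
  then obtain a r where r: "0 < r" and a: "\<And>h. \<bar>h\<bar> < r \<Longrightarrow> (\<lambda>n. a n * h ^ n) sums F (t + h)"
    unfolding real_analytic_at_def by blast
  define c where "c n = complex_of_real (a n)" for n
  define f where "f z = (\<Sum>n. c n * (z - of_real t) ^ n)" for z
  have summ: "summable (\<lambda>n. c n * (z - of_real t) ^ n)" if "z \<in> ball (of_real t) r" for z
  proof -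
    have n: "norm (z - of_real t) < r" using that by (simp add: dist_norm norm_minus_commute)
    \<comment> \<open>The hypothesis gives convergence at real points only. It applies to the real
      number \<open>K\<close>, which exceeds \<open>norm (z - of_real t)\<close>, and hence gives
      convergence at \<open>z\<close>.\<close>
    define K where "K = (norm (z - of_real t) + r) / 2"
    have K: "norm (z - of_real t) < K" "\<bar>K\<bar> < r" "0 < K"
      using n norm_ge_zero[of "z - of_real t"] r by (simp_all add: K_def abs_less_iff field_simps add_pos_nonneg)
    have "summable (\<lambda>n. a n * K ^ n)" using a[OF K(2)] sums_summable by blast
    then have "summable (\<lambda>n. c n * of_real K ^ n)"
      using summable_of_real[of "\<lambda>n. a n * K ^ n", where 'a=complex] by (simp add: c_def)
    then show ?thesis by (rule powser_inside) (use K in simp)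
  qed
  have "f analytic_on ball (of_real t) r"
    by (rule power_series_analytic[of _ _ c]) (use summ in \<open>auto simp: f_def intro: summable_sums\<close>)
  then have "f analytic_on {of_real t}" using r by (meson analytic_on_subset centre_in_ball empty_subsetI insert_subset)
  moreover have "\<forall>\<^sub>F x in nhds t. f (of_real x) = of_real (F x)"
    unfolding eventually_nhds_metric
  proof (intro exI[of _ r] conjI allI impI r)
    fix x assume "dist x t < r"
    then have "(\<lambda>n. a n * (x - t) ^ n) sums F x" using a[of "x - t"] by (simp add: dist_real_def)
    then have "(\<lambda>n. c n * (of_real x - of_real t) ^ n) sums of_real (F x)"
      using sums_of_real[of "\<lambda>n. a n * (x - t) ^ n" "F x", where 'a=complex] by (simp add: c_def)
    then show "f (of_real x) = of_real (F x)" unfolding f_def by (rule sums_unique[symmetric])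
  qed
  ultimately show "\<exists>f. f analytic_on {of_real t} \<and> (\<forall>\<^sub>F x in nhds t. f (of_real x) = of_real (F x))"
    by blast
next
  assume "\<exists>f. f analytic_on {of_real t} \<and> (\<forall>\<^sub>F x in nhds t. f (of_real x) = of_real (F x))"
  then obtain f e d where e: "0 < e" "f holomorphic_on ball (of_real t) e"
    and d: "0 < d" "\<And>x. dist x t < d \<Longrightarrow> f (of_real x) = of_real (F x)"
    unfolding analytic_at_ball eventually_nhds_metric by blast
  \<comment> \<open>For real \<open>h\<close> the powers are real, so the real parts of the Taylor
    coefficients of the extension already sum to \<open>F\<close>.\<close>
  let ?a = "\<lambda>n. Re ((deriv ^^ n) f (of_real t) / fact n)"
  have "(\<lambda>n. ?a n * h ^ n) sums F (t + h)" if h: "\<bar>h\<bar> < min d e" for h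
  proof -
    have "of_real (t + h) \<in> ball (complex_of_real t) e"
      using h by (simp add: dist_norm norm_minus_commute)
    from holomorphic_power_series[OF e(2) this]
    have "(\<lambda>n. (deriv ^^ n) f (of_real t) / fact n * of_real (h ^ n)) sums of_real (F (t + h))"
      using d(2)[of "t + h"] h by (simp add: dist_real_def)
    from sums_Re[OF this] show ?thesis by (simp only: Re_complex_of_real times_complex.sel
      Im_complex_of_real mult_zero_right diff_0_right)
  qed
  then show "real_analytic_at F t" unfolding real_analytic_at_def
    using d(1) e(1) by (intro exI[of _ ?a] exI[of _ "min d e"]) auto
qed

lemma real_analytic_at_cong:
  assumes "\<forall>\<^sub>F x in nhds t. F x = G x" "real_analytic_at F t"
  shows "real_analytic_at G t"
proof -
  obtain f where f: "f analytic_on {of_real t}" "\<forall>\<^sub>F x in nhds t. f (of_real x) = of_real (F x)"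
    using assms(2) unfolding real_analytic_at_iff by blast
  have "\<forall>\<^sub>F x in nhds t. f (of_real x) = of_real (G x)"
    using f(2) assms(1) by eventually_elim simp
  with f(1) show ?thesis unfolding real_analytic_at_iff by blast
qed

lemma real_analytic_at_DERIV:
  assumes "real_analytic_at F t"
  shows "(F has_real_derivative deriv F t) (at t)"
proof -
  obtain a r where r: "0 < r" and a: "\<And>h. \<bar>h\<bar> < r \<Longrightarrow> (\<lambda>n. a n * h ^ n) sums F (t + h)"
    using assms unfolding real_analytic_at_def by blast
  have "((\<lambda>h. \<Sum>n. a n * h ^ n) has_real_derivative (\<Sum>n. diffs a n * 0 ^ n)) (at 0)"
    by (rule termdiffs_strong'[of r]) (use a r in \<open>auto intro: sums_summable\<close>)
  then have "((\<lambda>h. F (t + h)) has_real_derivative (\<Sum>n. diffs a n * 0 ^ n)) (at 0)"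
    by (rule has_field_derivative_transform_within[OF _ r])
       (auto intro!: sums_unique[symmetric] a)
  then have "(F has_real_derivative (\<Sum>n. diffs a n * 0 ^ n)) (at t)"
    using DERIV_shift[of F _ 0 t] by (simp add: add.commute)
  then show ?thesis by (metis DERIV_imp_deriv)
qed

lemma real_analytic_at_isCont: "real_analytic_at F t \<Longrightarrow> isCont F t"
  using DERIV_isCont real_analytic_at_DERIV by blast

lemma real_analytic_at_const [simp]: "real_analytic_at (\<lambda>x. c) t"
  unfolding real_analytic_at_iff by (rule exI[of _ "\<lambda>_. of_real c"]) auto

lemma real_analytic_at_ident [simp]: "real_analytic_at (\<lambda>x. x) t"
  unfolding real_analytic_at_iff by (rule exI[of _ "\<lambda>z. z"]) auto

lemma real_analytic_at_add:
  assumes "real_analytic_at F t" "real_analytic_at G t"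
  shows "real_analytic_at (\<lambda>x. F x + G x) t"
proof -
  obtain f g where f: "f analytic_on {of_real t}" "\<forall>\<^sub>F x in nhds t. f (of_real x) = of_real (F x)"
    and g: "g analytic_on {of_real t}" "\<forall>\<^sub>F x in nhds t. g (of_real x) = of_real (G x)"
    using assms unfolding real_analytic_at_iff by blast
  have "\<forall>\<^sub>F x in nhds t. f (of_real x) + g (of_real x) = of_real (F x + G x)"
    using f(2) g(2) by eventually_elim simp
  then show ?thesis unfolding real_analytic_at_iff
    using analytic_on_add[OF f(1) g(1)] by (intro exI[of _ "\<lambda>z. f z + g z"]) blast
qed

lemma real_analytic_at_mult:
  assumes "real_analytic_at F t" "real_analytic_at G t"
  shows "real_analytic_at (\<lambda>x. F x * G x) t"
proof -
  obtain f g where f: "f analytic_on {of_real t}" "\<forall>\<^sub>F x in nhds t. f (of_real x) = of_real (F x)"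
    and g: "g analytic_on {of_real t}" "\<forall>\<^sub>F x in nhds t. g (of_real x) = of_real (G x)"
    using assms unfolding real_analytic_at_iff by blast
  have "\<forall>\<^sub>F x in nhds t. f (of_real x) * g (of_real x) = of_real (F x * G x)"
    using f(2) g(2) by eventually_elim simp
  then show ?thesis unfolding real_analytic_at_iff
    using analytic_on_mult[OF f(1) g(1)] by (intro exI[of _ "\<lambda>z. f z * g z"]) blast
qed

lemma real_analytic_at_compose:
  assumes "real_analytic_at F t" "real_analytic_at G (F t)"
  shows "real_analytic_at (\<lambda>x. G (F x)) t"
proof -
  obtain f g where f: "f analytic_on {of_real t}" "\<forall>\<^sub>F x in nhds t. f (of_real x) = of_real (F x)"
    and g: "g analytic_on {of_real (F t)}" "\<forall>\<^sub>F y in nhds (F t). g (of_real y) = of_real (G y)"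
    using assms unfolding real_analytic_at_iff by blast
  have ft: "f (of_real t) = of_real (F t)" using f(2) by (rule eventually_nhds_x_imp_x)
  have "(F \<longlongrightarrow> F t) (nhds t)"
    using real_analytic_at_isCont[OF assms(1)] by (simp add: isCont_def tendsto_at_iff_tendsto_nhds)
  then have "\<forall>\<^sub>F x in nhds t. g (of_real (F x)) = of_real (G (F x))"
    using g(2) filterlim_iff by blast
  with f(2) have "\<forall>\<^sub>F x in nhds t. (g \<circ> f) (of_real x) = of_real (G (F x))"
    by eventually_elim simp
  moreover have "(g \<circ> f) analytic_on {of_real t}"
    by (rule analytic_on_compose[OF f(1)]) (use g(1) ft in auto)
  ultimately show ?thesis unfolding real_analytic_at_iff by blast
qed

lemma real_analytic_at_of_complex:
  assumes "f analytic_on {of_real t}" "\<forall>\<^sub>F x in nhds t. f (of_real x) = of_real (F x)"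
  shows "real_analytic_at F t"
  using assms real_analytic_at_iff by blast

lemma real_analytic_at_uminus: "real_analytic_at F t \<Longrightarrow> real_analytic_at (\<lambda>x. - F x) t"
  using real_analytic_at_mult[OF real_analytic_at_const[of "-1"], of F t] by simp

lemma real_analytic_at_diff:
  "real_analytic_at F t \<Longrightarrow> real_analytic_at G t \<Longrightarrow> real_analytic_at (\<lambda>x. F x - G x) t"
  using real_analytic_at_add[OF _ real_analytic_at_uminus, of F t G] by simp

lemma real_analytic_at_inverse:
  assumes "real_analytic_at F t" "F t \<noteq> 0"
  shows "real_analytic_at (\<lambda>x. inverse (F x)) t"
  by (rule real_analytic_at_compose[OF assms(1)], rule real_analytic_at_of_complex[of inverse])
     (use assms(2) in \<open>auto intro!: analytic_intros\<close>)

lemma real_analytic_at_divide: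
  "real_analytic_at F t \<Longrightarrow> real_analytic_at G t \<Longrightarrow> G t \<noteq> 0 \<Longrightarrow> real_analytic_at (\<lambda>x. F x / G x) t"
  using real_analytic_at_mult[OF _ real_analytic_at_inverse, of F t G] by (simp add: divide_inverse)

lemma real_analytic_at_power:
  "real_analytic_at F t \<Longrightarrow> real_analytic_at (\<lambda>x. F x ^ n) t"
  by (induction n) (auto intro: real_analytic_at_mult)

lemma real_analytic_at_sin: "real_analytic_at F t \<Longrightarrow> real_analytic_at (\<lambda>x. sin (F x)) t"
  by (erule real_analytic_at_compose, rule real_analytic_at_of_complex[of sin])
     (auto simp: sin_of_real intro!: analytic_intros)

lemma real_analytic_at_cos: "real_analytic_at F t \<Longrightarrow> real_analytic_at (\<lambda>x. cos (F x)) t"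
  by (erule real_analytic_at_compose, rule real_analytic_at_of_complex[of cos])
     (auto simp: cos_of_real intro!: analytic_intros)

lemma real_analytic_at_sqrt:
  assumes "real_analytic_at F t" "F t > 0"
  shows "real_analytic_at (\<lambda>x. sqrt (F x)) t"
proof (rule real_analytic_at_compose[OF assms(1)], rule real_analytic_at_of_complex[of csqrt])
  show "csqrt analytic_on {of_real (F t)}"
    using assms(2) by (auto intro!: analytic_intros simp: complex_nonpos_Reals_iff)
  have "\<forall>\<^sub>F x in nhds (F t). x > 0" using assms(2) by (simp add: eventually_gt_at_top order_tendstoD eventually_nhds_in_open[of "{0<..}", simplified])
  then show "\<forall>\<^sub>F x in nhds (F t). csqrt (of_real x) = of_real (sqrt x)"
    by eventually_elim (simp add: csqrt_of_real_nonneg)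
qed

text \<open>A holomorphic primitive of the extension of \<open>f\<close> exists on a disc, and its
  real part on the axis differs from \<open>F\<close> by a constant. Arc length, charts and
  \<open>arctan\<close> become analytic this way.\<close>

lemma real_analytic_at_primitive:
  assumes "\<forall>\<^sub>F x in nhds t. (F has_real_derivative f x) (at x)" "real_analytic_at f t"
  shows "real_analytic_at F t"
proof -
  obtain g e d where e: "0 < e" "g holomorphic_on ball (of_real t) e"
    and d: "0 < d" "\<And>x. dist x t < d \<Longrightarrow> g (of_real x) = of_real (f x)"
    using assms(2) unfolding real_analytic_at_iff analytic_at_ball eventually_nhds_metric by blast
  obtain d' where d': "0 < d'" "\<And>x. dist x t < d' \<Longrightarrow> (F has_real_derivative f x) (at x)"
    using assms(1) unfolding eventually_nhds_metric by blast
  obtain G where G: "\<And>z. z \<in> ball (of_real t) e \<Longrightarrow> (G has_field_derivative g z) (at z within ball (of_real t) e)"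
    using holomorphic_convex_primitive'[OF convex_ball open_ball e(2)] by blast
  define m where "m = min e (min d d')"
  have m: "m > 0" using e d d' by (simp add: m_def)
  have hol: "G holomorphic_on ball (of_real t) e" using G holomorphic_on_def field_differentiable_def by blast
  have GD: "((\<lambda>x. Re (G (of_real x)) - F x) has_real_derivative 0) (at x)" if "dist x t < m" for x
  proof -
    have xb: "of_real x \<in> ball (complex_of_real t) e"
      using that by (simp add: m_def dist_commute)
    then have "(G has_field_derivative of_real (f x)) (at (of_real x))"
      using G[OF xb] d(2)[of x] that at_within_open[OF xb] by (simp add: m_def)
    then have "((\<lambda>x. G (of_real x)) has_vector_derivative of_real (f x)) (at x)"
      using field_vector_diff_chain_at[OF has_vector_derivative_of_real[OF DERIV_ident], of G "of_real (f x)" x]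
      by (simp add: o_def)
    from bounded_linear.has_vector_derivative[OF bounded_linear_Re this]
    have "((\<lambda>x. Re (G (of_real x))) has_vector_derivative f x) (at x)"
      by (simp only: Re_complex_of_real)
    then have "((\<lambda>x. Re (G (of_real x))) has_real_derivative f x) (at x)"
      unfolding has_real_derivative_iff_has_vector_derivative .
    from DERIV_diff[OF this d'(2)[of x]] show ?thesis using that by (simp add: m_def)
  qed
  have eq: "Re (G (of_real x)) - F x = Re (G (of_real t)) - F t" if "dist x t < m" for x
  proof (rule DERIV_zero_connected_constant[of "ball t m" "{}"])
    show "continuous_on (ball t m) (\<lambda>x. Re (G (of_real x)) - F x)"
      by (intro continuous_at_imp_continuous_on ballI DERIV_isCont[OF GD]) (simp add: dist_commute)
  qed (use that m GD in \<open>auto simp: dist_commute\<close>)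
  have "real_analytic_at (\<lambda>x. Re (G (of_real x)) + (F t - Re (G (of_real t)))) t"
  proof (rule real_analytic_at_add[OF _ real_analytic_at_const])
    let ?a = "\<lambda>n. Re ((deriv ^^ n) G (of_real t) / fact n)"
    have "(\<lambda>n. ?a n * h ^ n) sums Re (G (of_real (t + h)))" if h: "\<bar>h\<bar> < e" for h
    proof -
      have "of_real (t + h) \<in> ball (complex_of_real t) e"
        using h by (simp add: dist_norm norm_minus_commute)
      from holomorphic_power_series[OF hol this]
      have "(\<lambda>n. (deriv ^^ n) G (of_real t) / fact n * of_real (h ^ n)) sums G (of_real (t + h))"
        by simp
      from sums_Re[OF this] show ?thesis by (simp only: Re_complex_of_real times_complex.sel
        Im_complex_of_real mult_zero_right diff_0_right)
    qed
    then show "real_analytic_at (\<lambda>x. Re (G (of_real x))) t"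
      unfolding real_analytic_at_def using e(1) by (intro exI[of _ ?a] exI[of _ e]) auto
  qed
  moreover have "\<forall>\<^sub>F x in nhds t. Re (G (of_real x)) + (F t - Re (G (of_real t))) = F x"
    unfolding eventually_nhds_metric
  proof (intro exI[of _ m] conjI allI impI m)
    fix x assume "dist x t < m"
    from eq[OF this] show "Re (G (of_real x)) + (F t - Re (G (of_real t))) = F x" by linarith
  qed
  ultimately show ?thesis by (rule real_analytic_at_cong[rotated])
qed

lemma real_analytic_at_arctan: "real_analytic_at F t \<Longrightarrow> real_analytic_at (\<lambda>x. arctan (F x)) t"
proof (erule real_analytic_at_compose, rule real_analytic_at_primitive)
  show "\<forall>\<^sub>F x in nhds (F t). (arctan has_real_derivative inverse (1 + x\<^sup>2)) (at x)"
    by (simp add: DERIV_arctan)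
  show "real_analytic_at (\<lambda>x. inverse (1 + x\<^sup>2)) (F t)"
    by (intro real_analytic_at_inverse real_analytic_at_add real_analytic_at_power)
       (auto simp: add_nonneg_eq_0_iff)
qed

lemma real_analytic_at_deriv:
  assumes "real_analytic_at F t"
  shows "real_analytic_at (deriv F) t"
proof -
  obtain a r where r: "0 < r" and a: "\<And>h. \<bar>h\<bar> < r \<Longrightarrow> (\<lambda>n. a n * h ^ n) sums F (t + h)"
    using assms unfolding real_analytic_at_def by blast
  have "(\<lambda>n. diffs a n * h ^ n) sums deriv F (t + h)" if h: "\<bar>h\<bar> < r" for h
  proof -
    have D: "((\<lambda>h. \<Sum>n. a n * h ^ n) has_real_derivative (\<Sum>n. diffs a n * h ^ n)) (at h)"
      by (rule termdiffs_strong'[of r]) (use a h in \<open>auto intro: sums_summable\<close>)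
    have "((\<lambda>h. F (t + h)) has_real_derivative (\<Sum>n. diffs a n * h ^ n)) (at h)"
    proof (rule has_field_derivative_transform_within[OF D, of "r - \<bar>h\<bar>"])
      fix x assume "dist x h < r - \<bar>h\<bar>"
      then have "\<bar>x\<bar> < r" by (simp add: dist_real_def)
      then show "(\<Sum>n. a n * x ^ n) = F (t + x)" by (intro sums_unique[symmetric] a)
    qed (use h in auto)
    then have "(F has_real_derivative (\<Sum>n. diffs a n * h ^ n)) (at (t + h))"
      using DERIV_shift[of F _ h t] by (simp add: add.commute)
    then have "deriv F (t + h) = (\<Sum>n. diffs a n * h ^ n)" by (rule DERIV_imp_deriv)
    moreover have "summable (\<lambda>n. diffs a n * h ^ n)"
      by (rule termdiff_converges[of h r]) (use h a in \<open>auto intro: sums_summable\<close>)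
    ultimately show ?thesis by (metis summable_sums)
  qed
  then show ?thesis unfolding real_analytic_at_def using r by blast
qed

text \<open>The complex derivative of the extension at \<open>t\<close> equals the real one, so it
  is non-zero and the extension has a holomorphic local inverse.\<close>

lemma real_analytic_at_inverse_function:
  assumes F: "real_analytic_at F t" "deriv F t \<noteq> 0"
    and G: "\<forall>\<^sub>F x in nhds t. G (F x) = x" "isCont G (F t)" "\<forall>\<^sub>F y in nhds (F t). F (G y) = y"
  shows "real_analytic_at G (F t)"
proof -
  obtain f where f: "f analytic_on {of_real t}" "\<forall>\<^sub>F x in nhds t. f (of_real x) = of_real (F x)"
    using F(1) unfolding real_analytic_at_iff by blast
  obtain e where e: "0 < e" "f holomorphic_on ball (of_real t) e"
    using f(1) analytic_at_ball by blast
  have fD: "(f has_field_derivative deriv f (of_real t)) (at (of_real t))"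
    using e by (meson centre_in_ball holomorphic_derivI open_ball)
  have ft: "f (of_real t) = of_real (F t)" using f(2) by (rule eventually_nhds_x_imp_x)
  have "((\<lambda>x. f (of_real x)) has_vector_derivative deriv f (of_real t)) (at t)"
    using field_vector_diff_chain_at[OF has_vector_derivative_of_real[OF DERIV_ident] fD]
    by (simp add: o_def)
  moreover have "((\<lambda>x. f (of_real x)) has_vector_derivative of_real (deriv F t)) (at t)"
  proof -
    have 1: "((\<lambda>x. of_real (F x)) has_vector_derivative (of_real (deriv F t) :: complex)) (at t)"
      using has_vector_derivative_of_real[OF real_analytic_at_DERIV[OF F(1)]] .
    obtain d where "0 < d" "\<And>x. dist x t < d \<Longrightarrow> f (of_real x) = of_real (F x)"
      using f(2) unfolding eventually_nhds_metric by blast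
    then show ?thesis
      by (intro has_vector_derivative_transform_within[OF 1, of d]) auto
  qed
  ultimately have "deriv f (of_real t) = of_real (deriv F t)"
    using vector_derivative_unique_at by blast
  then have nz: "deriv f (of_real t) \<noteq> 0" using F(2) by simp
  obtain r where r: "r > 0" "ball (complex_of_real t) r \<subseteq> ball (of_real t) e"
    "open (f ` ball (of_real t) r)" "inj_on f (ball (of_real t) r)"
  proof (rule has_complex_derivative_locally_invertible[OF e(2) _ open_ball nz])
    show "of_real t \<in> ball (complex_of_real t) e" using e(1) by simp
  qed (rule that)
  obtain g where g: "g holomorphic_on f ` ball (of_real t) r" "\<And>z. z \<in> ball (of_real t) r \<Longrightarrow> g (f z) = z"
  proof (rule holomorphic_has_inverse[OF holomorphic_on_subset[OF e(2) r(2)] open_ball r(4)])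
    fix g assume "g holomorphic_on f ` ball (of_real t) r"
      "\<And>z. z \<in> ball (of_real t) r \<Longrightarrow> g (f z) = z"
    then show thesis by (rule that)
  qed
  have "g analytic_on {of_real (F t)}"
    unfolding analytic_at
  proof (intro exI conjI)
    show "of_real (F t) \<in> f ` ball (of_real t) r"
      using r(1) by (intro image_eqI[of _ _ "of_real t"]) (auto simp: ft)
  qed (use g(1) r(3) in auto)
  moreover have "\<forall>\<^sub>F y in nhds (F t). g (of_real y) = of_real (G y)"
  proof -
    have Gt: "G (F t) = t" using G(1) by (rule eventually_nhds_x_imp_x)
    have lim: "(G \<longlongrightarrow> t) (nhds (F t))"
      using G(2)[unfolded isCont_def tendsto_at_iff_tendsto_nhds] by (simp only: Gt)
    have "\<forall>\<^sub>F x in nhds t. of_real x \<in> ball (complex_of_real t) r"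
      unfolding eventually_nhds_metric using r(1)
      by (auto simp: dist_commute)
    with f(2) have "\<forall>\<^sub>F x in nhds t. of_real x \<in> ball (complex_of_real t) r \<and> f (of_real x) = of_real (F x)"
      by eventually_elim simp
    then have "\<forall>\<^sub>F y in nhds (F t). of_real (G y) \<in> ball (complex_of_real t) r \<and> f (of_real (G y)) = of_real (F (G y))"
      using lim filterlim_iff by blast
    then show ?thesis using G(3)
    proof eventually_elim
      case (elim y)
      then show ?case using g(2)[of "of_real (G y)"] by simp
    qed
  qed
  ultimately show ?thesis unfolding real_analytic_at_iff by blast
qed

text \<open>At a limit point of zeros inside \<open>S\<close> a non-zero Taylor coefficient would
  isolate the zero; so the points near which \<open>F\<close> vanishes form a subset both open and
  closed in \<open>S\<close>.\<close>

lemma real_analytic_identity: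
  assumes S: "open S" "connected S" and F: "\<And>t. t \<in> S \<Longrightarrow> real_analytic_at F t"
    and p: "p \<in> S" "p islimpt {t \<in> S. F t = 0}"
    and t: "t \<in> S"
  shows "F t = 0"
proof -
  have loc: "\<forall>\<^sub>F x in nhds q. F x = 0" if q: "q \<in> S" "q islimpt {t \<in> S. F t = 0}" for q
  proof -
    obtain a r where r: "0 < r" and a: "\<And>h. \<bar>h\<bar> < r \<Longrightarrow> (\<lambda>n. a n * h ^ n) sums F (q + h)"
      using F[OF q(1)] unfolding real_analytic_at_def by blast

    have "F q = 0"
    proof (rule ccontr)
      assume "F q \<noteq> 0"
      then have "\<forall>\<^sub>F x in at q. F x \<noteq> 0"
        using real_analytic_at_isCont[OF F[OF q(1)]] isContD tendsto_imp_eventually_ne by blast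
      then show False using q(2) eventually_mono[of "\<lambda>x. F x \<noteq> 0" "at q" "\<lambda>y. y \<notin> {t \<in> S. F t = 0}"] unfolding islimpt_iff_eventually by blast
    qed
    have "a n = 0" for n
    proof (rule ccontr)
      assume an: "a n \<noteq> 0"
      have "a 0 = 0" using a[of 0] r \<open>F q = 0\<close> by (simp add: powser_sums_zero_iff)
      then have "n > 0" using an by (cases n) auto
      obtain s where s: "0 < s" "\<And>z. z \<in> cball q s - {q} \<Longrightarrow> F z \<noteq> 0"
        by (rule powser_0_nonzero[of r q a F n])
           (use r \<open>F q = 0\<close> an \<open>n > 0\<close> a[of "_ - q"] in auto)
      then have "\<forall>\<^sub>F x in at q. F x \<noteq> 0"
        unfolding eventually_at by (intro exI[of _ s]) (auto simp: dist_commute)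
      then show False using q(2) eventually_mono[of "\<lambda>x. F x \<noteq> 0" "at q" "\<lambda>y. y \<notin> {t \<in> S. F t = 0}"] unfolding islimpt_iff_eventually by blast
    qed
    then have "F x = 0" if "dist x q < r" for x
      using a[of "x - q"] that by (auto simp: dist_real_def dest: sums_unique2[OF sums_zero])
    then show ?thesis unfolding eventually_nhds_metric using r by blast
  qed
  let ?Z = "{x \<in> S. \<forall>\<^sub>F y in nhds x. F y = 0}"
  have "openin (top_of_set S) ?Z"
  proof -
    have "{x. \<forall>\<^sub>F y in nhds x. F y = 0} = interior {x. F x = 0}"
      by (auto simp: eventually_nhds interior_def)
    then have "open ?Z" using S(1) by (simp add: open_Int Collect_conj_eq)
    then show ?thesis using S(1) by (simp add: openin_open_eq)
  qed
  moreover have "closedin (top_of_set S) ?Z"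
    unfolding closedin_limpt
  proof (intro conjI allI impI)
    fix x assume x: "x islimpt ?Z \<and> x \<in> S"
    have "?Z \<subseteq> {t \<in> S. F t = 0}" using eventually_nhds_x_imp_x by auto
    then have "x islimpt {t \<in> S. F t = 0}" using x islimpt_subset by blast
    then show "x \<in> ?Z" using loc[of x] x by simp
  qed auto
  moreover have "p \<in> ?Z" using loc[of p] p by simp
  ultimately have "?Z = S" using S(2) unfolding connected_clopen by (metis empty_iff)
  then have "\<forall>\<^sub>F y in nhds t. F y = 0" using t by auto
  then show ?thesis by (rule eventually_nhds_x_imp_x)
qed


subsection \<open>Real analytic functions of two variables\<close>

definition D1 :: "(real \<Rightarrow> real \<Rightarrow> real) \<Rightarrow> real \<Rightarrow> real \<Rightarrow> real" where
  "D1 F s t = deriv (\<lambda>x. F x t) s"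

definition D2 :: "(real \<Rightarrow> real \<Rightarrow> real) \<Rightarrow> real \<Rightarrow> real \<Rightarrow> real" where
  "D2 F s t = deriv (F s) t"

text \<open>The witnesses of \<open>real_analytic2_at\<close> are exposed so that the coefficients
  of partial derivatives can be written down and compared.\<close>

definition double_power_series ::
  "(nat \<Rightarrow> nat \<Rightarrow> real) \<Rightarrow> real \<Rightarrow> (real \<Rightarrow> real \<Rightarrow> real) \<Rightarrow> real \<Rightarrow> real \<Rightarrow> bool" where
  "double_power_series a r F s t \<longleftrightarrow> 0 < r \<and> (\<forall>h k. \<bar>h\<bar> < r \<longrightarrow> \<bar>k\<bar> < r \<longrightarrow>
     ((\<lambda>(m, n). a m n * h ^ m * k ^ n) has_sum F (s + h) (t + k)) UNIV)"

lemma real_analytic2_at_iff: "real_analytic2_at F s t \<longleftrightarrow> (\<exists>a r. double_power_series a r F s t)"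
  by (simp add: real_analytic2_at_def double_power_series_def)

lemma double_power_series_swap:
  assumes "double_power_series a r F s t"
  shows "double_power_series (\<lambda>m n. a n m) r (\<lambda>x y. F y x) t s"
  unfolding double_power_series_def
proof (intro conjI allI impI)
  show "0 < r" using assms by (simp add: double_power_series_def)
  fix h k :: real assume "\<bar>h\<bar> < r" "\<bar>k\<bar> < r"
  then have S: "((\<lambda>(m, n). a m n * k ^ m * h ^ n) has_sum F (s + k) (t + h)) UNIV"
    using assms by (simp add: double_power_series_def)
  have "bij_betw prod.swap (UNIV :: (nat \<times> nat) set) UNIV" by (rule bij_swap)
  from has_sum_reindex_bij_betw[OF this, of "\<lambda>(m, n). a m n * k ^ m * h ^ n"] S
  have "((\<lambda>x. case prod.swap x of (m, n) \<Rightarrow> a m n * k ^ m * h ^ n) has_sum F (s + k) (t + h)) UNIV"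
    by simp
  also have "(\<lambda>x. case prod.swap x of (m, n) \<Rightarrow> a m n * k ^ m * h ^ n) = (\<lambda>(m, n). a n m * h ^ m * k ^ n)"
    by (auto simp: fun_eq_iff algebra_simps)
  finally show "((\<lambda>(m, n). a n m * h ^ m * k ^ n) has_sum F (s + k) (t + h)) UNIV" .
qed

lemma real_analytic2_at_swap: "real_analytic2_at (\<lambda>x y. F y x) t s \<longleftrightarrow> real_analytic2_at F s t"
  unfolding real_analytic2_at_iff
proof
  assume "\<exists>a r. double_power_series a r (\<lambda>x y. F y x) t s"
  then obtain a r where "double_power_series a r (\<lambda>x y. F y x) t s" by metis
  from double_power_series_swap[OF this] show "\<exists>a r. double_power_series a r F s t" by metis
next
  assume "\<exists>a r. double_power_series a r F s t"
  then obtain a r where "double_power_series a r F s t" by metis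
  from double_power_series_swap[OF this] show "\<exists>a r. double_power_series a r (\<lambda>x y. F y x) t s" by metis
qed

text \<open>With \<open>h = k = 0\<close> only the index \<open>(0, 0)\<close> survives, because
  \<open>0 ^ 0 = 1\<close>.\<close>

lemma double_power_series_center:
  assumes "double_power_series a r F s t"
  shows "F s t = a 0 0"
proof -
  have S: "((\<lambda>(m, n). a m n * 0 ^ m * 0 ^ n) has_sum F s t) UNIV"
    using assms unfolding double_power_series_def by (elim conjE allE[of _ "0 :: real"]) simp
  have "((\<lambda>(m, n). a m n * 0 ^ m * 0 ^ n) has_sum a 0 0) {(0, 0)}"
    using has_sum_finite[of "{(0, 0)}" "\<lambda>(m, n). a m n * 0 ^ m * 0 ^ n"] by simp
  also have "?this \<longleftrightarrow> ((\<lambda>(m, n). a m n * 0 ^ m * 0 ^ n) has_sum a 0 0) UNIV"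
    by (rule has_sum_cong_neutral) auto
  finally show ?thesis using has_sum_unique[OF S] by simp
qed

lemma double_power_series_slice:
  assumes "double_power_series a r F s t" "\<bar>k\<bar> < r"
  shows "\<bar>h\<bar> < r \<Longrightarrow> (\<lambda>m. (\<Sum>\<^sub>\<infinity>n. a m n * k ^ n) * h ^ m) sums F (s + h) (t + k)"
    and "(\<lambda>n. a m n * k ^ n) summable_on UNIV"
proof -
  have r: "0 < r" and S: "\<And>h. \<bar>h\<bar> < r \<Longrightarrow>
      ((\<lambda>(m, n). a m n * h ^ m * k ^ n) has_sum F (s + h) (t + k)) UNIV"
    using assms by (auto simp: double_power_series_def)
  show summ: "(\<lambda>n. a m n * k ^ n) summable_on UNIV" for m
  proof -
    \<comment> \<open>Here \<open>r / 2\<close> is just an admissible non-zero value of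
      \<open>h\<close>: the factor \<open>(r / 2) ^ m\<close> can be cancelled row by row.\<close>
    have "(\<lambda>(m, n). a m n * (r / 2) ^ m * k ^ n) summable_on (Sigma UNIV (\<lambda>_. UNIV))"
      using has_sum_imp_summable[OF S[of "r / 2"]] r by simp
    then have "(\<lambda>n. a m n * (r / 2) ^ m * k ^ n) summable_on UNIV"
      by (rule summable_on_SigmaD1) simp
    then have "(\<lambda>n. (r / 2) ^ m * (a m n * k ^ n)) summable_on UNIV"
      by (simp add: algebra_simps)
    then show ?thesis
      using r summable_on_cmult_right'[of "(r / 2) ^ m" "\<lambda>n. a m n * k ^ n" UNIV] by simp
  qed
  assume "\<bar>h\<bar> < r"
  have "((\<lambda>m. (\<Sum>\<^sub>\<infinity>n. a m n * k ^ n) * h ^ m) has_sum F (s + h) (t + k)) UNIV"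
  proof (rule has_sum_SigmaD)
    show "((\<lambda>(m, n). a m n * h ^ m * k ^ n) has_sum F (s + h) (t + k)) (Sigma UNIV (\<lambda>_. UNIV))"
      using S[OF \<open>\<bar>h\<bar> < r\<close>] by simp
    fix m
    have "((\<lambda>n. (a m n * k ^ n) * h ^ m) has_sum (\<Sum>\<^sub>\<infinity>n. a m n * k ^ n) * h ^ m) UNIV"
      by (intro has_sum_cmult_left has_sum_infsum summ)
    then show "((\<lambda>n. case (m, n) of (m, n) \<Rightarrow> a m n * h ^ m * k ^ n) has_sum
        (\<Sum>\<^sub>\<infinity>n. a m n * k ^ n) * h ^ m) UNIV"
      by (simp add: mult_ac)
  qed
  then show "(\<lambda>m. (\<Sum>\<^sub>\<infinity>n. a m n * k ^ n) * h ^ m) sums F (s + h) (t + k)"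
    by (rule has_sum_imp_sums)
qed

lemma real_analytic2_at_slice1:
  assumes "real_analytic2_at F s t"
  shows "real_analytic_at (\<lambda>x. F x t) s"
proof -
  obtain a r where a: "double_power_series a r F s t"
    using assms unfolding real_analytic2_at_iff by blast
  have r: "0 < r" using a by (simp add: double_power_series_def)
  then have "(\<lambda>m. (\<Sum>\<^sub>\<infinity>n. a m n * 0 ^ n) * h ^ m) sums F (s + h) t" if "\<bar>h\<bar> < r" for h
    using double_power_series_slice(1)[OF a, of 0 h] that by simp
  then show ?thesis unfolding real_analytic_at_def using r
    by (intro exI[of _ "\<lambda>m. \<Sum>\<^sub>\<infinity>n. a m n * 0 ^ n"] exI[of _ r]) simp
qed

lemma real_analytic2_at_slice2: "real_analytic2_at F s t \<Longrightarrow> real_analytic_at (F s) t"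
  by (rule real_analytic2_at_slice1[OF real_analytic2_at_swap[THEN iffD2]])

text \<open>The radius shrinks to \<open>r / 4\<close> so that the new factor is absorbed:
  \<open>Suc m \<le> 2 ^ m\<close> gives \<open>Suc m * \<bar>h\<bar> ^ m \<le> (r / 2) ^ m\<close>,
  and the original series converges absolutely at \<open>r / 2\<close>. Absolute convergence over
  all pairs is the point, since \<open>has_sum\<close> is unconditional.\<close>

lemma double_power_series_D1:
  assumes "double_power_series a r F s t"
  shows "double_power_series (\<lambda>m n. real (Suc m) * a (Suc m) n) (r / 4) (D1 F) s t"
  unfolding double_power_series_def
proof (intro conjI allI impI)
  show r4: "0 < r / 4" using assms by (simp add: double_power_series_def)
  fix h k :: real assume h: "\<bar>h\<bar> < r / 4" and k: "\<bar>k\<bar> < r / 4"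
  define b where "b m = (\<Sum>\<^sub>\<infinity>n. a m n * k ^ n)" for m
  have kr: "\<bar>k\<bar> < r" and hr: "\<bar>h\<bar> < r" using h k r4 by auto
  have sums: "(\<lambda>m. b m * x ^ m) sums F (s + x) (t + k)" if "\<bar>x\<bar> < r" for x
    using double_power_series_slice(1)[OF assms kr that] by (simp add: b_def)
  have D: "((\<lambda>h. \<Sum>n. b n * h ^ n) has_real_derivative (\<Sum>n. diffs b n * h ^ n)) (at h)"
    by (rule termdiffs_strong'[of r]) (use sums hr in \<open>auto intro: sums_summable\<close>)
  have "((\<lambda>h. F (s + h) (t + k)) has_real_derivative (\<Sum>n. diffs b n * h ^ n)) (at h)"
  proof (rule has_field_derivative_transform_within[OF D, of "r - \<bar>h\<bar>"])
    fix x assume "dist x h < r - \<bar>h\<bar>"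
    then have "\<bar>x\<bar> < r" by (simp add: dist_real_def)
    then show "(\<Sum>n. b n * x ^ n) = F (s + x) (t + k)" by (intro sums_unique[symmetric] sums)
  qed (use hr in auto)
  then have "((\<lambda>x. F x (t + k)) has_real_derivative (\<Sum>n. diffs b n * h ^ n)) (at (s + h))"
    using DERIV_shift[of "\<lambda>x. F x (t + k)" _ h s] by (simp add: add.commute)
  then have D1: "D1 F (s + h) (t + k) = (\<Sum>n. diffs b n * h ^ n)"
    unfolding D1_def by (rule DERIV_imp_deriv)
  have summ: "(\<lambda>(m, n). real (Suc m) * a (Suc m) n * h ^ m * k ^ n) summable_on UNIV"
  proof -
    let ?f = "\<lambda>(m, n). a m n * (r / 2) ^ m * k ^ n"
    have "(?f has_sum F (s + r / 2) (t + k)) UNIV"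
      using assms kr r4 by (simp add: double_power_series_def)
    from summable_on_iff_abs_summable_on_real[THEN iffD1, OF has_sum_imp_summable[OF this]]
    have "(\<lambda>x. norm (?f x)) summable_on UNIV" .
    then have "(\<lambda>x. norm (?f x)) summable_on range (\<lambda>(m, n). (Suc m, n))"
      by (rule summable_on_subset_banach) simp
    then have "(\<lambda>x. norm (?f x)) \<circ> (\<lambda>(m, n). (Suc m, n)) summable_on UNIV"
      by (subst (asm) summable_on_reindex) (auto simp: inj_on_def)
    then have "(\<lambda>x. 2 / r * ((\<lambda>x. norm (?f x)) \<circ> (\<lambda>(m, n). (Suc m, n))) x) summable_on UNIV"
      by (rule summable_on_cmult_right)
    then have "(\<lambda>x. norm (case x of (m, n) \<Rightarrow> real (Suc m) * a (Suc m) n * h ^ m * k ^ n)) summable_on UNIV"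
    proof (rule summable_on_comparison_test, goal_cases)
      case (1 x)
      obtain m n where x: "x = (m, n)" by (cases x)
      have "real (Suc m) * \<bar>h\<bar> ^ m \<le> 2 ^ m * (r / 4) ^ m"
      proof (rule mult_mono)
        show "real (Suc m) \<le> 2 ^ m"
          by (metis Suc_leI less_exp of_nat_le_iff of_nat_numeral of_nat_power)
        show "\<bar>h\<bar> ^ m \<le> (r / 4) ^ m" using h by (intro power_mono) auto
      qed auto
      also have "\<dots> = (r / 2) ^ m" by (simp flip: power_mult_distrib)
      also have "\<dots> = 2 / r * (r / 2) ^ Suc m" using r4 by simp
      finally have "\<bar>a (Suc m) n\<bar> * \<bar>k\<bar> ^ n * (real (Suc m) * \<bar>h\<bar> ^ m) \<le>
          \<bar>a (Suc m) n\<bar> * \<bar>k\<bar> ^ n * (2 / r * (r / 2) ^ Suc m)"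
        by (intro mult_left_mono) auto
      then show ?case using r4 by (simp add: x abs_mult power_abs mult_ac)
    qed auto
    then show ?thesis by (rule abs_summable_summable)
  qed
  have "((\<lambda>(m, n). real (Suc m) * a (Suc m) n * h ^ m * k ^ n) has_sum D1 F (s + h) (t + k))
    (Sigma UNIV (\<lambda>_. UNIV))"
  proof (rule has_sum_SigmaI)
    fix m
    have "((\<lambda>n. (real (Suc m) * h ^ m) * (a (Suc m) n * k ^ n)) has_sum (real (Suc m) * h ^ m) * b (Suc m)) UNIV"
      unfolding b_def
      by (intro has_sum_cmult_right has_sum_infsum double_power_series_slice(2)[OF assms kr])
    then show "((\<lambda>n. case (m, n) of (m, n) \<Rightarrow> real (Suc m) * a (Suc m) n * h ^ m * k ^ n) has_sum
        (real (Suc m) * h ^ m) * b (Suc m)) UNIV" by (simp add: mult_ac)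
    show "(\<lambda>(m, n). real (Suc m) * a (Suc m) n * h ^ m * k ^ n) summable_on (Sigma UNIV (\<lambda>_. UNIV))"
      using summ by simp
  next
    let ?g = "\<lambda>m. real (Suc m) * h ^ m * b (Suc m)"
    have "?g summable_on UNIV"
    proof -
      have "summable (\<lambda>m. norm (diffs b m * h ^ m))"
      proof (rule powser_insidea[of _ "r / 2"])
        show "summable (\<lambda>m. diffs b m * (r / 2) ^ m)"
          by (rule termdiff_converges[of "r / 2" r]) (use r4 sums in \<open>auto intro: sums_summable\<close>)
      qed (use h r4 in auto)
      then have "summable (\<lambda>m. norm (?g m))" by (simp add: diffs_def mult_ac)
      then show ?thesis by (rule norm_summable_imp_summable_on)
    qed
    then have "(?g has_sum (\<Sum>\<^sub>\<infinity>m. ?g m)) UNIV" by (rule has_sum_infsum)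
    moreover have "(\<Sum>\<^sub>\<infinity>m. ?g m) = D1 F (s + h) (t + k)"
      using sums_unique[OF has_sum_imp_sums[OF calculation]] unfolding D1 by (simp add: diffs_def mult_ac)
    ultimately show "(?g has_sum D1 F (s + h) (t + k)) UNIV" by simp
  qed
  then show "((\<lambda>(m, n). real (Suc m) * a (Suc m) n * h ^ m * k ^ n) has_sum D1 F (s + h) (t + k)) UNIV"
    by simp
qed

lemma double_power_series_D2:
  assumes "double_power_series a r F s t"
  shows "double_power_series (\<lambda>m n. real (Suc n) * a m (Suc n)) (r / 4) (D2 F) s t"
proof -
  have "(\<lambda>x y. D1 (\<lambda>x y. F y x) y x) = D2 F" by (simp add: D1_def D2_def fun_eq_iff)
  then show ?thesis
    using double_power_series_swap[OF double_power_series_D1[OF double_power_series_swap[OF assms]]] by simp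
qed

lemma real_analytic2_at_D1: "real_analytic2_at F s t \<Longrightarrow> real_analytic2_at (D1 F) s t"
  unfolding real_analytic2_at_iff using double_power_series_D1 by metis

lemma real_analytic2_at_D2: "real_analytic2_at F s t \<Longrightarrow> real_analytic2_at (D2 F) s t"
  unfolding real_analytic2_at_iff using double_power_series_D2 by metis

text \<open>Both sides are the coefficient \<open>a 1 1\<close>, read off at the centre.\<close>

lemma D1_D2_commute:
  assumes "real_analytic2_at F s t"
  shows "D1 (D2 F) s t = D2 (D1 F) s t"
proof -
  obtain a r where a: "double_power_series a r F s t"
    using assms unfolding real_analytic2_at_iff by blast
  show ?thesis
    using double_power_series_center[OF double_power_series_D1[OF double_power_series_D2[OF a]]]
      double_power_series_center[OF double_power_series_D2[OF double_power_series_D1[OF a]]] by simp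
qed

lemma real_analytic2_at_DERIV1:
  "real_analytic2_at F s t \<Longrightarrow> ((\<lambda>x. F x t) has_real_derivative D1 F s t) (at s)"
  unfolding D1_def by (intro real_analytic_at_DERIV real_analytic2_at_slice1)

lemma real_analytic2_at_DERIV2:
  "real_analytic2_at F s t \<Longrightarrow> (F s has_real_derivative D2 F s t) (at t)"
  unfolding D2_def by (intro real_analytic_at_DERIV real_analytic2_at_slice2)

text \<open>The extension \<open>g\<close> of \<open>f\<close> is inserted into the double series.
  Near the centre both increments stay within \<open>r / 2\<close>, so the terms are dominated by
  the series at \<open>(r / 2, r / 2)\<close>, and the sum is a uniform limit of holomorphic
  functions.\<close>

lemma real_analytic2_at_compose:
  assumes F: "real_analytic2_at F s (f s)" and f: "real_analytic_at f s"
  shows "real_analytic_at (\<lambda>x. F x (f x)) s"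
proof -
  define t where "t = f s"
  obtain a r where a: "double_power_series a r F s t"
    using F unfolding real_analytic2_at_iff t_def by metis
  have r: "0 < r" and S: "\<And>h k. \<bar>h\<bar> < r \<Longrightarrow> \<bar>k\<bar> < r \<Longrightarrow>
      ((\<lambda>(m, n). a m n * h ^ m * k ^ n) has_sum F (s + h) (t + k)) UNIV"
    using a unfolding double_power_series_def by simp_all
  obtain g e where e: "0 < e" "g holomorphic_on ball (of_real s) e"
    and gf: "\<forall>\<^sub>F x in nhds s. g (of_real x) = of_real (f x)"
    using f unfolding real_analytic_at_iff analytic_at_ball by metis
  have gs: "g (of_real s) = of_real t" unfolding t_def using gf by (rule eventually_nhds_x_imp_x)
  have "isCont g (of_real s)"
    using e by (meson centre_in_ball continuous_on_eq_continuous_at holomorphic_on_imp_continuous_on open_ball)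
  then obtain d where d: "0 < d" "\<And>z. dist z (of_real s) < d \<Longrightarrow> dist (g z) (of_real t) < r / 2"
    unfolding continuous_at_eps_delta gs using r by (metis half_gt_zero)
  define c where "c = min (r / 2) (min d e) / 2"
  have c: "0 < c" "c < r / 2" "c < d" "c < e" using r d e by (auto simp: c_def)
  define T where "T x z = of_real (a (fst x) (snd x)) * (z - of_real s) ^ fst x * (g z - of_real t) ^ snd x"
    for x and z :: complex
  define G where "G z = (\<Sum>\<^sub>\<infinity>x. T x z)" for z
  have lim: "uniform_limit (cball (of_real s) c) (\<lambda>X z. \<Sum>x\<in>X. T x z) G (finite_subsets_at_top UNIV)"
    unfolding G_def
  proof (rule Weierstrass_m_test_general)
    show "(\<lambda>x. norm (case x of (m, n) \<Rightarrow> a m n * (r / 2) ^ m * (r / 2) ^ n)) summable_on UNIV"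
      using S[of "r / 2" "r / 2"] r
      by (intro summable_on_iff_abs_summable_on_real[THEN iffD1] has_sum_imp_summable) auto
    fix x :: "nat \<times> nat" and z :: complex assume z: "z \<in> cball (of_real s) c"
    have 1: "norm (z - of_real s) \<le> r / 2" using z c by (simp add: dist_norm norm_minus_commute)
    have 2: "norm (g z - of_real t) \<le> r / 2"
      using d(2)[of z] z c by (simp add: dist_norm norm_minus_commute)
    obtain m n where x: "x = (m, n)" by (cases x)
    have "norm (z - of_real s) ^ m * norm (g z - of_real t) ^ n \<le> (r / 2) ^ m * (r / 2) ^ n"
      using 1 2 r by (intro mult_mono power_mono) auto
    then have "\<bar>a m n\<bar> * (norm (z - of_real s) ^ m * norm (g z - of_real t) ^ n)
        \<le> \<bar>a m n\<bar> * ((r / 2) ^ m * (r / 2) ^ n)"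
      by (rule mult_left_mono) simp
    then show "norm (T x z) \<le> norm (case x of (m, n) \<Rightarrow> a m n * (r / 2) ^ m * (r / 2) ^ n)"
      using r by (simp add: T_def x norm_mult norm_power abs_mult power_abs mult_ac)
  qed
  have "G holomorphic_on ball (of_real s) c"
  proof (rule holomorphic_uniform_limit[OF _ lim])
    have hol: "(\<lambda>z. \<Sum>x\<in>X. T x z) holomorphic_on ball (of_real s) e" for X
      unfolding T_def by (intro holomorphic_intros e(2))
    have "continuous_on (cball (of_real s) c) (\<lambda>z. \<Sum>x\<in>X. T x z)
        \<and> (\<lambda>z. \<Sum>x\<in>X. T x z) holomorphic_on ball (of_real s) c" for X
    proof
      show "continuous_on (cball (of_real s) c) (\<lambda>z. \<Sum>x\<in>X. T x z)"
        by (rule continuous_on_subset[OF holomorphic_on_imp_continuous_on[OF hol]]) (use c in auto)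
      show "(\<lambda>z. \<Sum>x\<in>X. T x z) holomorphic_on ball (of_real s) c"
        by (rule holomorphic_on_subset[OF hol]) (use c in auto)
    qed
    then show "\<forall>\<^sub>F X in finite_subsets_at_top UNIV.
        continuous_on (cball (of_real s) c) (\<lambda>z. \<Sum>x\<in>X. T x z)
        \<and> (\<lambda>z. \<Sum>x\<in>X. T x z) holomorphic_on ball (of_real s) c"
      by (intro always_eventually allI)
  qed auto
  then have "G analytic_on {of_real s}" using c(1) unfolding analytic_at_ball by metis
  moreover have "\<forall>\<^sub>F x in nhds s. G (of_real x) = of_real (F x (f x))"
  proof -
    have "\<forall>\<^sub>F x in nhds s. dist x s < c" using c(1) unfolding eventually_nhds_metric by metis
    with gf show ?thesis
    proof eventually_elim
      case (elim x)
      have "dist (complex_of_real x) (of_real s) < d" using elim c by simp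
      from d(2)[OF this] have "\<bar>f x - t\<bar> < r" using r by (simp add: elim dist_real_def)
      moreover have "\<bar>x - s\<bar> < r" using elim c r by (simp add: dist_real_def)
      ultimately have "((\<lambda>(m, n). a m n * (x - s) ^ m * (f x - t) ^ n) has_sum F x (f x)) UNIV"
        using S[of "x - s" "f x - t"] by simp
      from has_sum_of_real[OF this, where 'a = complex]
      have "((\<lambda>y. T y (of_real x)) has_sum of_real (F x (f x))) UNIV"
        by (simp add: T_def elim(1) case_prod_unfold)
      then show ?case unfolding G_def by (rule infsumI)
    qed
  qed
  ultimately show ?thesis by (rule real_analytic_at_of_complex)
qed

text \<open>Extended bounds let one statement serve the whole line (arc length) and bounded arcs
  (charts).\<close>

lemma real_antiderivative:
  fixes f :: "real \<Rightarrow> real" and a b :: ereal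
  assumes "a < b" "\<And>x. a < ereal x \<Longrightarrow> ereal x < b \<Longrightarrow> isCont f x"
  obtains F where "\<And>x. a < ereal x \<Longrightarrow> ereal x < b \<Longrightarrow> (F has_real_derivative f x) (at x)"
  using einterval_antiderivative[OF assms] unfolding has_real_derivative_iff_has_vector_derivative by metis

subsection \<open>Groups of circle diffeomorphisms lifted to the line\<close>

lemma cis_eq_iff: "cis s = cis t \<longleftrightarrow> (\<exists>k::int. s = t + 2 * pi * of_int k)"
  by (metis cis.sel complex_eqI sin_cos_eq_iff)

lemma per_int:
  assumes "\<And>t::real. F (t + 2 * pi) = F t + (c::real)"
  shows "F (t + 2 * pi * of_int k) = F t + c * of_int k"
proof -
  have nat: "F (t + 2 * pi * of_nat n) = F t + c * of_nat n" for n t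
  proof (induction n)
    case (Suc n)
    have "F (t + 2 * pi * of_nat (Suc n)) = F ((t + 2 * pi * of_nat n) + 2 * pi)"
      by (simp add: algebra_simps)
    then show ?case by (simp only: Suc assms) (simp add: algebra_simps)
  qed simp
  show ?thesis
  proof (cases "k \<ge> 0")
    case True then show ?thesis using nat[of t "nat k"] by simp
  next
    case False
    then show ?thesis using nat[of "t + 2 * pi * of_int k" "nat (- k)"] by (simp add: algebra_simps)
  qed
qed

lemma cis_neq:
  assumes "x < t" "t < x + 2 * pi"
  shows "cis x \<noteq> cis t"
proof
  assume "cis x = cis t"
  then have "cis t = cis x" by simp
  then obtain k :: int where k: "t = x + 2 * pi * of_int k" unfolding cis_eq_iff by metis
  have "0 < 2 * pi * real_of_int k" "2 * pi * real_of_int k < 2 * pi * 1" using k assms by auto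
  then have "0 < k" "k < 1" by (simp_all add: zero_less_mult_iff)
  then show False by simp
qed

lemma representative:
  obtains k :: int where "x \<le> t + 2 * pi * of_int k" "t + 2 * pi * of_int k < x + 2 * pi"
proof
  define k where "k = - \<lfloor>(t - x) / (2 * pi)\<rfloor>"
  have "of_int (- k) \<le> (t - x) / (2 * pi)" "(t - x) / (2 * pi) < of_int (- k) + 1"
    unfolding k_def by (simp_all add: floor_correct)
  then show "x \<le> t + 2 * pi * of_int k" "t + 2 * pi * of_int k < x + 2 * pi"
    by (simp_all add: field_simps)
qed

lemma representative_strict:
  assumes "cis x \<noteq> cis t"
  obtains k :: int where "x < t + 2 * pi * of_int k" "t + 2 * pi * of_int k < x + 2 * pi"
proof -
  obtain k :: int where k: "x \<le> t + 2 * pi * of_int k" "t + 2 * pi * of_int k < x + 2 * pi"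
    using representative[of x t] by metis
  moreover have "x \<noteq> t + 2 * pi * of_int k" using assms cis_eq_iff by metis
  ultimately show thesis using that[of k] by simp
qed

text \<open>A bounded increasing orbit converges, and continuity makes the limit a fixed point; so
  orbits escape where fixed points are absent.\<close>

lemma iterate_limit_up:
  fixes f :: "real \<Rightarrow> real"
  assumes "continuous_on UNIV f" "mono f" "x \<le> f x" "\<And>n. (f ^^ n) x \<le> B"
  obtains L where "(\<lambda>n. (f ^^ n) x) \<longlonglongrightarrow> L" "f L = L" "x \<le> L" "L \<le> B"
proof -
  have "(f ^^ n) x \<le> (f ^^ Suc n) x" for n
    by (induction n) (use assms(2,3) in \<open>auto simp: monoD\<close>)
  then have inc: "incseq (\<lambda>n. (f ^^ n) x)" by (rule incseq_SucI)
  obtain L where L: "(\<lambda>n. (f ^^ n) x) \<longlonglongrightarrow> L" "\<And>n. (f ^^ n) x \<le> L"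
    using incseq_convergent[OF inc, of B] assms(4) by metis
  have "(\<lambda>n. f ((f ^^ n) x)) \<longlonglongrightarrow> f L"
    by (rule continuous_on_tendsto_compose[OF assms(1) L(1)]) auto
  moreover have "(\<lambda>n. f ((f ^^ n) x)) \<longlonglongrightarrow> L" using LIMSEQ_Suc[OF L(1)] by simp
  ultimately have "f L = L" using LIMSEQ_unique by metis
  moreover have "L \<le> B" using LIMSEQ_le_const2[OF L(1)] assms(4) by metis
  moreover have "x \<le> L" using L(2)[of 0] by simp
  ultimately show thesis using that L(1) by metis
qed

lemma iterate_limit_down:
  fixes f :: "real \<Rightarrow> real"
  assumes "continuous_on UNIV f" "mono f" "f x \<le> x" "\<And>n. B \<le> (f ^^ n) x"
  obtains L where "(\<lambda>n. (f ^^ n) x) \<longlonglongrightarrow> L" "f L = L" "L \<le> x" "B \<le> L"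
proof -
  let ?g = "\<lambda>y. - f (- y)"
  have it: "(?g ^^ n) (- x) = - (f ^^ n) x" for n by (induction n) auto
  obtain L where L: "(\<lambda>n. (?g ^^ n) (- x)) \<longlonglongrightarrow> L" "?g L = L" "- x \<le> L" "L \<le> - B"
  proof (rule iterate_limit_up[of ?g "- x" "- B"])
    show "continuous_on UNIV ?g"
      by (intro continuous_intros continuous_on_compose2[OF assms(1)]) auto
    show "mono ?g" using assms(2) by (auto simp: mono_def)
    show "(?g ^^ n) (- x) \<le> - B" for n using assms(4)[of n] by (simp add: it)
  qed (use assms(3) in auto)
  have "(\<lambda>n. - (?g ^^ n) (- x)) \<longlonglongrightarrow> - L" using L(1) by (rule tendsto_minus)
  then have "(\<lambda>n. (f ^^ n) x) \<longlonglongrightarrow> - L" by (simp add: it)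
  then show thesis using that[of "- L"] L by simp
qed

text \<open>By \<open>H_shift\<close> and \<open>H_comp\<close>, \<open>H\<close> contains every
  lift of each of its elements. Hence a fixed point on the circle is a fixed point on the line of a
  suitable lift in \<open>H\<close>, and freeness can be expressed on the line. All conditions on
  \<open>\<Omega>\<close> other than periodicity concern pairs that are distinct on the
  circle.\<close>

locale circle_action =
  fixes H :: "(real \<Rightarrow> real) set" and \<Omega> :: "real \<Rightarrow> real \<Rightarrow> real"
  assumes H_comp: "f \<in> H \<Longrightarrow> g \<in> H \<Longrightarrow> (\<lambda>t. f (g t)) \<in> H"
    and H_inv: "f \<in> H \<Longrightarrow> \<exists>g\<in>H. \<forall>t. g (f t) = t \<and> f (g t) = t"
    and H_shift: "(\<lambda>t. t + 2 * pi) \<in> H"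
    and H_per: "f \<in> H \<Longrightarrow> f (t + 2 * pi) = f t + 2 * pi"
    and H_ra: "f \<in> H \<Longrightarrow> real_analytic_at f t"
    and H_pos: "f \<in> H \<Longrightarrow> 0 < deriv f t"
    and H_orbit: "infinite ((\<lambda>f. cis (f t)) ` H)"
    and Om_pos: "cis s \<noteq> cis t \<Longrightarrow> 0 < \<Omega> s t"
    and Om_ra: "cis s \<noteq> cis t \<Longrightarrow> real_analytic2_at \<Omega> s t"
    and Om_per1: "\<Omega> (s + 2 * pi) t = \<Omega> s t"
    and Om_per2: "\<Omega> s (t + 2 * pi) = \<Omega> s t"
    and Om_inv: "f \<in> H \<Longrightarrow> cis s \<noteq> cis t \<Longrightarrow>
                   \<Omega> (f s) (f t) * deriv f s * deriv f t = \<Omega> s t"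
begin

lemma H_DERIV: "f \<in> H \<Longrightarrow> (f has_real_derivative deriv f t) (at t)"
  by (intro real_analytic_at_DERIV H_ra)

lemma H_strict_mono: "f \<in> H \<Longrightarrow> strict_mono f"
  unfolding strict_mono_def by (meson DERIV_pos_imp_increasing H_DERIV H_pos)

lemma H_less [simp]: "f \<in> H \<Longrightarrow> f s < f t \<longleftrightarrow> s < t"
  using H_strict_mono strict_mono_less by blast

lemma H_le [simp]: "f \<in> H \<Longrightarrow> f s \<le> f t \<longleftrightarrow> s \<le> t"
  using H_strict_mono strict_mono_less_eq by blast

lemma H_eq [simp]: "f \<in> H \<Longrightarrow> f s = f t \<longleftrightarrow> s = t"
  using H_strict_mono strict_mono_eq by blast

lemma H_mono: "f \<in> H \<Longrightarrow> mono f"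
  by (simp add: H_strict_mono strict_mono_mono)

lemma H_cont: "f \<in> H \<Longrightarrow> continuous_on A f"
  by (intro continuous_at_imp_continuous_on ballI real_analytic_at_isCont H_ra)

lemma H_id: "(\<lambda>t. t) \<in> H"
proof -
  obtain g where "g \<in> H" "\<forall>t. g (t + 2 * pi) = t" using H_inv[OF H_shift] by auto
  with H_comp[OF \<open>g \<in> H\<close> H_shift] show ?thesis by simp
qed

lemma H_funpow: "f \<in> H \<Longrightarrow> (f ^^ n) \<in> H"
  by (induction n) (use H_id H_comp in \<open>auto simp: id_def o_def\<close>)

lemma H_shift_int: "(\<lambda>t. t + 2 * pi * of_int k) \<in> H"
proof -
  have nat: "(\<lambda>t. t + 2 * pi * of_nat n) \<in> H" for n
  proof (induction n)
    case (Suc n)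
    from H_comp[OF this H_shift] show ?case by (simp add: algebra_simps)
  qed (simp add: H_id)
  show ?thesis
  proof (cases "k \<ge> 0")
    case True then show ?thesis using nat[of "nat k"] by simp
  next
    case False
    obtain g where g: "g \<in> H" "\<And>t. g (t + 2 * pi * of_nat (nat (- k))) = t"
      using H_inv[OF nat[of "nat (- k)"]] by auto
    have "g t = t + 2 * pi * of_int k" for t
      using g(2)[of "t + 2 * pi * of_int k"] False by (simp add: algebra_simps)
    then show ?thesis using g(1) by (metis ext)
  qed
qed

lemma H_per_int: "f \<in> H \<Longrightarrow> f (t + 2 * pi * of_int k) = f t + 2 * pi * of_int k"
  using per_int[of f "2 * pi"] H_per by simp

lemma H_cis [simp]: "f \<in> H \<Longrightarrow> cis (f s) = cis (f t) \<longleftrightarrow> cis s = cis t"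
  unfolding cis_eq_iff by (metis H_per_int H_eq)

section \<open>Order and commutativity of free actions\<close>

definition free :: bool where
  "free \<longleftrightarrow> (\<forall>f\<in>H. \<forall>t. f t = t \<longrightarrow> (\<forall>s. f s = s))"

lemma freeD: "free \<Longrightarrow> f \<in> H \<Longrightarrow> f t = t \<Longrightarrow> f s = s"
  unfolding free_def by blast

text \<open>Graphs cannot cross: at a crossing the inverse of \<open>f\<close> composed with
  \<open>g\<close> has a fixed point, so it is the identity. Elements are thus totally ordered by
  their value at any one point, for which \<open>0\<close> serves below.\<close>

lemma H_compare:
  assumes free: free
    and f: "f \<in> H" and g: "g \<in> H" and t: "f t \<le> g t"
  shows "f s \<le> g s"
proof (rule ccontr)
  assume "\<not> f s \<le> g s"
  then have s: "g s < f s" by simp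
  obtain i where i: "i \<in> H" "\<And>x. i (f x) = x" "\<And>x. f (i x) = x" using H_inv[OF f] by metis
  have "continuous_on (closed_segment t s) (\<lambda>x. g x - f x)"
    by (intro continuous_intros H_cont f g)
  moreover have "connected (closed_segment t s)" by (rule connected_segment)
  ultimately have "connected ((\<lambda>x. g x - f x) ` closed_segment t s)"
    using connected_continuous_image by blast
  then have "0 \<in> (\<lambda>x. g x - f x) ` closed_segment t s"
    by (rule connectedD_interval[of _ "g s - f s" "g t - f t"]) (use s t in auto)
  then obtain x where "f x = g x" by (metis (no_types, lifting) imageE eq_iff_diff_eq_0)
  then have "i (g x) = x" by (metis i(2))
  then have "i (g s) = s" using freeD[OF free H_comp[OF i(1) g]] by metis
  then show False using s i(3)[of "g s"] by simp
qed

text \<open>A bounded orbit of \<open>0\<close> would converge to a fixed point of \<open>e\<close>,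
  which freeness forbids since \<open>e\<close> moves \<open>0\<close>. The least index beyond
  \<open>y\<close> then gives the integer part of \<open>y\<close> in units of
  \<open>e\<close>.\<close>

lemma H_archimedean:
  assumes free: free
    and e: "e \<in> H" "0 < e 0" and y: "0 \<le> y"
  obtains n where "(e ^^ n) 0 \<le> y" "y < (e ^^ Suc n) 0"
proof -
  have "\<exists>n. y < (e ^^ n) 0"
  proof (rule ccontr)
    assume "\<not> ?thesis"
    then have "\<And>n. (e ^^ n) 0 \<le> y" by (simp add: not_less)
    then obtain L where "e L = L"
      using iterate_limit_up[OF H_cont[OF e(1)] H_mono[OF e(1)], of 0 y] e(2) by (metis less_imp_le)
    then show False using freeD[OF free e(1), of L 0] e(2) by simp
  qed
  define n where "n = (LEAST n. y < (e ^^ n) 0)"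
  have n: "y < (e ^^ n) 0" "\<And>m. m < n \<Longrightarrow> \<not> y < (e ^^ m) 0"
    unfolding n_def using LeastI_ex[OF \<open>\<exists>n. y < (e ^^ n) 0\<close>] not_less_Least by blast+
  then obtain m where "n = Suc m" using y by (cases n) auto
  then have "(e ^^ m) 0 \<le> y" "y < (e ^^ Suc m) 0" using n(1) n(2)[of m] by (simp_all add: not_less)
  then show thesis by (rule that)
qed

lemma H_commute_pos:
  assumes free: free
    and f: "f \<in> H" "0 < f 0" and g: "g \<in> H" "0 < g 0"
  shows "f (g 0) \<le> g (f 0)"
proof (rule ccontr)
  assume "\<not> f (g 0) \<le> g (f 0)"
  then have less: "g (f 0) < f (g 0)" by simp
  note compare = H_compare[OF free]
  obtain i where i: "i \<in> H" "\<And>x. i (f x) = x" "\<And>x. f (i x) = x" using H_inv[OF f(1)] by metis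
  obtain j where j: "j \<in> H" "\<And>x. j (g x) = x" "\<And>x. g (j x) = x" using H_inv[OF g(1)] by metis
  define k where "k x = f (g (i (j x)))" for x
  have k: "k \<in> H" unfolding k_def by (rule H_comp[OF f(1) H_comp[OF g(1) H_comp[OF i(1) j(1)]]])
  have kgf: "k (g (f x)) = f (g x)" for x by (simp add: k_def i j)
  have k0: "0 < k 0"
  proof (rule ccontr)
    assume "\<not> 0 < k 0"
    then have "k (g (f 0)) \<le> g (f 0)" using compare[OF k H_id, of 0] by simp
    then show False using less kgf by simp
  qed
  have pow_less: "f' x < (e ^^ m) x" if "e \<in> H" "f' \<in> H" "f' 0 < (e ^^ m) 0" for f' e m x
    using compare[OF H_funpow[OF that(1)] that(2), of m x 0] that(3) by (meson not_le)
  have pow_ge: "(e ^^ m) x \<le> f' x" if "e \<in> H" "f' \<in> H" "(e ^^ m) 0 \<le> f' 0" for f' e m x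
    using compare[OF H_funpow[OF that(1)] that(2), of m 0 x] that(3) by simp
  \<comment> \<open>If \<open>e ^^ m \<le> f < e ^^ Suc m\<close> and
    \<open>e ^^ n \<le> g < e ^^ Suc n\<close>, then \<open>f (g 0)\<close> lies below
    \<open>(e ^^ (m + n + 2)) 0\<close>, hence below
    \<open>e (e (g (f 0))) \<le> k (g (f 0)) = f (g 0)\<close>.\<close>
  have E: False if e: "e \<in> H" "0 < e 0" "e (e 0) \<le> k 0" for e
  proof -
    obtain m where m: "(e ^^ m) 0 \<le> f 0" "f 0 < (e ^^ Suc m) 0"
      using H_archimedean[OF free e(1,2), of "f 0"] f(2) by (metis less_imp_le)
    obtain n where n: "(e ^^ n) 0 \<le> g 0" "g 0 < (e ^^ Suc n) 0"
      using H_archimedean[OF free e(1,2), of "g 0"] g(2) by (metis less_imp_le)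
    have "f (g 0) < (e ^^ Suc m) (g 0)" by (rule pow_less[OF e(1) f(1) m(2)])
    also have "\<dots> < (e ^^ Suc m) ((e ^^ Suc n) 0)" using n(2) H_less[OF H_funpow[OF e(1)]] by blast
    also have "\<dots> = e (e ((e ^^ n) ((e ^^ m) 0)))"
    proof -
      have "(e ^^ Suc m) ((e ^^ Suc n) 0) = (e ^^ (Suc m + Suc n)) 0"
        by (simp only: funpow_add o_apply)
      also have "Suc m + Suc n = Suc (Suc (n + m))" by simp
      also have "(e ^^ Suc (Suc (n + m))) 0 = e (e ((e ^^ n) ((e ^^ m) 0)))"
        by (simp only: funpow.simps funpow_add o_apply)
      finally show ?thesis .
    qed
    also have "\<dots> \<le> e (e ((e ^^ n) (f 0)))" using m(1) e(1) H_funpow[OF e(1)] by simp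
    also have "\<dots> \<le> e (e (g (f 0)))" using pow_ge[OF e(1) g(1) n(1)] e(1) by simp
    also have "\<dots> \<le> k (g (f 0))"
      using compare[OF H_comp[OF e(1) e(1)] k, of 0] e(3) by simp
    finally show False using kgf by simp
  qed
  have least: "k 0 \<le> h 0" if h: "h \<in> H" "0 < h 0" for h
  proof (rule ccontr)
    assume "\<not> k 0 \<le> h 0"
    then have hk: "h 0 < k 0" by simp
    obtain l where l: "l \<in> H" "\<And>x. l (h x) = x" "\<And>x. h (l x) = x" using H_inv[OF h(1)] by metis
    \<comment> \<open>Now \<open>k\<close> is \<open>h\<close> after \<open>h'\<close>; the smaller
      of the two, applied twice, stays below \<open>k\<close>, which \<open>E\<close>
      excludes.\<close>
    define h' where "h' x = l (k x)" for x
    have h': "h' \<in> H" unfolding h'_def by (rule H_comp[OF l(1) k])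
    have "0 < h' 0" using hk H_less[OF l(1), of "h 0" "k 0"] by (simp add: h'_def l)
    have hh': "h (h' x) = k x" for x by (simp add: h'_def l)
    show False
    proof (cases "h 0 \<le> h' 0")
      case True
      then have "h (h 0) \<le> k 0" using h(1) hh'[of 0] by (metis H_le)
      then show False using E[OF h] by simp
    next
      case False
      then have "h' (h' 0) \<le> h (h' 0)" using compare[OF h' h(1), of 0] by simp
      then show False using E[OF h' \<open>0 < h' 0\<close>] hh' by simp
    qed
  qed
  \<comment> \<open>Division with remainder by the least positive element: the remainder
    \<open>l (f' 0)\<close> is at least \<open>0\<close> and below \<open>k 0\<close>, so it
    vanishes.\<close>
  have power: "\<exists>m. \<forall>x. f' x = (k ^^ m) x" if f': "f' \<in> H" "0 < f' 0" for f'
  proof -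
    obtain m where m: "(k ^^ m) 0 \<le> f' 0" "f' 0 < (k ^^ Suc m) 0"
      using H_archimedean[OF free k k0, of "f' 0"] f'(2) by (metis less_imp_le)
    have km: "k ^^ m \<in> H" by (rule H_funpow[OF k])
    obtain l where l: "l \<in> H" "\<And>x. l ((k ^^ m) x) = x" "\<And>x. (k ^^ m) (l x) = x"
      using H_inv[OF km] by metis
    have lf: "(\<lambda>x. l (f' x)) \<in> H" by (rule H_comp[OF l(1) f'(1)])
    have "0 \<le> l (f' 0)" using m(1) l(2)[of 0] l(1) by (metis H_le)
    moreover have "l (f' 0) < k 0"
      using m(2) l(2)[of "k 0"] l(1) by (metis H_less comp_apply funpow_Suc_right)
    ultimately have "l (f' 0) = 0" using least[OF lf] by (meson less_eq_real_def not_less)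
    then have "l (f' x) = x" for x using freeD[OF free lf] by simp
    then show ?thesis by (metis l(3))
  qed
  obtain m n where "\<And>x. f x = (k ^^ m) x" "\<And>x. g x = (k ^^ n) x" using power[OF f] power[OF g] by metis
  then show False using less by (metis add.commute comp_apply funpow_add less_irrefl)
qed

text \<open>
  Hoelder's theorem: compare elements pointwise. If the commutator \<open>k\<close> of two positive elements is
  positive, either \<open>e \<circ> e \<le> k\<close> for some positive \<open>e\<close>, and counting powers of \<open>e\<close> below both elements
  bounds \<open>k\<close> strictly by \<open>e \<circ> e\<close>; or \<open>k\<close> is the least positive element, and both are powers of it.
\<close>

lemma H_commute:
  assumes free: free
    and f: "f \<in> H" and g: "g \<in> H"
  shows "f (g t) = g (f t)"
proof -
  have pos: "\<exists>m::int. 0 < f 0 + 2 * pi * of_int m" for f :: "real \<Rightarrow> real"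
  proof -
    obtain m :: nat where "- f 0 < real m * (2 * pi)"
      using reals_Archimedean3[of "2 * pi"] by auto
    then have "0 < f 0 + 2 * pi * of_int (int m)" by (simp add: algebra_simps)
    then show ?thesis by (rule exI)
  qed
  obtain m :: int where m: "0 < f 0 + 2 * pi * of_int m" using pos by blast
  obtain n :: int where n: "0 < g 0 + 2 * pi * of_int n" using pos by blast
  \<comment> \<open>Adding deck translations makes both elements positive and, these being central,
    does not affect commutation.\<close>
  define f' where "f' x = f x + 2 * pi * of_int m" for x
  define g' where "g' x = g x + 2 * pi * of_int n" for x
  have f': "f' \<in> H" "0 < f' 0" using H_comp[OF H_shift_int f] m by (simp_all add: f'_def[abs_def])
  have g': "g' \<in> H" "0 < g' 0" using H_comp[OF H_shift_int g] n by (simp_all add: g'_def[abs_def])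
  have "f' (g' 0) = g' (f' 0)"
    using H_commute_pos[OF free f' g'] H_commute_pos[OF free g' f'] by simp
  then have "f' (g' t) = g' (f' t)"
    using H_compare[OF free H_comp[OF f'(1) g'(1)] H_comp[OF g'(1) f'(1)], of 0 t]
      H_compare[OF free H_comp[OF g'(1) f'(1)] H_comp[OF f'(1) g'(1)], of 0 t] by simp
  then show ?thesis by (simp add: f'_def g'_def H_per_int f g)
qed

end

subsection \<open>Free actions\<close>

context circle_action begin

text \<open>
  The second condition says that the vector of half angles of \<open>\<Phi> (f t)\<close> is parallel to the image
  of that of \<open>\<Phi> t\<close> under the matrix with rows \<open>(p, q)\<close> and \<open>(r, s)\<close>. As a vanishing bilinear
  expression it can be extended from an interval by analytic continuation.
\<close>

definition projective_chart :: "(real \<Rightarrow> real) \<Rightarrow> bool" where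
  "projective_chart \<Phi> \<longleftrightarrow>
     (\<forall>t. real_analytic_at \<Phi> t \<and> 0 < deriv \<Phi> t \<and> \<Phi> (t + 2 * pi) = \<Phi> t + 2 * pi) \<and>
     (\<forall>f\<in>H. \<exists>p q r s. 0 < p * s - q * r \<and> (\<forall>t.
        cos (\<Phi> (f t) / 2) * (r * cos (\<Phi> t / 2) + s * sin (\<Phi> t / 2)) =
        sin (\<Phi> (f t) / 2) * (p * cos (\<Phi> t / 2) + q * sin (\<Phi> t / 2))))"

lemma free_projective_chart:
  assumes free: free
  shows "\<exists>\<Phi>. projective_chart \<Phi>"
proof -
  have "\<not> (\<lambda>f. cis (f 0)) ` H \<subseteq> {cis 0}" using H_orbit finite_subset by blast
  then obtain f where f: "f \<in> H" "cis (f 0) \<noteq> cis 0" by blast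
  \<comment> \<open>A coincidence on the circle would give a lift of \<open>f\<close> with a fixed
    point, hence equal to the identity, against the choice of \<open>f\<close>.\<close>
  have ft: "cis t \<noteq> cis (f t)" for t
  proof
    assume "cis t = cis (f t)"
    then obtain k where k: "t = f t + 2 * pi * of_int k" unfolding cis_eq_iff by auto
    have "f 0 + 2 * pi * of_int k = 0"
      using freeD[OF free H_comp[OF H_shift_int f(1)] k[symmetric]] .
    then have "cis 0 = cis (f 0)" unfolding cis_eq_iff by (intro exI[of _ k]) simp
    then show False using f(2) by simp
  qed
  \<comment> \<open>This is the speed of the curve \<open>t \<mapsto> (t, f t)\<close> in the
    Lorentz metric \<open>\<Omega> ds dt\<close>. As \<open>g\<close> commutes with
    \<open>f\<close>, it maps the curve to itself, whence \<open>l_inv\<close>.\<close>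
  define l where "l t = sqrt (\<Omega> t (f t) * deriv f t)" for t
  have l_pos: "0 < l t" for t unfolding l_def using Om_pos[OF ft] H_pos[OF f(1)] by simp
  have l_ra: "real_analytic_at l t" for t
    unfolding l_def[abs_def]
  proof (rule real_analytic_at_sqrt)
    show "real_analytic_at (\<lambda>t. \<Omega> t (f t) * deriv f t) t"
      by (rule real_analytic_at_mult[OF real_analytic2_at_compose[OF Om_ra[OF ft] H_ra[OF f(1)]]
            real_analytic_at_deriv[OF H_ra[OF f(1)]]])
    show "0 < \<Omega> t (f t) * deriv f t" using Om_pos[OF ft] H_pos[OF f(1)] by simp
  qed
  have l_inv: "l (g t) * deriv g t = l t" if g: "g \<in> H" for g t
  proof -
    have comm: "f (g x) = g (f x)" for x by (rule H_commute[OF free f(1) g])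
    have "((\<lambda>x. f (g x)) has_real_derivative deriv f (g t) * deriv g t) (at t)"
      by (intro DERIV_chain2 H_DERIV f g)
    moreover have "((\<lambda>x. g (f x)) has_real_derivative deriv g (f t) * deriv f t) (at t)"
      by (intro DERIV_chain2 H_DERIV f g)
    ultimately have d: "deriv f (g t) * deriv g t = deriv g (f t) * deriv f t"
      unfolding comm using DERIV_unique by metis
    have "\<Omega> (g t) (f (g t)) * deriv f (g t) * (deriv g t)\<^sup>2
        = \<Omega> (g t) (g (f t)) * (deriv f (g t) * deriv g t) * deriv g t"
      by (simp add: comm power2_eq_square)
    also have "\<dots> = \<Omega> (g t) (g (f t)) * deriv g t * deriv g (f t) * deriv f t"
      by (simp add: d)
    also have "\<dots> = \<Omega> t (f t) * deriv f t" using Om_inv[OF g ft] by simp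
    finally have "l t = sqrt (\<Omega> (g t) (f (g t)) * deriv f (g t) * (deriv g t)\<^sup>2)"
      by (simp add: l_def)
    also have "\<dots> = l (g t) * deriv g t"
      using H_pos[OF g, of t] by (simp add: real_sqrt_mult l_def)
    finally show ?thesis by simp
  qed
  obtain L where L: "\<And>x. (L has_real_derivative l x) (at x)"
    using real_antiderivative[of "-\<infinity>" \<infinity> l, OF _ real_analytic_at_isCont[OF l_ra]] by auto
  have L_H: "L (g t) - L t = L (g 0) - L 0" if g: "g \<in> H" for g t
  proof (rule DERIV_isconst_all[of "\<lambda>t. L (g t) - L t"])
    show "\<forall>x. ((\<lambda>t. L (g t) - L t) has_real_derivative 0) (at x)"
    proof
      fix x
      have "((\<lambda>t. L (g t) - L t) has_real_derivative l (g x) * deriv g x - l x) (at x)"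
        by (intro DERIV_diff DERIV_chain2[of L] L H_DERIV g)
      then show "((\<lambda>t. L (g t) - L t) has_real_derivative 0) (at x)" by (simp add: l_inv g)
    qed
  qed
  define c where "c = L (2 * pi) - L 0"
  have L_less: "L x < L y" if "x < y" for x y
    using DERIV_pos_imp_increasing[OF that] L l_pos by metis
  have c: "0 < c" using L_less[of 0 "2 * pi"] by (simp add: c_def)
  define \<Phi> where "\<Phi> t = 2 * pi / c * L t" for t
  have \<Phi>D: "(\<Phi> has_real_derivative 2 * pi / c * l t) (at t)" for t
    unfolding \<Phi>_def[abs_def] by (intro DERIV_cmult L)
  have "projective_chart \<Phi>"
    unfolding projective_chart_def
  proof (intro conjI allI ballI)
    fix t
    show "real_analytic_at \<Phi> t"
      by (rule real_analytic_at_primitive[where f = "\<lambda>t. 2 * pi / c * l t"])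
         (rule always_eventually allI \<Phi>D real_analytic_at_mult[OF real_analytic_at_const l_ra])+
    show "0 < deriv \<Phi> t" using DERIV_imp_deriv[OF \<Phi>D[of t]] l_pos[of t] c by simp
    show "\<Phi> (t + 2 * pi) = \<Phi> t + 2 * pi"
    proof -
      have "L (t + 2 * pi) = L t + c" using L_H[OF H_shift, of t] by (simp add: c_def)
      then show ?thesis using c by (simp add: \<Phi>_def distrib_left)
    qed
  next
    fix g assume g: "g \<in> H"
    define b where "b = (\<Phi> (g 0) - \<Phi> 0) / 2"
    have \<Phi>g: "\<Phi> (g t) / 2 = \<Phi> t / 2 + b" for t
    proof -
      have "L (g t) = L t + (L (g 0) - L 0)" using L_H[OF g, of t] by simp
      then have "\<Phi> (g t) = \<Phi> t + (\<Phi> (g 0) - \<Phi> 0)"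
        by (simp add: \<Phi>_def distrib_left right_diff_distrib)
      then show ?thesis by (simp add: b_def)
    qed
    show "\<exists>p q r s. 0 < p * s - q * r \<and> (\<forall>t.
        cos (\<Phi> (g t) / 2) * (r * cos (\<Phi> t / 2) + s * sin (\<Phi> t / 2)) =
        sin (\<Phi> (g t) / 2) * (p * cos (\<Phi> t / 2) + q * sin (\<Phi> t / 2)))"
    \<comment> \<open>In arc length \<open>g\<close> is a translation, so half angles increase by
      \<open>b\<close> and the matrix is the rotation through \<open>b\<close>.\<close>
    proof (intro exI conjI allI)
      have "cos b * cos b + sin b * sin b = 1" by (metis cos_squared_eq diff_add_cancel power2_eq_square)
      then show "0 < cos b * cos b - (- sin b) * sin b" by simp
      show "cos (\<Phi> (g t) / 2) * (sin b * cos (\<Phi> t / 2) + cos b * sin (\<Phi> t / 2)) =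
        sin (\<Phi> (g t) / 2) * (cos b * cos (\<Phi> t / 2) + (- sin b) * sin (\<Phi> t / 2))" for t
        unfolding \<Phi>g sin_add cos_add by (simp add: algebra_simps)
    qed
  qed
  then show ?thesis by metis
qed

subsection \<open>Affine charts and hyperbolic elements\<close>

text \<open>An affine coordinate on the circle without \<open>x\<close>, written on its lift between
  \<open>x\<close> and \<open>x + 2 * pi\<close>. Contracting the form at \<open>x\<close> with the
  coordinate vector gives the 1-form \<open>\<Omega> x t dt\<close>, whose primitive is unique up to
  a constant; values of \<open>V\<close> elsewhere are arbitrary.\<close>

definition chart :: "real \<Rightarrow> (real \<Rightarrow> real) \<Rightarrow> bool" where
  "chart x V \<longleftrightarrow> (\<forall>t. x < t \<longrightarrow> t < x + 2 * pi \<longrightarrow> (V has_real_derivative \<Omega> x t) (at t))"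

lemma chartD: "chart x V \<Longrightarrow> x < t \<Longrightarrow> t < x + 2 * pi \<Longrightarrow> (V has_real_derivative \<Omega> x t) (at t)"
  unfolding chart_def by metis

lemma chart_exists: obtains V where "chart x V"
proof -
  obtain V where V: "\<And>t. ereal x < ereal t \<Longrightarrow> ereal t < ereal (x + 2 * pi) \<Longrightarrow> (V has_real_derivative \<Omega> x t) (at t)"
  proof (rule real_antiderivative[of "ereal x" "ereal (x + 2 * pi)" "\<Omega> x"])
    fix t assume "ereal x < ereal t" "ereal t < ereal (x + 2 * pi)"
    then have "cis x \<noteq> cis t" using cis_neq[of x t] by simp
    then show "isCont (\<Omega> x) t" by (intro real_analytic_at_isCont real_analytic2_at_slice2 Om_ra)
  qed auto
  then have "chart x V" unfolding chart_def by simp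
  then show thesis by (rule that)
qed

lemma chart_less:
  assumes V: "chart x V" and "x < s" "s < t" "t < x + 2 * pi"
  shows "V s < V t"
proof (rule DERIV_pos_imp_increasing[OF \<open>s < t\<close>])
  fix u assume "s \<le> u" "u \<le> t"
  then have u: "x < u" "u < x + 2 * pi" using assms by auto
  then show "\<exists>y. (V has_real_derivative y) (at u) \<and> 0 < y"
    using chartD[OF V u] Om_pos[OF cis_neq[OF u]] by metis
qed

lemma chart_less_iff:
  assumes V: "chart x V" and "x < s" "s < x + 2 * pi" "x < t" "t < x + 2 * pi"
  shows "V s < V t \<longleftrightarrow> s < t"
  using chart_less[OF V, of s t] chart_less[OF V, of t s] assms by (metis less_asym not_less_iff_gr_or_eq)

lemma chart_inj:
  assumes V: "chart x V" and "x < s" "s < x + 2 * pi" "x < t" "t < x + 2 * pi" "V s = V t"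
  shows "s = t"
  using chart_less_iff[OF V, of s t] chart_less_iff[OF V, of t s] assms by simp

lemma chart_continuous:
  assumes V: "chart x V" and "A \<subseteq> {x<..<x + 2 * pi}"
  shows "continuous_on A V"
  using assms(2) by (intro continuous_at_imp_continuous_on ballI DERIV_isCont[OF chartD[OF V]]) auto

lemma chart_unique:
  assumes V: "chart x V" "chart x W" and t: "x < s" "s < x + 2 * pi" "x < t" "t < x + 2 * pi"
  shows "W t - V t = W s - V s"
proof (rule DERIV_isconst3[of x "x + 2 * pi" t s "\<lambda>t. W t - V t"])
  fix u assume "u \<in> {x<..<x + 2 * pi}"
  then show "((\<lambda>t. W t - V t) has_real_derivative 0) (at u)"
    using DERIV_diff[OF chartD[OF V(2), of u] chartD[OF V(1), of u]] by simp
qed (use t in auto)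

lemma chart_shift: "chart x V \<Longrightarrow> chart x (\<lambda>t. V t - c)"
  unfolding chart_def by (auto intro!: derivative_eq_intros)

lemma inverse_DERIV:
  assumes f: "f \<in> H" and i: "i \<in> H" "\<And>t. f (i t) = t"
  shows "deriv f (i t) * deriv i t = 1"
proof -
  have "((\<lambda>t. f (i t)) has_real_derivative deriv f (i t) * deriv i t) (at t)"
    by (rule DERIV_chain2[of f, OF H_DERIV[OF f] H_DERIV[OF i(1)]])
  then have "((\<lambda>t. t) has_real_derivative deriv f (i t) * deriv i t) (at t)" by (simp add: i)
  then show ?thesis using DERIV_unique[OF _ DERIV_ident] by metis
qed

text \<open>The element \<open>f\<close> preserves the form but multiplies the tangent vector at
  \<open>x\<close> by \<open>deriv f x\<close>; this accounts for the divisor.\<close>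

lemma chart_transport:
  assumes V: "chart x V" and f: "f \<in> H" and i: "i \<in> H" "\<And>t. i (f t) = t" "\<And>t. f (i t) = t"
  shows "chart (f x) (\<lambda>t. V (i t) / deriv f x)"
  unfolding chart_def
proof (intro allI impI)
  fix t assume t: "f x < t" "t < f x + 2 * pi"
  have "i (f x) < i t" "i t < i (f x + 2 * pi)" using t i(1) by simp_all
  then have it: "x < i t" "i t < x + 2 * pi" using H_per[OF i(1)] i(2) by simp_all
  have "((\<lambda>t. V (i t) / deriv f x) has_real_derivative \<Omega> x (i t) * deriv i t / deriv f x) (at t)"
    by (rule DERIV_cdivide[OF DERIV_chain2[of V, OF chartD[OF V it] H_DERIV[OF i(1)]]])
  moreover have "\<Omega> x (i t) * deriv i t / deriv f x = \<Omega> (f x) t"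
    using Om_inv[OF f cis_neq[OF it]] inverse_DERIV[OF f i(1,3), of t] H_pos[OF f, of x]
    by (simp add: i field_simps) (metis mult.assoc mult.commute mult.right_neutral)
  ultimately show "((\<lambda>t. V (i t) / deriv f x) has_real_derivative \<Omega> (f x) t) (at t)" by simp
qed

text \<open>The transported chart is again a chart at \<open>a\<close>, so the two differ by a
  constant; \<open>b\<close> only serves to eliminate it.\<close>

lemma chart_affine:
  assumes V: "chart a V" and f: "f \<in> H" "f a = a" and b: "a < b" "b < a + 2 * pi"
    and t: "a < t" "t < a + 2 * pi"
  shows "V (f t) - V (f b) = (V t - V b) / deriv f a"
proof -
  obtain i where i: "i \<in> H" "\<And>x. i (f x) = x" "\<And>x. f (i x) = x" using H_inv[OF f(1)] by metis
  have "chart a (\<lambda>t. V (i t) / deriv f a)" using chart_transport[OF V f(1) i] f(2) by simp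
  moreover have "a < f t \<and> f t < a + 2 * pi" if "a < t" "t < a + 2 * pi" for t
    using that H_less[OF f(1), of a t] H_less[OF f(1), of t "a + 2 * pi"] H_per[OF f(1), of a] f(2) by simp
  ultimately have "V (i (f t)) / deriv f a - V (f t) = V (i (f b)) / deriv f a - V (f b)"
    by (intro chart_unique[OF V]) (use b t in auto)
  then show ?thesis by (simp add: i diff_divide_distrib)
qed

lemma fixes_interval_imp_id:
  assumes f: "f \<in> H" "f a = a" and "\<And>t. a < t \<Longrightarrow> t < a + 2 * pi \<Longrightarrow> f t = t"
  shows "f t = t"
proof -
  obtain k :: int where k: "a \<le> t + 2 * pi * of_int k" "t + 2 * pi * of_int k < a + 2 * pi"
    using representative[of a t] by metis
  have "f (t + 2 * pi * of_int k) = t + 2 * pi * of_int k"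
    using k assms by (cases "a = t + 2 * pi * of_int k") auto
  then show ?thesis using H_per_int[OF f(1), of t k] by simp
qed

section \<open>Elements with two fixed points\<close>

definition hyperbolic :: "(real \<Rightarrow> real) \<Rightarrow> real \<Rightarrow> real \<Rightarrow> bool" where
  "hyperbolic f a b \<longleftrightarrow> f \<in> H \<and> f a = a \<and> f b = b \<and> a < b \<and> b < a + 2 * pi \<and> (\<exists>t. f t \<noteq> t)"

lemma interval_sign:
  assumes f: "f \<in> H" and ne: "\<And>t. a < t \<Longrightarrow> t < b \<Longrightarrow> f t \<noteq> t"
  shows "(\<forall>t. a < t \<longrightarrow> t < b \<longrightarrow> t < f t) \<or> (\<forall>t. a < t \<longrightarrow> t < b \<longrightarrow> f t < t)"
proof (rule ccontr)
  assume "\<not> ?thesis"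
  then obtain s t where s: "a < s" "s < b" "f s \<le> s" and t: "a < t" "t < b" "t \<le> f t"
    by (meson not_le)
  have "connected ((\<lambda>x. f x - x) ` {a<..<b})"
    by (intro connected_continuous_image continuous_intros H_cont f) simp
  then have "0 \<in> (\<lambda>x. f x - x) ` {a<..<b}"
    by (rule connectedD_interval[of _ "f s - s" "f t - t"]) (use s t in auto)
  then show False using ne by force
qed

text \<open>
  If \<open>p\<close> fixes only \<open>a\<close> on the circle and \<open>k\<close> moves \<open>a\<close>, then \<open>p\<^sup>n \<circ> k\<close> has two fixed points for
  large \<open>n\<close>.
\<close>

lemma hyperbolic_exists:
  assumes "\<not> free"
  obtains f a b where "hyperbolic f a b"
proof -
  obtain g a s where g: "g \<in> H" "g a = a" "g s \<noteq> s" using assms unfolding free_def by metis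
  obtain j where j: "j \<in> H" "\<And>x. j (g x) = x" "\<And>x. g (j x) = x" using H_inv[OF g(1)] by metis
  show thesis
  proof (cases "\<exists>b. a < b \<and> b < a + 2 * pi \<and> g b = b")
    case True
    then show thesis using that g unfolding hyperbolic_def by metis
  next
    case False
    \<comment> \<open>With \<open>a\<close> the only fixed point on the circle, \<open>g\<close>
      moves the open turn after \<open>a\<close> in one direction; its inverse is taken if that
      direction is down.\<close>
    have "\<exists>p. p \<in> H \<and> p a = a \<and> (\<forall>t. a < t \<longrightarrow> t < a + 2 * pi \<longrightarrow> t < p t)"
    proof (cases "\<forall>t. a < t \<longrightarrow> t < a + 2 * pi \<longrightarrow> t < g t")
      case True then show ?thesis using g by metis
    next
      case False': False
      then have g_less: "\<forall>t. a < t \<longrightarrow> t < a + 2 * pi \<longrightarrow> g t < t"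
        using interval_sign[OF g(1), of a "a + 2 * pi"] False by metis
      have "t < j t" if "a < t" "t < a + 2 * pi" for t
        using H_less[OF j(1), of "g t" t] g_less that j(2) by simp
      moreover have "j a = a" using j(2)[of a] g(2) by simp
      ultimately show ?thesis using j(1) by metis
    qed
    then obtain p where p: "p \<in> H" "p a = a" "\<And>t. a < t \<Longrightarrow> t < a + 2 * pi \<Longrightarrow> t < p t" by metis
    have "\<not> (\<lambda>f. cis (f a)) ` H \<subseteq> {cis a}" using H_orbit finite_subset by blast
    then obtain k0 where k0: "k0 \<in> H" "cis a \<noteq> cis (k0 a)" by force
    obtain m :: int where m: "a < k0 a + 2 * pi * of_int m" "k0 a + 2 * pi * of_int m < a + 2 * pi"
      using representative_strict[OF k0(2)] by metis
    define k where "k t = k0 t + 2 * pi * of_int m" for t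
    have k: "k \<in> H" "a < k a" "k a < a + 2 * pi"
      using H_comp[OF H_shift_int k0(1)] m by (simp_all add: k_def[abs_def])
    obtain i where i: "i \<in> H" "\<And>x. i (k x) = x" "\<And>x. k (i x) = x" using H_inv[OF k(1)] by metis
    \<comment> \<open>The point \<open>u\<close> lies between \<open>d\<close>, which
      \<open>k\<close> sends to \<open>a + 2 * pi\<close>, and \<open>a + 2 * pi\<close>. Hence
      \<open>k u\<close> lies in the turn after \<open>a + 2 * pi\<close>, which iterates of
      \<open>p\<close> push up to \<open>a + 4 * pi\<close>, past \<open>u + 2 * pi\<close>.\<close>
    define d where "d = i (a + 2 * pi)"
    have kd: "k d = a + 2 * pi" by (simp add: d_def i)
    have ad: "a < d" using H_less[OF k(1), of a d] k(3) kd by simp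
    have da: "d < a + 2 * pi" using H_less[OF k(1), of d "a + 2 * pi"] k(2) kd H_per[OF k(1), of a] by simp
    define u where "u = (d + (a + 2 * pi)) / 2"
    have u: "d < u" "u < a + 2 * pi" using da by (simp_all add: u_def)
    have ku: "a + 2 * pi < k u" "k u < a + 4 * pi"
      using H_less[OF k(1), of d u] kd u H_less[OF k(1), of u "a + 2 * pi"] H_per[OF k(1), of a] k(3)
      by simp_all
    have pa: "p (a + 4 * pi) = a + 4 * pi"
      using H_per_int[OF p(1), of a 2] p(2) by simp
    have p_up: "t < p t" if "a + 2 * pi < t" "t < a + 4 * pi" for t
      using p(3)[of "t - 2 * pi"] H_per[OF p(1), of "t - 2 * pi"] that by simp
    have pn_le: "(p ^^ n) (k u) \<le> a + 4 * pi" for n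
      by (induction n) (use ku H_le[OF p(1), of _ "a + 4 * pi"] pa in auto)
    obtain L where L: "(\<lambda>n. (p ^^ n) (k u)) \<longlonglongrightarrow> L" "p L = L" "k u \<le> L" "L \<le> a + 4 * pi"
      using iterate_limit_up[OF H_cont[OF p(1)] H_mono[OF p(1)] less_imp_le[OF p_up[OF ku]] pn_le] by metis
    have "L = a + 4 * pi"
      using p_up[of L] L ku by (metis less_eq_real_def less_irrefl less_le_trans)
    then have "\<forall>\<^sub>F n in sequentially. u + 2 * pi < (p ^^ n) (k u)"
      using order_tendstoD(1)[OF L(1), of "u + 2 * pi"] u by simp
    then obtain n where n: "u + 2 * pi < (p ^^ n) (k u)"
      using eventually_happens trivial_limit_sequentially by blast
    have pn: "p ^^ n \<in> H" by (rule H_funpow[OF p(1)])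
    have pna: "(p ^^ n) a = a" by (induction n) (simp_all add: p(2))
    \<comment> \<open>The difference \<open>F t - t\<close> is negative at \<open>d\<close>,
      positive at \<open>u\<close> and negative at \<open>a + 2 * pi\<close>; its two zeros are less
      than one turn apart.\<close>
    define F where "F t = (p ^^ n) (k t) - 2 * pi" for t
    have F: "F \<in> H" using H_comp[OF H_shift_int[of "-1"] H_comp[OF pn k(1)]] by (simp add: F_def[abs_def])
    have Fd: "F d < d" using ad kd H_per[OF pn, of a] pna by (simp add: F_def)
    have Fu: "u < F u" using n by (simp add: F_def)
    have Fa: "F (a + 2 * pi) < a + 2 * pi"
      using H_less[OF pn, of "k a" "a + 2 * pi"] k(3) H_per[OF pn] H_per[OF k(1)] pna by (simp add: F_def)
    have cont: "continuous_on A (\<lambda>t. F t - t)" for A by (intro continuous_intros H_cont F)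
    have "\<exists>x\<ge>d. x \<le> u \<and> F x - x = 0"
      by (rule IVT'[OF _ _ _ cont]) (use Fd Fu u in auto)
    then obtain v where v: "d \<le> v" "v \<le> u" "F v = v" by auto
    have "\<exists>x\<ge>u. x \<le> a + 2 * pi \<and> F x - x = 0"
      by (rule IVT2'[OF _ _ _ cont]) (use Fa Fu u in auto)
    then obtain w where w: "u \<le> w" "w \<le> a + 2 * pi" "F w = w" by auto
    have "v \<noteq> u" "w \<noteq> u" using v w Fu by auto
    then have "hyperbolic F v w"
      unfolding hyperbolic_def using F v w Fu ad by (intro conjI exI[of _ u]) auto
    then show thesis by (rule that)
  qed
qed

text \<open>With the origin at the second fixed point the affine action becomes linear. Multiplier
  one would fix the whole turn, as \<open>V\<close> is injective, and make the element trivial;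
  passing to the inverse brings the multiplier above one. This justifies the word
  hyperbolic.\<close>

lemma hyperbolic_normal_form:
  assumes "\<not> free"
  obtains f a b V \<mu> where "f \<in> H" "f a = a" "f b = b" "a < b" "b < a + 2 * pi"
    "chart a V" "V b = 0" "1 < (\<mu>::real)" "\<And>t. a < t \<Longrightarrow> t < a + 2 * pi \<Longrightarrow> V (f t) = \<mu> * V t"
proof -
  obtain g a b where "hyperbolic g a b" using hyperbolic_exists[OF assms] by metis
  then have g: "g \<in> H" "g a = a" "g b = b" and ab: "a < b" "b < a + 2 * pi" and ne: "\<exists>t. g t \<noteq> t"
    unfolding hyperbolic_def by auto
  obtain V0 where V0: "chart a V0" using chart_exists by metis
  define V where "V t = V0 t - V0 b" for t
  have V: "chart a V" unfolding V_def[abs_def] by (rule chart_shift[OF V0])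
  have Vb: "V b = 0" by (simp add: V_def)
  have in_int: "a < h t \<and> h t < a + 2 * pi" if "h \<in> H" "h a = a" "a < t" "t < a + 2 * pi" for t h
    using that H_less[of h a t] H_less[of h t "a + 2 * pi"] H_per[of h a] by simp
  obtain j where j: "j \<in> H" "\<And>x. j (g x) = x" "\<And>x. g (j x) = x" using H_inv[OF g(1)] by metis
  have ja: "j a = a" "j b = b" using j(2)[of a] j(2)[of b] g by simp_all
  define m where "m = 1 / deriv g a"
  have m0: "0 < m" using H_pos[OF g(1)] by (simp add: m_def)
  have Vg: "V (g t) = m * V t" if "a < t" "t < a + 2 * pi" for t
    using chart_affine[OF V g(1,2) ab that] g(3) Vb by (simp add: m_def)
  have "m \<noteq> 1"
  proof
    assume "m = 1"
    then have "g t = t" if "a < t" "t < a + 2 * pi" for t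
      using Vg[OF that] chart_inj[OF V _ _ that] in_int[OF g(1,2) that] by simp
    then show False using fixes_interval_imp_id[OF g(1,2)] ne by metis
  qed
  then consider "1 < m" | "m < 1" by linarith
  then show thesis
  proof cases
    case 1
    then show thesis using that[OF g ab V Vb 1 Vg] by simp
  next
    case 2
    have "V (j t) = 1 / m * V t" if "a < t" "t < a + 2 * pi" for t
      using Vg[of "j t"] in_int[OF j(1) ja(1) that] m0 j(3) by (simp add: field_simps)
    then show thesis using that[OF j(1) ja ab V Vb, of "1 / m"] 2 m0 by simp
  qed
qed

end

lemma D1_eqI:
  assumes "cis s \<noteq> cis t" and eq: "\<And>x. cis x \<noteq> cis t \<Longrightarrow> F x t = g x"
    and "(g has_real_derivative d) (at s)"
  shows "D1 F s t = d"
  unfolding D1_def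
proof (rule DERIV_imp_deriv, rule has_field_derivative_transform_within_open[OF assms(3)])
  show "open {x. cis x \<noteq> cis t}"
    by (intro open_Collect_neq continuous_intros)
qed (use assms in auto)

lemma D2_eqI:
  assumes "cis s \<noteq> cis t" and eq: "\<And>y. cis s \<noteq> cis y \<Longrightarrow> F s y = g y"
    and "(g has_real_derivative d) (at t)"
  shows "D2 F s t = d"
  unfolding D2_def
proof (rule DERIV_imp_deriv, rule has_field_derivative_transform_within_open[OF assms(3)])
  show "open {y. cis s \<noteq> cis y}"
    by (intro open_Collect_neq continuous_intros)
qed (use assms in auto)

context circle_action begin

subsection \<open>Constant curvature\<close>

text \<open>
  Up to a factor this is the Gauss curvature of the Lorentz metric \<open>\<Omega> ds dt\<close>: it equals the mixed
  derivative of \<open>ln \<Omega>\<close> divided by \<open>\<Omega>\<close>.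
\<close>

definition K :: "real \<Rightarrow> real \<Rightarrow> real" where
  "K s t = (\<Omega> s t * D2 (D1 \<Omega>) s t - D1 \<Omega> s t * D2 \<Omega> s t) / \<Omega> s t ^ 3"

text \<open>Under \<open>f\<close>, \<open>ln \<Omega>\<close> changes by a function of
  \<open>s\<close> plus a function of \<open>t\<close>, which the mixed derivative kills; what
  remains scales like \<open>\<Omega>\<close>. The computation clears the logarithms: numerator and
  denominator of \<open>K\<close> both scale by \<open>(p s * p t) ^ 3\<close>.\<close>

lemma K_invariant:
  assumes f: "f \<in> H" and st: "cis s \<noteq> cis t"
  shows "K (f s) (f t) = K s t"
proof -
  define p where "p = deriv f"
  define p' where "p' = deriv p"
  have fD: "(f has_real_derivative p x) (at x)" for x unfolding p_def by (rule H_DERIV[OF f])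
  have pD: "(p has_real_derivative p' x) (at x)" for x
    unfolding p'_def p_def by (intro real_analytic_at_DERIV real_analytic_at_deriv H_ra f)
  have p0: "0 < p x" for x unfolding p_def by (rule H_pos[OF f])
  have ra: "real_analytic2_at \<Omega> (f x) (f y)" if "cis x \<noteq> cis y" for x y
    by (rule Om_ra) (use that f in simp)
  have E0: "\<Omega> x y = \<Omega> (f x) (f y) * p x * p y" if "cis x \<noteq> cis y" for x y
    unfolding p_def using Om_inv[OF f that] by simp
  have E1: "D1 \<Omega> x y = D1 \<Omega> (f x) (f y) * p x * p x * p y + \<Omega> (f x) (f y) * p' x * p y"
    if "cis x \<noteq> cis y" for x y
  proof (rule D1_eqI[OF that E0])
    have "((\<lambda>z. \<Omega> (f z) (f y)) has_real_derivative D1 \<Omega> (f x) (f y) * p x) (at x)"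
      by (rule DERIV_chain2[of "\<lambda>z. \<Omega> z (f y)", OF real_analytic2_at_DERIV1[OF ra[OF that]] fD])
    from DERIV_cmult_right[OF DERIV_mult[OF this pD], of "p y"]
    show "((\<lambda>z. \<Omega> (f z) (f y) * p z * p y) has_real_derivative
      D1 \<Omega> (f x) (f y) * p x * p x * p y + \<Omega> (f x) (f y) * p' x * p y) (at x)"
      by (simp add: algebra_simps)
  qed
  have E2: "D2 \<Omega> x y = D2 \<Omega> (f x) (f y) * p y * p x * p y + \<Omega> (f x) (f y) * p x * p' y"
    if "cis x \<noteq> cis y" for x y
  proof (rule D2_eqI[OF that E0])
    have "((\<lambda>z. \<Omega> (f x) (f z)) has_real_derivative D2 \<Omega> (f x) (f y) * p y) (at y)"
      by (rule DERIV_chain2[of "\<Omega> (f x)", OF real_analytic2_at_DERIV2[OF ra[OF that]] fD])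
    from DERIV_mult[OF DERIV_cmult_right[OF this, of "p x"] pD]
    show "((\<lambda>z. \<Omega> (f x) (f z) * p x * p z) has_real_derivative
      D2 \<Omega> (f x) (f y) * p y * p x * p y + \<Omega> (f x) (f y) * p x * p' y) (at y)"
      by (simp add: algebra_simps)
  qed
  have E12: "D2 (D1 \<Omega>) s t = (D2 (D1 \<Omega>) (f s) (f t) * p t * p s * p s * p t
      + D1 \<Omega> (f s) (f t) * p s * p s * p' t)
      + (D2 \<Omega> (f s) (f t) * p t * p' s * p t + \<Omega> (f s) (f t) * p' s * p' t)"
  proof (rule D2_eqI[OF st E1])
    have 1: "((\<lambda>z. D1 \<Omega> (f s) (f z)) has_real_derivative D2 (D1 \<Omega>) (f s) (f t) * p t) (at t)"
      by (rule DERIV_chain2[of "D1 \<Omega> (f s)",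
            OF real_analytic2_at_DERIV2[OF real_analytic2_at_D1[OF ra[OF st]]] fD])
    have 2: "((\<lambda>z. \<Omega> (f s) (f z)) has_real_derivative D2 \<Omega> (f s) (f t) * p t) (at t)"
      by (rule DERIV_chain2[of "\<Omega> (f s)", OF real_analytic2_at_DERIV2[OF ra[OF st]] fD])
    show "((\<lambda>z. D1 \<Omega> (f s) (f z) * p s * p s * p z + \<Omega> (f s) (f z) * p' s * p z) has_real_derivative
      (D2 (D1 \<Omega>) (f s) (f t) * p t * p s * p s * p t + D1 \<Omega> (f s) (f t) * p s * p s * p' t)
      + (D2 \<Omega> (f s) (f t) * p t * p' s * p t + \<Omega> (f s) (f t) * p' s * p' t)) (at t)"
      by (rule derivative_eq_intros 1 2 pD refl)+ (simp add: algebra_simps)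
  qed
  have "\<Omega> s t * D2 (D1 \<Omega>) s t - D1 \<Omega> s t * D2 \<Omega> s t =
      (\<Omega> (f s) (f t) * D2 (D1 \<Omega>) (f s) (f t) - D1 \<Omega> (f s) (f t) * D2 \<Omega> (f s) (f t)) * (p s * p t) ^ 3"
    unfolding E12 E1[OF st] E2[OF st] E0[OF st] by algebra
  moreover have "\<Omega> s t ^ 3 = \<Omega> (f s) (f t) ^ 3 * (p s * p t) ^ 3"
    unfolding E0[OF st] by algebra
  moreover have "p s * p t \<noteq> 0" using p0[of s] p0[of t] by simp
  ultimately show ?thesis unfolding K_def by simp
qed

lemma K_continuous1:
  assumes "cis s \<noteq> cis t"
  shows "isCont (\<lambda>s. K s t) s"
proof -
  note ra = Om_ra[OF assms]
  have "real_analytic_at (\<lambda>s. K s t) s"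
    unfolding K_def
    by (intro real_analytic_at_divide real_analytic_at_diff real_analytic_at_mult real_analytic_at_power
        real_analytic2_at_slice1[OF ra] real_analytic2_at_slice1[OF real_analytic2_at_D1[OF ra]]
        real_analytic2_at_slice1[OF real_analytic2_at_D2[OF ra]]
        real_analytic2_at_slice1[OF real_analytic2_at_D2[OF real_analytic2_at_D1[OF ra]]])
      (use Om_pos[OF assms] in simp)
  then show ?thesis by (rule real_analytic_at_isCont)
qed

lemma K_analytic2:
  assumes "cis s \<noteq> cis t"
  shows "real_analytic_at (K s) t"
proof -
  note ra = Om_ra[OF assms]
  show ?thesis
    unfolding K_def[abs_def]
    by (intro real_analytic_at_divide real_analytic_at_diff real_analytic_at_mult real_analytic_at_power
        real_analytic2_at_slice2[OF ra] real_analytic2_at_slice2[OF real_analytic2_at_D1[OF ra]]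
        real_analytic2_at_slice2[OF real_analytic2_at_D2[OF ra]]
        real_analytic2_at_slice2[OF real_analytic2_at_D2[OF real_analytic2_at_D1[OF ra]]])
      (use Om_pos[OF assms] in simp)
qed

text \<open>By compactness the orbit accumulates somewhere, but possibly only over \<open>x\<close>
  itself. A group element moves such a limit point off \<open>x\<close>: it has to lie strictly
  inside the turn for the identity theorem to apply there.\<close>

lemma orbit_limit_point:
  obtains p where "x < p" "p < x + 2 * pi" "p islimpt {t \<in> (\<lambda>g. g b) ` H. x < t \<and> t < x + 2 * pi}"
proof -
  let ?O = "(\<lambda>g. g b) ` H"
  have "(\<lambda>f. cis (f b)) ` H \<subseteq> cis ` (?O \<inter> {x..x + 2 * pi})"
  proof
    fix z assume "z \<in> (\<lambda>f. cis (f b)) ` H"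
    then obtain f where f: "f \<in> H" "z = cis (f b)" by auto
    obtain k :: int where k: "x \<le> f b + 2 * pi * of_int k" "f b + 2 * pi * of_int k < x + 2 * pi"
      using representative[of x "f b"] by metis
    have "f b + 2 * pi * of_int k \<in> ?O"
      using H_comp[OF H_shift_int f(1), of k] by (rule rev_image_eqI) simp
    moreover have "z = cis (f b + 2 * pi * of_int k)" unfolding f(2) cis_eq_iff
      by (rule exI[of _ "- k"]) simp
    ultimately show "z \<in> cis ` (?O \<inter> {x..x + 2 * pi})" using k by auto
  qed
  then have "infinite (?O \<inter> {x..x + 2 * pi})"
    using H_orbit finite_surj by metis
  moreover have "compact {x..x + 2 * pi}" by simp
  ultimately obtain p0 where p0: "p0 islimpt (?O \<inter> {x..x + 2 * pi})"
    unfolding compact_eq_Bolzano_Weierstrass by (meson Int_lower2)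
  then have p0: "p0 islimpt ?O" by (meson islimpt_subset Int_lower1)
  have "\<not> (\<lambda>f. cis (f p0)) ` H \<subseteq> {cis x}" using H_orbit finite_subset by blast
  then obtain g where g: "g \<in> H" "cis x \<noteq> cis (g p0)" by force
  obtain k :: int where k: "x < g p0 + 2 * pi * of_int k" "g p0 + 2 * pi * of_int k < x + 2 * pi"
    using representative_strict[OF g(2)] by metis
  define h where "h t = g t + 2 * pi * of_int k" for t
  have h: "h \<in> H" unfolding h_def[abs_def] by (rule H_comp[OF H_shift_int g(1)])
  obtain u where u: "\<And>n. u n \<in> ?O - {p0}" "u \<longlonglongrightarrow> p0" using p0 unfolding islimpt_sequential by metis
  have "h p0 islimpt ?O"
    unfolding islimpt_sequential
  proof (intro exI conjI allI)
    fix n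
    obtain f where f: "f \<in> H" "u n = f b" using u(1)[of n] by auto
    have "h (u n) \<in> ?O" using H_comp[OF h f(1)] f(2) by (rule_tac rev_image_eqI) simp_all
    then show "(\<lambda>n. h (u n)) n \<in> ?O - {h p0}" using u(1)[of n] h by simp
    show "(\<lambda>n. h (u n)) \<longlonglongrightarrow> h p0"
      by (rule continuous_on_tendsto_compose[OF H_cont[OF h, of UNIV] u(2)]) auto
  qed
  then have "h p0 islimpt (?O \<inter> {x<..<x + 2 * pi})"
    using k islimpt_Int_eventually[of "h p0" ?O "{x<..<x + 2 * pi}"] eventually_at_in_open'[of "{x<..<x + 2 * pi}" "h p0"]
    by (simp add: h_def)
  moreover have "?O \<inter> {x<..<x + 2 * pi} = {t \<in> ?O. x < t \<and> t < x + 2 * pi}" by auto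
  ultimately show thesis using that[of "h p0"] k by (simp add: h_def)
qed

text \<open>Both ends of the turn are infinitely far away in the affine coordinate: completeness of
  the affine structure on the circle without \<open>x\<close>.\<close>

definition complete :: "real \<Rightarrow> bool" where
  "complete x \<longleftrightarrow> (\<exists>V. chart x V \<and> (\<forall>y. \<exists>t. x < t \<and> t < x + 2 * pi \<and> V t = y))"

lemma K_constant_and_complete:
  assumes "\<not> free"
  obtains c a where "\<And>s t. s < t \<Longrightarrow> t < s + 2 * pi \<Longrightarrow> K s t = c" "complete a"
proof -
  obtain f a b V \<mu> where f: "f \<in> H" "f a = a" "f b = b" and ab: "a < b" "b < a + 2 * pi"
    and V: "chart a V" "V b = 0" and \<mu>: "1 < (\<mu>::real)"
    and Vf: "\<And>t. a < t \<Longrightarrow> t < a + 2 * pi \<Longrightarrow> V (f t) = \<mu> * V t"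
    using hyperbolic_normal_form[OF assms] by metis
  have f_int: "a < f t" "f t < a + 2 * pi" if "a < t" "t < a + 2 * pi" for t
    using that H_less[OF f(1), of a t] H_less[OF f(1), of t "a + 2 * pi"] H_per[OF f(1), of a] f(2) by simp_all
  have fn: "f ^^ n \<in> H" for n by (rule H_funpow[OF f(1)])
  have fn_fix: "(f ^^ n) a = a" "(f ^^ n) b = b" for n by (induction n) (simp_all add: f)
  have fn_int: "a < (f ^^ n) t" "(f ^^ n) t < a + 2 * pi" if "a < t" "t < a + 2 * pi" for t n
    by (induction n) (simp_all add: that f_int)
  have Vfn: "V ((f ^^ n) t) = \<mu> ^ n * V t" if "a < t" "t < a + 2 * pi" for t n
    by (induction n) (simp_all add: Vf fn_int that)
  have V_sign: "V t < 0 \<longleftrightarrow> t < b" "0 < V t \<longleftrightarrow> b < t" if "a < t" "t < a + 2 * pi" for t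
    using chart_less_iff[OF V(1) that ab] chart_less_iff[OF V(1) ab that] V(2) by simp_all
  have "complete a"
    unfolding complete_def
  proof (intro exI[of _ V] conjI allI V(1))
    fix y :: real
    have large: "\<exists>n. \<bar>y\<bar> < \<mu> ^ n * e" if "0 < e" for e
      using real_arch_pow[OF \<mu>, of "\<bar>y\<bar> / e"] that by (simp add: field_simps)
    define s where "s = (a + b) / 2"
    define t where "t = (b + (a + 2 * pi)) / 2"
    have s: "a < s" "s < b" "s < a + 2 * pi" and t: "a < t" "b < t" "t < a + 2 * pi" using ab by (simp_all add: s_def t_def)
    obtain m where m: "\<bar>y\<bar> < \<mu> ^ m * - V s" using large[of "- V s"] V_sign(1)[OF s(1,3)] s by auto
    obtain n where n: "\<bar>y\<bar> < \<mu> ^ n * V t" using large[of "V t"] V_sign(2)[OF t(1,3)] t by auto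
    have "connected (V ` {a<..<a + 2 * pi})"
      by (rule connected_continuous_image[OF chart_continuous[OF V(1)]]) auto
    moreover have "V ((f ^^ m) s) \<in> V ` {a<..<a + 2 * pi}" "V ((f ^^ n) t) \<in> V ` {a<..<a + 2 * pi}"
      using fn_int s t by auto
    ultimately have "y \<in> V ` {a<..<a + 2 * pi}"
      by (rule connectedD_interval) (use m n Vfn[OF s(1,3), of m] Vfn[OF t(1,3), of n] in auto)
    then show "\<exists>t>a. t < a + 2 * pi \<and> V t = y" by auto
  qed
  \<comment> \<open>In the chart \<open>f\<close> expands away from \<open>b\<close>, so
    \<open>a\<close> attracts the whole open turn between two consecutive lifts of
    \<open>b\<close>.\<close>
  have lim: "(\<lambda>n. (f ^^ n) x) \<longlonglongrightarrow> a" if x: "b - 2 * pi < x" "x < b" for x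
  proof -
    have no_fix: "L = b" if "a < L" "L < a + 2 * pi" "f L = L" for L
    proof -
      have "V L = \<mu> * V L" using Vf[OF that(1,2)] that(3) by simp
      then have "V L = 0" using \<mu> by simp
      then show ?thesis using chart_inj[OF V(1) that(1,2) ab] V(2) by simp
    qed
    consider "x = a" | "a < x" | "x < a" by linarith
    then show ?thesis
    proof cases
      case 1 then show ?thesis by (simp add: fn_fix)
    next
      case 2
      have x2: "x < a + 2 * pi" using x ab by simp
      have "\<mu> * V x < V x" using V_sign(1)[OF 2 x2] x(2) \<mu> by (simp add: mult_less_cancel_right1)
      then have "f x < x" using chart_less_iff[OF V(1) f_int[OF 2 x2] 2 x2] Vf[OF 2 x2] by simp
      then obtain L where L: "(\<lambda>n. (f ^^ n) x) \<longlonglongrightarrow> L" "f L = L" "L \<le> x" "a \<le> L"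
        using iterate_limit_down[OF H_cont[OF f(1)] H_mono[OF f(1)], of x a] fn_int(1)[OF 2 x2]
        by (metis less_imp_le)
      have "L = a" using no_fix[of L] L x x2 by (metis less_eq_real_def less_le_trans not_less)
      then show ?thesis using L(1) by simp
    next
      case 3
      define y where "y = x + 2 * pi"
      have y: "a < y" "y < a + 2 * pi" "b < y" using x ab 3 by (simp_all add: y_def)
      have "V y < \<mu> * V y" using V_sign(2)[OF y(1,2)] y(3) \<mu> by (simp add: mult_less_cancel_right2)
      then have "y < f y" using chart_less_iff[OF V(1) y(1,2) f_int[OF y(1,2)]] Vf[OF y(1,2)] by simp
      then obtain L where L: "(\<lambda>n. (f ^^ n) y) \<longlonglongrightarrow> L" "f L = L" "y \<le> L" "L \<le> a + 2 * pi"
        using iterate_limit_up[OF H_cont[OF f(1)] H_mono[OF f(1)], of y "a + 2 * pi"] fn_int(2)[OF y(1,2)]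
        by (metis less_imp_le)
      have "L = a + 2 * pi" using no_fix[of L] L y by (metis less_eq_real_def less_le_trans not_less)
      moreover have "(\<lambda>n. (f ^^ n) y) = (\<lambda>n. (f ^^ n) x + 2 * pi)"
        by (simp add: y_def H_per[OF fn])
      ultimately have "(\<lambda>n. (f ^^ n) x + 2 * pi - 2 * pi) \<longlonglongrightarrow> a + 2 * pi - 2 * pi"
        using L(1) by (intro tendsto_diff tendsto_const) simp
      then show ?thesis by simp
    qed
  qed
  \<comment> \<open>\<open>K\<close> is invariant under the iterates, which fix \<open>b\<close> and
    move \<open>x\<close> towards \<open>a\<close>; the limit pair \<open>(a, b)\<close> is off the
    diagonal, where \<open>K\<close> is continuous.\<close>
  have K_b: "K x b = K a b" if x: "b - 2 * pi < x" "x < b" for x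
  proof -
    have "(\<lambda>n. K ((f ^^ n) x) b) \<longlonglongrightarrow> K a b"
      by (rule isCont_tendsto_compose[OF K_continuous1[OF cis_neq[OF ab]] lim[OF x]])
    moreover have "K ((f ^^ n) x) b = K x b" for n
      using K_invariant[OF fn, of x b n] cis_neq[of x b] x fn_fix(2) by simp
    ultimately show ?thesis using LIMSEQ_const_iff[of "K x b" "K a b"] by simp
  qed
  have K_orbit: "K x (g b) = K a b" if gx: "g \<in> H" "x < g b" "g b < x + 2 * pi" for x g
  proof -
    obtain i where i: "i \<in> H" "\<And>x. i (g x) = x" "\<And>x. g (i x) = x" using H_inv[OF gx(1)] by metis
    have ix: "i x < b" "b - 2 * pi < i x"
      using H_less[OF i(1), of x "g b"] H_less[OF i(1), of "g b" "x + 2 * pi"] H_per[OF i(1), of x] gx i(2)[of b]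
      by simp_all
    have "K (g (i x)) (g b) = K (i x) b" by (rule K_invariant[OF gx(1) cis_neq]) (use ix in auto)
    then show ?thesis using K_b ix i(3) by simp
  qed
  \<comment> \<open>For fixed \<open>s\<close> the equation holds on the orbit of \<open>b\<close>,
    which accumulates inside the turn after \<open>s\<close>.\<close>
  have "K s t = K a b" if st: "s < t" "t < s + 2 * pi" for s t
  proof -
    obtain p where p: "s < p" "p < s + 2 * pi" "p islimpt {t \<in> (\<lambda>g. g b) ` H. s < t \<and> t < s + 2 * pi}"
      by (rule orbit_limit_point[of s b])
    have "K s t - K a b = 0"
    proof (rule real_analytic_identity[of "{s<..<s + 2 * pi}" "\<lambda>t. K s t - K a b" p])
      fix u assume "u \<in> {s<..<s + 2 * pi}"
      then have "cis s \<noteq> cis u" using cis_neq[of s u] by simp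
      from real_analytic_at_diff[OF K_analytic2[OF this] real_analytic_at_const]
      show "real_analytic_at (\<lambda>t. K s t - K a b) u" .
    next
      have "{t \<in> (\<lambda>g. g b) ` H. s < t \<and> t < s + 2 * pi} \<subseteq> {t \<in> {s<..<s + 2 * pi}. K s t - K a b = 0}"
        using K_orbit by auto
      then show "p islimpt {t \<in> {s<..<s + 2 * pi}. K s t - K a b = 0}" by (rule islimpt_subset[OF p(3)])
    qed (use p st in auto)
    then show ?thesis by simp
  qed
  then show thesis using that \<open>complete a\<close> by metis
qed

subsection \<open>The projective structure\<close>

text \<open>
  For fixed \<open>s\<close> this is the Schwarzian derivative of a primitive of \<open>\<Omega> s\<close>; its derivative in \<open>s\<close>
  is \<open>\<Omega>\<close> times the \<open>t\<close>-derivative of the curvature.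
\<close>

definition schwarz :: "real \<Rightarrow> real \<Rightarrow> real" where
  "schwarz s t = D2 (D2 \<Omega>) s t / \<Omega> s t - 3 / 2 * (D2 \<Omega> s t / \<Omega> s t)\<^sup>2"

lemma schwarz_independent:
  assumes K: "\<And>s t. s < t \<Longrightarrow> t < s + 2 * pi \<Longrightarrow> K s t = c"
    and st: "s < t" "t < s + 2 * pi" "s' < t" "t < s' + 2 * pi"
  shows "schwarz s t = schwarz s' t"
proof (rule DERIV_isconst3[of "t - 2 * pi" t s s' "\<lambda>s. schwarz s t"])
  fix s assume "s \<in> {t - 2 * pi<..<t}"
  then have s: "s < t" "t < s + 2 * pi" by auto
  have ra: "real_analytic2_at \<Omega> s y" if "s < y" "y < s + 2 * pi" for y
    by (rule Om_ra[OF cis_neq[OF that]])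
  note ra1 = real_analytic2_at_D1[OF ra[OF s]] and ra2 = real_analytic2_at_D2[OF ra[OF s]]
  note D1_2 = real_analytic2_at_DERIV1[OF ra2]
    and D2_2 = real_analytic2_at_DERIV2[OF ra2]
    and D1_22 = real_analytic2_at_DERIV1[OF real_analytic2_at_D2[OF ra2]]
    and D2_12 = real_analytic2_at_DERIV2[OF real_analytic2_at_D1[OF ra2]]
  have pos: "0 < \<Omega> s y" if "s < y" "y < s + 2 * pi" for y by (rule Om_pos[OF cis_neq[OF that]])
  have rel: "\<Omega> s y * D1 (D2 \<Omega>) s y - D1 \<Omega> s y * D2 \<Omega> s y = c * \<Omega> s y ^ 3"
    if y: "s < y" "y < s + 2 * pi" for y
    using K[OF y] pos[OF y] D1_D2_commute[OF ra[OF y]] unfolding K_def by (simp add: field_simps)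
  let ?A = "D2 (D1 (D2 \<Omega>)) s t"
  \<comment> \<open>Differentiating the curvature equation \<open>rel\<close> in \<open>y\<close>
    yields the third-order term \<open>?A\<close> in terms of lower ones.\<close>
  have "((\<lambda>y. \<Omega> s y * D1 (D2 \<Omega>) s y - D1 \<Omega> s y * D2 \<Omega> s y) has_real_derivative
      (D2 \<Omega> s t * D1 (D2 \<Omega>) s t + ?A * \<Omega> s t)
      - (D2 (D1 \<Omega>) s t * D2 \<Omega> s t + D2 (D2 \<Omega>) s t * D1 \<Omega> s t)) (at t)"
    by (rule DERIV_diff[OF DERIV_mult[OF real_analytic2_at_DERIV2[OF ra[OF s]] D2_12]
          DERIV_mult[OF real_analytic2_at_DERIV2[OF ra1] D2_2]])
  then have "((\<lambda>y. c * \<Omega> s y ^ 3) has_real_derivative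
      (D2 \<Omega> s t * D1 (D2 \<Omega>) s t + ?A * \<Omega> s t)
      - (D2 (D1 \<Omega>) s t * D2 \<Omega> s t + D2 (D2 \<Omega>) s t * D1 \<Omega> s t)) (at t)"
    by (rule has_field_derivative_transform_within_open[of _ _ _ "{s<..<s + 2 * pi}"]) (use s rel in auto)
  moreover have "((\<lambda>y. c * \<Omega> s y ^ 3) has_real_derivative c * (3 * \<Omega> s t ^ 2 * D2 \<Omega> s t)) (at t)"
    by (rule derivative_eq_intros real_analytic2_at_DERIV2[OF ra[OF s]] refl)+ simp
  ultimately have "(D2 \<Omega> s t * D1 (D2 \<Omega>) s t + ?A * \<Omega> s t)
      - (D2 (D1 \<Omega>) s t * D2 \<Omega> s t + D2 (D2 \<Omega>) s t * D1 \<Omega> s t) = c * (3 * \<Omega> s t ^ 2 * D2 \<Omega> s t)"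
    using DERIV_unique by metis
  then have A: "?A * \<Omega> s t - D2 (D2 \<Omega>) s t * D1 \<Omega> s t = 3 * c * \<Omega> s t ^ 2 * D2 \<Omega> s t"
    using D1_D2_commute[OF ra[OF s]] by (simp add: algebra_simps)
  have AA: "D1 (D2 (D2 \<Omega>)) s t = ?A" by (rule D1_D2_commute[OF ra2])
  have "((\<lambda>s. schwarz s t) has_real_derivative
      (?A * \<Omega> s t - D2 (D2 \<Omega>) s t * D1 \<Omega> s t) / (\<Omega> s t * \<Omega> s t)
      - 3 / 2 * (2 * (D2 \<Omega> s t / \<Omega> s t) * ((D1 (D2 \<Omega>) s t * \<Omega> s t - D2 \<Omega> s t * D1 \<Omega> s t) / (\<Omega> s t * \<Omega> s t)))) (at s)"
    unfolding schwarz_def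
    using pos[OF s]
    by (auto intro!: derivative_eq_intros D1_22[unfolded AA] D1_2 real_analytic2_at_DERIV1[OF ra[OF s]])
  moreover have "(?A * \<Omega> s t - D2 (D2 \<Omega>) s t * D1 \<Omega> s t) / (\<Omega> s t * \<Omega> s t)
      - 3 / 2 * (2 * (D2 \<Omega> s t / \<Omega> s t) * ((D1 (D2 \<Omega>) s t * \<Omega> s t - D2 \<Omega> s t * D1 \<Omega> s t) / (\<Omega> s t * \<Omega> s t))) = 0"
  proof -
    have "D1 (D2 \<Omega>) s t * \<Omega> s t - D2 \<Omega> s t * D1 \<Omega> s t = c * \<Omega> s t ^ 3"
      using rel[OF s] by (simp add: algebra_simps)
    then show ?thesis unfolding A using pos[OF s] by (simp add: field_simps power2_eq_square power3_eq_cube)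
  qed
  ultimately show "((\<lambda>s. schwarz s t) has_real_derivative 0) (at s)" by simp
qed (use st in auto)

definition log_deriv :: "real \<Rightarrow> real \<Rightarrow> real" where
  "log_deriv s t = D2 \<Omega> s t / \<Omega> s t"

text \<open>
  The functions \<open>\<Omega> x t powr (- 1 / 2)\<close> solve one and the same Hill equation in \<open>t\<close>. Below, \<open>w\<close> is the
  Wronskian of two of them and \<open>R\<close> is their quotient, whose derivative is \<open>- w * \<Omega> b t\<close>.
\<close>

lemma charts_moebius_related:
  assumes K: "\<And>s t. s < t \<Longrightarrow> t < s + 2 * pi \<Longrightarrow> K s t = c"
    and V: "chart a V" and W: "chart b W"
    and J: "u < v" "a \<le> u" "v \<le> a + 2 * pi" "b \<le> u" "v \<le> b + 2 * pi"
  obtains w C D where "\<And>t. u < t \<Longrightarrow> t < v \<Longrightarrow> 0 < C - w * W t"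
    "\<And>t. u < t \<Longrightarrow> t < v \<Longrightarrow> V t = (if w = 0 then W t / C\<^sup>2 else 1 / (w * (C - w * W t))) + D"
proof -
  have const: "F x = F y" if "\<And>t. u < t \<Longrightarrow> t < v \<Longrightarrow> (F has_real_derivative 0) (at t)"
    "u < x" "x < v" "u < y" "y < v" for F :: "real \<Rightarrow> real" and x y
    using DERIV_isconst3[of u v x y F] that J(1) by simp
  have const': "\<exists>k. \<forall>t. u < t \<longrightarrow> t < v \<longrightarrow> F t = k"
    if "\<And>t. u < t \<Longrightarrow> t < v \<Longrightarrow> (F has_real_derivative 0) (at t)" for F :: "real \<Rightarrow> real"
    by (intro exI[of _ "F ((u + v) / 2)"] allI impI const[OF that]) (use J(1) in auto)
  have ran: "a < t" "t < a + 2 * pi" "b < t" "t < b + 2 * pi" if "u < t" "t < v" for t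
    using that J by simp_all
  define A where "A = \<Omega> a"
  define B where "B = \<Omega> b"
  define la where "la = log_deriv a"
  define lb where "lb = log_deriv b"
  have pos: "0 < A t" "0 < B t" if "u < t" "t < v" for t
    unfolding A_def B_def using Om_pos cis_neq ran[OF that] by simp_all
  have deriv: "(\<Omega> x has_real_derivative \<Omega> x t * log_deriv x t) (at t)"
    "(log_deriv x has_real_derivative schwarz x t + (log_deriv x t)\<^sup>2 / 2) (at t)"
    if "x < t" "t < x + 2 * pi" for x t
  proof -
    note ra = Om_ra[OF cis_neq[OF that]]
    have 0: "\<Omega> x t \<noteq> 0" using Om_pos[OF cis_neq[OF that]] by simp
    show "(\<Omega> x has_real_derivative \<Omega> x t * log_deriv x t) (at t)"
      using real_analytic2_at_DERIV2[OF ra] 0 by (simp add: log_deriv_def)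
    have "(log_deriv x has_real_derivative
        (D2 (D2 \<Omega>) x t * \<Omega> x t - D2 \<Omega> x t * D2 \<Omega> x t) / (\<Omega> x t * \<Omega> x t)) (at t)"
      unfolding log_deriv_def[abs_def]
      by (rule DERIV_divide[OF real_analytic2_at_DERIV2[OF real_analytic2_at_D2[OF ra]]
            real_analytic2_at_DERIV2[OF ra] 0])
    moreover have "(D2 (D2 \<Omega>) x t * \<Omega> x t - D2 \<Omega> x t * D2 \<Omega> x t) / (\<Omega> x t * \<Omega> x t)
        = schwarz x t + (log_deriv x t)\<^sup>2 / 2"
      using 0 by (simp add: schwarz_def log_deriv_def field_simps power2_eq_square)
    ultimately show "(log_deriv x has_real_derivative schwarz x t + (log_deriv x t)\<^sup>2 / 2) (at t)"
      by simp
  qed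
  have AD: "(A has_real_derivative A t * la t) (at t)" and BD: "(B has_real_derivative B t * lb t) (at t)"
    if "u < t" "t < v" for t
    unfolding A_def B_def la_def lb_def using deriv(1) ran[OF that] by simp_all
  \<comment> \<open>Both logarithmic derivatives solve Riccati equations with the same
    inhomogeneity, so their difference involves only the squares. Hence \<open>la - lb\<close>
    satisfies the same linear equation as \<open>S\<close>, with coefficient
    \<open>(la + lb) / 2\<close>, and their quotient is constant.\<close>
  have lD: "((\<lambda>t. la t - lb t) has_real_derivative ((la t)\<^sup>2 - (lb t)\<^sup>2) / 2) (at t)" if "u < t" "t < v" for t
    using DERIV_diff[OF deriv(2)[OF ran(1,2)[OF that]] deriv(2)[OF ran(3,4)[OF that]]]
      schwarz_independent[OF K ran(1,2)[OF that] ran(3,4)[OF that]]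
    by (simp add: la_def lb_def diff_divide_distrib)
  define S where "S t = sqrt (A t * B t)" for t
  have S_pos: "0 < S t" if "u < t" "t < v" for t using pos[OF that] by (simp add: S_def)
  have SD: "(S has_real_derivative S t * (la t + lb t) / 2) (at t)" if "u < t" "t < v" for t
  proof -
    have "0 < A t * B t" using pos[OF that] by simp
    from DERIV_chain2[OF DERIV_real_sqrt[OF this] DERIV_mult[OF AD[OF that] BD[OF that]]]
    have "(S has_real_derivative inverse (S t) / 2 * (A t * la t * B t + B t * lb t * A t)) (at t)"
      by (simp add: S_def[abs_def])
    moreover have "inverse (S t) / 2 * (A t * la t * B t + B t * lb t * A t) = S t * (la t + lb t) / 2"
    proof -
      have "A t * la t * B t + B t * lb t * A t = S t * S t * (la t + lb t)"
        using pos[OF that] by (simp add: S_def algebra_simps)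
      then show ?thesis using S_pos[OF that] by simp
    qed
    ultimately show ?thesis by (simp only:)
  qed
  obtain w where w: "\<And>t. u < t \<Longrightarrow> t < v \<Longrightarrow> (la t - lb t) / S t = 2 * w"
  proof -
    have "((\<lambda>t. (la t - lb t) / S t) has_real_derivative 0) (at t)" if "u < t" "t < v" for t
    proof -
      have "((la t)\<^sup>2 - (lb t)\<^sup>2) / 2 * S t - (la t - lb t) * (S t * (la t + lb t) / 2) = 0"
        by (simp add: algebra_simps power2_eq_square)
      then show ?thesis
        using DERIV_divide[OF lD[OF that] SD[OF that]] S_pos[OF that] by simp
    qed
    from const'[OF this] obtain k where "\<forall>t. u < t \<longrightarrow> t < v \<longrightarrow> (la t - lb t) / S t = k" by metis
    then show thesis using that[of "k / 2"] by simp
  qed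
  define R where "R t = S t / A t" for t
  have R_pos: "0 < R t" if "u < t" "t < v" for t using pos[OF that] S_pos[OF that] by (simp add: R_def)
  have R_sq: "R t ^ 2 * A t = B t" if "u < t" "t < v" for t
    using pos[OF that] by (simp add: R_def S_def power_divide) (simp add: power2_eq_square)
  have RD: "(R has_real_derivative - w * B t) (at t)" if "u < t" "t < v" for t
  proof -
    have "A t \<noteq> 0" using pos[OF that] by simp
    from DERIV_divide[OF SD[OF that] AD[OF that] this]
    have "(R has_real_derivative (S t * (la t + lb t) / 2 * A t - S t * (A t * la t)) / (A t * A t)) (at t)"
      by (simp add: R_def[abs_def])
    moreover have "(S t * (la t + lb t) / 2 * A t - S t * (A t * la t)) / (A t * A t) = - w * B t"
    proof -
      have "la t = lb t + 2 * w * S t" using w[OF that] S_pos[OF that] by (simp add: field_simps)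
      then have "(S t * (la t + lb t) / 2 * A t - S t * (A t * la t)) / (A t * A t) = - w * (S t * S t) / A t"
        using \<open>A t \<noteq> 0\<close> by (simp add: field_simps)
      also have "S t * S t = A t * B t" using pos[OF that] by (simp add: S_def)
      finally show ?thesis using \<open>A t \<noteq> 0\<close> by simp
    qed
    ultimately show ?thesis by simp
  qed
  have VD: "(V has_real_derivative A t) (at t)" and WD: "(W has_real_derivative B t) (at t)"
    if "u < t" "t < v" for t
    unfolding A_def B_def using chartD[OF V] chartD[OF W] ran[OF that] by simp_all
  obtain C where C: "\<And>t. u < t \<Longrightarrow> t < v \<Longrightarrow> R t + w * W t = C"
  proof -
    have "((\<lambda>t. R t + w * W t) has_real_derivative 0) (at t)" if "u < t" "t < v" for t
      using DERIV_add[OF RD[OF that] DERIV_cmult[OF WD[OF that], of w]] by simp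
    from const'[OF this] show thesis using that by metis
  qed
  have RC: "C - w * W t = R t" if "u < t" "t < v" for t using C[OF that] by simp
  show thesis
  proof (cases "w = 0")
    case True
    have RC: "R t = C" if "u < t" "t < v" for t using RC[OF that] True by simp
    have "((\<lambda>t. V t - W t / C\<^sup>2) has_real_derivative 0) (at t)" if "u < t" "t < v" for t
      using DERIV_diff[OF VD[OF that] DERIV_cdivide[OF WD[OF that], of "C\<^sup>2"]] R_sq[OF that] R_pos[OF that]
      by (simp add: RC[OF that] field_simps)
    from const'[OF this] obtain D where "\<forall>t. u < t \<longrightarrow> t < v \<longrightarrow> V t - W t / C\<^sup>2 = D" by metis
    then have "V t = W t / C\<^sup>2 + D" if "u < t" "t < v" for t using that by (simp add: field_simps)
    then show thesis using that[of C w D] R_pos True RC by simp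
  next
    case False
    \<comment> \<open>Since \<open>R\<close> has derivative \<open>- w * B\<close> and
      \<open>R ^ 2 * A = B\<close>, the derivative of \<open>1 / (w * R)\<close> is
      \<open>A\<close>.\<close>
    have "((\<lambda>t. V t - 1 / (w * R t)) has_real_derivative 0) (at t)" if "u < t" "t < v" for t
    proof -
      have nz: "w * R t \<noteq> 0" using False R_pos[OF that] by simp
      have "((\<lambda>t. V t - 1 / (w * R t)) has_real_derivative A t - (0 * (w * R t) - 1 * (w * (- w * B t))) / (w * R t * (w * R t))) (at t)"
        by (rule DERIV_diff[OF VD[OF that] DERIV_divide[OF DERIV_const DERIV_cmult[OF RD[OF that]] nz]])
      then show ?thesis using nz R_sq[OF that, symmetric] by (simp add: power2_eq_square)
    qed
    from const'[OF this] obtain D where "\<forall>t. u < t \<longrightarrow> t < v \<longrightarrow> V t - 1 / (w * R t) = D" by metis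
    then have "V t = 1 / (w * R t) + D" if "u < t" "t < v" for t using that by (simp add: field_simps)
    then show thesis using that[of C w D] R_pos RC False by simp
  qed
qed

end

section \<open>Complete charts and trivial monodromy\<close>

lemma quadratic_identity:
  fixes A B C :: real
  assumes "\<And>i. i \<in> {0, 1, 2} \<Longrightarrow> A * (X + e * i)\<^sup>2 + B * (X + e * i) + C = 0" and e: "e \<noteq> 0"
  shows "A * Y\<^sup>2 + B * Y + C = 0"
proof -
  have 0: "A * X\<^sup>2 + B * X + C = 0" and 1: "A * (X + e)\<^sup>2 + B * (X + e) + C = 0"
    and 2: "A * (X + e * 2)\<^sup>2 + B * (X + e * 2) + C = 0"
    using assms(1)[of 0] assms(1)[of 1] assms(1)[of 2] by simp_all
  \<comment> \<open>The second difference over three equally spaced points isolates the leading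
    coefficient.\<close>
  have "2 * A * e\<^sup>2 = (A * (X + e * 2)\<^sup>2 + B * (X + e * 2) + C) - 2 * (A * (X + e)\<^sup>2 + B * (X + e) + C)
      + (A * X\<^sup>2 + B * X + C)" by (simp add: power2_eq_square algebra_simps)
  then have A: "A = 0" using e unfolding 0 1 2 by simp
  have "B * X + C = 0" "B * X + B * e + C = 0" using 0 1 A by (simp_all add: distrib_left)
  then have "B * e = 0" by linarith
  then have "B = 0" using e by simp
  then show ?thesis using A 0 by simp
qed

text \<open>Three samples make the identity hold for all arguments; at \<open>\<beta>\<close>, which
  is not among the samples in the application, it reduces to
  \<open>l * (M * (\<beta> - \<alpha>) - k) = 0\<close>. The resulting \<open>k\<close> depends on
  \<open>M\<close>, \<open>\<alpha>\<close> and \<open>\<beta>\<close> alone, hence can be compared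
  between two arcs.\<close>

lemma moebius_coefficients:
  fixes N M j l k \<alpha> \<beta> :: real
  assumes "\<And>i. i \<in> {0, 1, 2} \<Longrightarrow> (N * (X + e * i - \<beta>) - l) * (M * (X + e * i - \<alpha>) - k)
      = - j * (X + e * i - \<alpha>) * (X + e * i - \<beta>)"
    and e: "e \<noteq> 0" and l: "l \<noteq> 0"
  shows "k = M * (\<beta> - \<alpha>)"
proof -
  let ?A = "N * M + j" and ?B = "- N * (M * \<alpha> + k) - M * (N * \<beta> + l) - j * (\<alpha> + \<beta>)"
    and ?C = "(N * \<beta> + l) * (M * \<alpha> + k) + j * \<alpha> * \<beta>"
  have eq: "?A * Y\<^sup>2 + ?B * Y + ?C = (N * (Y - \<beta>) - l) * (M * (Y - \<alpha>) - k) + j * (Y - \<alpha>) * (Y - \<beta>)" for Y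
    by (simp add: power2_eq_square algebra_simps)
  have "?A * \<beta>\<^sup>2 + ?B * \<beta> + ?C = 0"
  proof (rule quadratic_identity[OF _ e, of _ X])
    fix i :: real assume "i \<in> {0, 1, 2}"
    from assms(1)[OF this] show "?A * (X + e * i)\<^sup>2 + ?B * (X + e * i) + ?C = 0" unfolding eq by simp
  qed
  then show ?thesis unfolding eq using l by simp
qed

context circle_action begin

definition onto :: "real \<Rightarrow> (real \<Rightarrow> real) \<Rightarrow> bool" where
  "onto x V \<longleftrightarrow> (\<forall>y. \<exists>t. x < t \<and> t < x + 2 * pi \<and> V t = y)"

lemma onto_at_top:
  assumes "chart x V" "onto x V"
  shows "filterlim V at_top (at_left (x + 2 * pi))"
  unfolding filterlim_at_top
proof
  fix Z
  obtain t where t: "x < t" "t < x + 2 * pi" "V t = Z" using assms(2) unfolding onto_def by metis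
  have "\<forall>\<^sub>F s in at_left (x + 2 * pi). t < s" using t(2) by (rule eventually_at_left_real[THEN eventually_mono]) simp
  moreover have "\<forall>\<^sub>F s in at_left (x + 2 * pi). s < x + 2 * pi" by (simp add: eventually_at_filter)
  ultimately show "\<forall>\<^sub>F s in at_left (x + 2 * pi). Z \<le> V s"
    by eventually_elim (use chart_less[OF assms(1) t(1)] t(3) in force)
qed

lemma onto_at_bot:
  assumes "chart x V" "onto x V"
  shows "filterlim V at_bot (at_right x)"
  unfolding filterlim_at_bot
proof
  fix Z
  obtain t where t: "x < t" "t < x + 2 * pi" "V t = Z" using assms(2) unfolding onto_def by metis
  have "\<forall>\<^sub>F s in at_right x. s < t" using t(1) by (rule eventually_at_right_real[THEN eventually_mono]) simp
  moreover have "\<forall>\<^sub>F s in at_right x. x < s" by (simp add: eventually_at_filter)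
  ultimately show "\<forall>\<^sub>F s in at_right x. V s \<le> Z"
    by eventually_elim (use chart_less[OF assms(1) _ _ t(2)] t(3) in force)
qed

text \<open>On the arc \<open>V\<close> is a Moebius function of \<open>W\<close>. It tends to minus
  infinity at \<open>a\<close>, where \<open>W\<close> is finite, so the function is not affine and
  its pole is \<open>W a\<close>; as \<open>W\<close> tends to infinity at
  \<open>b + 2 * pi\<close>, the value of \<open>V\<close> there is \<open>D\<close>. Thus
  \<open>k\<close> is \<open>1 / w\<^sup>2\<close>.\<close>

lemma arc_relation:
  assumes K: "\<And>s t. s < t \<Longrightarrow> t < s + 2 * pi \<Longrightarrow> K s t = c"
    and V: "chart a V" "onto a V" and W: "chart b W" "onto b W" and ab: "b < a" "a < b + 2 * pi"
  obtains k where "0 < k" "\<And>t. a < t \<Longrightarrow> t < b + 2 * pi \<Longrightarrow> (V t - V (b + 2 * pi)) * (W t - W a) = - k"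
proof -
  let ?v = "b + 2 * pi"
  obtain w C D where pos: "\<And>t. a < t \<Longrightarrow> t < ?v \<Longrightarrow> 0 < C - w * W t"
    and rel: "\<And>t. a < t \<Longrightarrow> t < ?v \<Longrightarrow> V t = (if w = 0 then W t / C\<^sup>2 else 1 / (w * (C - w * W t))) + D"
    using charts_moebius_related[OF K V(1) W(1), of a ?v] ab by (metis add_le_cancel_right less_imp_le order_refl)
  have ev_r: "\<forall>\<^sub>F t in at_right a. a < t \<and> t < ?v" using eventually_at_right_real[OF ab(2)] by simp
  have ev_l: "\<forall>\<^sub>F t in at_left ?v. a < t \<and> t < ?v" using eventually_at_left_real[OF ab(2)] by simp
  have contW: "(W \<longlongrightarrow> W a) (at_right a)"
    using DERIV_isCont[OF chartD[OF W(1) ab]] by (meson continuous_at_imp_continuous_at_within continuous_within)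
  have "a < ?v" "?v < a + 2 * pi" using ab by simp_all
  from DERIV_isCont[OF chartD[OF V(1) this]]
  have contV: "(V \<longlongrightarrow> V ?v) (at_left ?v)"
    by (meson continuous_at_imp_continuous_at_within continuous_within)
  have not_conv: False if "(V \<longlongrightarrow> y) (at_right a)" for y
    using not_tendsto_and_filterlim_at_infinity[OF _ that
        filterlim_mono[OF onto_at_bot[OF V] at_bot_le_at_infinity order_refl]] by simp
  have w0: "w \<noteq> 0"
  proof
    assume w: "w = 0"
    have "((\<lambda>t. W t / C\<^sup>2 + D) \<longlongrightarrow> W a / C\<^sup>2 + D) (at_right a)"
      unfolding divide_inverse by (intro tendsto_intros contW)
    moreover have "\<forall>\<^sub>F t in at_right a. W t / C\<^sup>2 + D = V t"
      using ev_r by eventually_elim (simp add: rel w)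
    ultimately have "(V \<longlongrightarrow> W a / C\<^sup>2 + D) (at_right a)" by (rule Lim_transform_eventually)
    then show False by (rule not_conv)
  qed
  have C: "C - w * W a = 0"
  proof (rule ccontr)
    assume nz: "C - w * W a \<noteq> 0"
    have "((\<lambda>t. 1 / (w * (C - w * W t)) + D) \<longlongrightarrow> 1 / (w * (C - w * W a)) + D) (at_right a)"
      by (intro tendsto_intros contW) (use nz w0 in simp)
    moreover have "\<forall>\<^sub>F t in at_right a. 1 / (w * (C - w * W t)) + D = V t"
      using ev_r by eventually_elim (simp add: rel w0)
    ultimately have "(V \<longlongrightarrow> 1 / (w * (C - w * W a)) + D) (at_right a)" by (rule Lim_transform_eventually)
    then show False by (rule not_conv)
  qed
  have D: "V ?v = D"
  proof -
    have "filterlim W at_infinity (at_left ?v)"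
      using onto_at_top[OF W] filterlim_at_top_imp_at_infinity by metis
    then have "((\<lambda>t. inverse (W t - W a)) \<longlongrightarrow> 0) (at_left ?v)"
      by (intro filterlim_compose[OF tendsto_inverse_0] )
         (use tendsto_add_filterlim_at_infinity'[of W "at_left ?v" "\<lambda>_. - W a" "- W a"] in simp)
    then have "((\<lambda>t. - (1 / w\<^sup>2) * inverse (W t - W a) + D) \<longlongrightarrow> - (1 / w\<^sup>2) * 0 + D) (at_left ?v)"
      by (intro tendsto_intros)
    moreover have "\<forall>\<^sub>F t in at_left ?v. - (1 / w\<^sup>2) * inverse (W t - W a) + D = V t"
      using ev_l
    proof eventually_elim
      case (elim t)
      have "W a < W t" using chart_less[OF W(1) ab(1)] elim by simp
      moreover have "C = w * W a" using C by simp
      ultimately show ?case using elim rel[of t] w0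
        by (simp add: field_simps power2_eq_square)
    qed
    ultimately have "(V \<longlongrightarrow> D) (at_left ?v)" using Lim_transform_eventually by force
    then show ?thesis using tendsto_unique[OF _ contV] by (metis trivial_limit_at_left_real)
  qed
  show thesis
  proof (rule that[of "1 / w\<^sup>2"])
    show "0 < 1 / w\<^sup>2" using w0 by simp
    fix t assume t: "a < t" "t < ?v"
    have "W a < W t" using chart_less[OF W(1) ab(1)] t by simp
    moreover have "C = w * W a" using C by simp
    ultimately show "(V t - V ?v) * (W t - W a) = - (1 / w\<^sup>2)" using t rel[OF t] w0
      unfolding D by (simp add: field_simps power2_eq_square)
  qed
qed

lemma chart_translate:
  assumes "chart x V" shows "chart (x + 2 * pi) (\<lambda>t. V (t - 2 * pi))"
  unfolding chart_def
proof (intro allI impI)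
  fix t assume "x + 2 * pi < t" "t < x + 2 * pi + 2 * pi"
  then have "(V has_real_derivative \<Omega> x (t - 2 * pi)) (at (t - 2 * pi))"
    by (intro chartD[OF assms]) auto
  moreover have "\<Omega> x (t - 2 * pi) = \<Omega> (x + 2 * pi) t"
    using Om_per2[of x "t - 2 * pi"] Om_per1[of x t] by simp
  ultimately show "((\<lambda>t. V (t - 2 * pi)) has_real_derivative \<Omega> (x + 2 * pi) t) (at t)"
    using DERIV_shift[of V "\<Omega> (x + 2 * pi) t" t "- 2 * pi"] by simp
qed

lemma onto_translate: "onto x V \<Longrightarrow> onto (x + 2 * pi) (\<lambda>t. V (t - 2 * pi))"
  unfolding onto_def
proof
  fix y assume "\<forall>y. \<exists>t>x. t < x + 2 * pi \<and> V t = y"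
  then obtain t where "x < t" "t < x + 2 * pi" "V t = y" by metis
  then show "\<exists>t>x + 2 * pi. t < x + 2 * pi + 2 * pi \<and> V (t - 2 * pi) = y"
    by (intro exI[of _ "t + 2 * pi"]) simp
qed

text \<open>
  The chart at \<open>a\<close> is a multiple of the inverse of the chart at \<open>c\<close> on each of the two arcs between
  \<open>a\<close> and \<open>c\<close>. A priori the two multiples differ (the monodromy around \<open>c\<close>); the third chart, at \<open>b\<close>,
  shows that they agree.
\<close>

lemma chart_complement:
  assumes K: "\<And>s t. s < t \<Longrightarrow> t < s + 2 * pi \<Longrightarrow> K s t = d"
    and Vc: "chart c Vc" "onto c Vc" and Va: "chart a Va" "onto a Va" and Vb: "chart b Vb" "onto b Vb"
    and cab: "c < a" "a < b" "b < c + 2 * pi"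
  obtains k where "0 < k"
    "\<And>t. a < t \<Longrightarrow> t < c + 2 * pi \<Longrightarrow> (Va t - Va (c + 2 * pi)) * (Vc t - Vc a) = - k"
    "\<And>t. c + 2 * pi < t \<Longrightarrow> t < a + 2 * pi \<Longrightarrow> (Va t - Va (c + 2 * pi)) * (Vc (t - 2 * pi) - Vc a) = - k"
proof -
  define \<alpha> where "\<alpha> = Vc a"
  define \<beta> where "\<beta> = Vc b"
  define m where "m = Va (c + 2 * pi)"
  define n where "n = Vb (c + 2 * pi)"
  define p where "p = Va b"
  define q where "q = Vb (a + 2 * pi)"
  have \<alpha>\<beta>: "\<alpha> < \<beta>" unfolding \<alpha>_def \<beta>_def using chart_less[OF Vc(1) cab] .
  note Vc' = chart_translate[OF Vc(1)] onto_translate[OF Vc(2)]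
  obtain k2 where k2: "0 < k2" "\<And>t. a < t \<Longrightarrow> t < c + 2 * pi \<Longrightarrow> (Va t - m) * (Vc t - \<alpha>) = - k2"
    unfolding m_def \<alpha>_def by (rule arc_relation[OF K Va Vc]) (use cab in auto)
  obtain k1 where "0 < k1" and k1': "\<And>t. c + 2 * pi < t \<Longrightarrow> t < a + 2 * pi \<Longrightarrow>
      (Vc (t - 2 * pi) - Vc (a + 2 * pi - 2 * pi)) * (Va t - Va (c + 2 * pi)) = - k1"
    by (rule arc_relation[OF K Vc' Va]) (use cab in auto)
  then have k1: "0 < k1"
    "\<And>t. c + 2 * pi < t \<Longrightarrow> t < a + 2 * pi \<Longrightarrow> (Vc (t - 2 * pi) - \<alpha>) * (Va t - m) = - k1"
    by (simp_all add: m_def \<alpha>_def)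
  obtain l2 where l2: "0 < l2" "\<And>t. b < t \<Longrightarrow> t < c + 2 * pi \<Longrightarrow> (Vb t - n) * (Vc t - \<beta>) = - l2"
    unfolding n_def \<beta>_def by (rule arc_relation[OF K Vb Vc]) (use cab in auto)
  obtain l1 where "0 < l1" and l1': "\<And>t. c + 2 * pi < t \<Longrightarrow> t < b + 2 * pi \<Longrightarrow>
      (Vc (t - 2 * pi) - Vc (b + 2 * pi - 2 * pi)) * (Vb t - Vb (c + 2 * pi)) = - l1"
    by (rule arc_relation[OF K Vc' Vb]) (use cab in auto)
  then have l1: "0 < l1"
    "\<And>t. c + 2 * pi < t \<Longrightarrow> t < b + 2 * pi \<Longrightarrow> (Vc (t - 2 * pi) - \<beta>) * (Vb t - n) = - l1"
    by (simp_all add: n_def \<beta>_def)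
  \<comment> \<open>The arc from \<open>b\<close> to \<open>a + 2 * pi\<close> passes over
    \<open>c + 2 * pi\<close>, so one relation with the same \<open>p\<close>, \<open>q\<close> and
    \<open>j\<close> holds on both sides of it; this is what ties \<open>k1\<close> to
    \<open>k2\<close>.\<close>
  obtain j where j: "\<And>t. b < t \<Longrightarrow> t < a + 2 * pi \<Longrightarrow> (Vb t - q) * (Va t - p) = - j"
    unfolding p_def q_def by (rule arc_relation[OF K Vb Va]) (use cab in auto)
  \<comment> \<open>Eliminating the values \<open>x\<close> and \<open>y\<close> of the charts at
    \<open>a\<close> and \<open>b\<close> leaves an identity in the value \<open>X\<close> of the
    chart at \<open>c\<close>.\<close>
  have combine: "((n - q) * (X - \<beta>) - l) * ((m - p) * (X - \<alpha>) - k) = - j * (X - \<alpha>) * (X - \<beta>)"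
    if "(y - n) * (X - \<beta>) = - l" "(x - m) * (X - \<alpha>) = - k" "(y - q) * (x - p) = - j" for x y X k l
  proof -
    have "(n - q) * (X - \<beta>) - l = (y - q) * (X - \<beta>)" using that(1) by (simp add: algebra_simps)
    moreover have "(m - p) * (X - \<alpha>) - k = (x - p) * (X - \<alpha>)" using that(2) by (simp add: algebra_simps)
    ultimately have "((n - q) * (X - \<beta>) - l) * ((m - p) * (X - \<alpha>) - k)
        = ((y - q) * (x - p)) * (X - \<alpha>) * (X - \<beta>)" by simp
    then show ?thesis unfolding that(3) .
  qed
  have "k2 = (m - p) * (\<beta> - \<alpha>)"
  proof (rule moebius_coefficients)
    fix i :: real assume i: "i \<in> {0, 1, 2}"
    \<comment> \<open>Values above \<open>\<beta>\<close> belong to points between \<open>b\<close>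
      and \<open>c + 2 * pi\<close>; completeness at \<open>c\<close> provides them.\<close>
    let ?X = "\<beta> + 1 + 1 * i"
    obtain t where t: "c < t" "t < c + 2 * pi" "Vc t = ?X" using Vc(2) unfolding onto_def by metis
    have "b < t" using chart_less_iff[OF Vc(1) _ _ t(1,2), of b] cab t(3) i by (auto simp: \<beta>_def)
    then show "((n - q) * (?X - \<beta>) - l2) * ((m - p) * (?X - \<alpha>) - k2) = - j * (?X - \<alpha>) * (?X - \<beta>)"
      using combine[of "Vb t" "Vc t" l2 "Va t" k2] l2(2)[of t] k2(2)[of t] j[of t] t cab by simp
  qed (use l2 in auto)
  moreover have "k1 = (m - p) * (\<beta> - \<alpha>)"
  proof (rule moebius_coefficients)
    fix i :: real assume i: "i \<in> {0, 1, 2}"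
    \<comment> \<open>Values below \<open>\<alpha>\<close> belong to points between \<open>c\<close>
      and \<open>a\<close>; the other two charts see them one turn later.\<close>
    let ?X = "\<alpha> - 1 + - 1 * i"
    obtain t where t: "c < t" "t < c + 2 * pi" "Vc t = ?X" using Vc(2) unfolding onto_def by metis
    have "t < a" using chart_less_iff[OF Vc(1) t(1,2), of a] cab t(3) i by (auto simp: \<alpha>_def)
    then show "((n - q) * (?X - \<beta>) - l1) * ((m - p) * (?X - \<alpha>) - k1) = - j * (?X - \<alpha>) * (?X - \<beta>)"
      using combine[of "Vb (t + 2 * pi)" "Vc t" l1 "Va (t + 2 * pi)" k1] l1(2)[of "t + 2 * pi"]
        k1(2)[of "t + 2 * pi"] j[of "t + 2 * pi"] t cab by (simp add: mult.commute)
  qed (use l1 in auto)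
  ultimately have "k1 = k2" by simp
  show thesis
    by (rule that[OF k2(1)]) (use k1(2) k2(2) \<open>k1 = k2\<close> in \<open>simp_all add: m_def \<alpha>_def mult.commute\<close>)
qed

lemma complete_orbit:
  assumes "complete a" "f \<in> H"
  shows "complete (f a)"
proof -
  obtain V where V: "chart a V" "\<And>y. \<exists>t. a < t \<and> t < a + 2 * pi \<and> V t = y"
    using assms(1) unfolding complete_def by metis
  obtain i where i: "i \<in> H" "\<And>x. i (f x) = x" "\<And>x. f (i x) = x" using H_inv[OF assms(2)] by metis
  show ?thesis
    unfolding complete_def
  proof (intro exI[of _ "\<lambda>t. V (i t) / deriv f a"] conjI allI)
    show "chart (f a) (\<lambda>t. V (i t) / deriv f a)" by (rule chart_transport[OF V(1) assms(2) i])
    fix y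
    obtain t where t: "a < t" "t < a + 2 * pi" "V t = y * deriv f a" using V(2) by metis
    show "\<exists>t. f a < t \<and> t < f a + 2 * pi \<and> V (i t) / deriv f a = y"
      by (rule exI[of _ "f t"])
        (use t H_pos[OF assms(2), of a] assms(2) H_per[OF assms(2), of a, symmetric] in \<open>simp add: i\<close>)
  qed
qed

lemma three_complete_points:
  assumes "complete x"
  obtains c a b where "complete c" "complete a" "complete b" "c < a" "a < b" "b < c + 2 * pi"
proof -
  have orbit: "\<exists>t. complete t \<and> x < t \<and> t < x + 2 * pi \<and> t \<noteq> y" for y
  proof -
    have "\<not> (\<lambda>f. cis (f x)) ` H \<subseteq> {cis x, cis y}" using H_orbit finite_subset by blast
    then obtain f where f: "f \<in> H" "cis x \<noteq> cis (f x)" "cis (f x) \<noteq> cis y" by force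
    obtain k :: int where k: "x < f x + 2 * pi * of_int k" "f x + 2 * pi * of_int k < x + 2 * pi"
      using representative_strict[OF f(2)] by metis
    have "complete (f x + 2 * pi * of_int k)"
      using complete_orbit[OF assms H_comp[OF H_shift_int f(1)]] .
    moreover have "f x + 2 * pi * of_int k \<noteq> y"
      using f(3) unfolding cis_eq_iff by (metis add_diff_cancel_right' diff_conv_add_uminus mult_minus_right of_int_minus)
    ultimately show ?thesis using k by metis
  qed
  obtain a where a: "complete a" "x < a" "a < x + 2 * pi" using orbit by metis
  obtain b where b: "complete b" "x < b" "b < x + 2 * pi" "b \<noteq> a" using orbit by metis
  show thesis
  proof (cases "a < b")
    case True then show thesis using that[OF assms a(1) b(1)] a b by simp
  next
    case False then show thesis using that[OF assms b(1) a(1)] a b by simp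
  qed
qed

section \<open>The global angular coordinate\<close>

lemma chart_real_analytic:
  assumes V: "chart x V" and t: "x < t" "t < x + 2 * pi"
  shows "real_analytic_at V t"
proof (rule real_analytic_at_primitive)
  show "\<forall>\<^sub>F s in nhds t. (V has_real_derivative \<Omega> x s) (at s)"
    unfolding eventually_nhds
    by (rule exI[of _ "{x<..<x + 2 * pi}"]) (use t chartD[OF V] in auto)
  show "real_analytic_at (\<Omega> x) t"
    by (rule real_analytic2_at_slice2[OF Om_ra[OF cis_neq[OF t]]])
qed

text \<open>The chart transported by \<open>g\<close> and \<open>V\<close> itself are Moebius
  related on the arc from \<open>g c\<close> to \<open>c + 2 * pi\<close>, and \<open>V\<close> is
  the tangent of half of \<open>\<Phi>\<close>. Multiplied out, the relation has no denominators and
  continues analytically to the whole line, past the points where the tangent is infinite. The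
  bounds on \<open>g c\<close> make the arc a non-empty part of the domain of
  \<open>V\<close>.\<close>

lemma projective_bilinear:
  fixes \<Phi> :: "real \<Rightarrow> real"
  assumes K: "\<And>s t. s < t \<Longrightarrow> t < s + 2 * pi \<Longrightarrow> K s t = d"
    and V: "chart c V"
    and ra: "\<And>t. real_analytic_at \<Phi> t"
    and \<Phi>V: "\<And>t. c < t \<Longrightarrow> t < c + 2 * pi \<Longrightarrow> \<Phi> t = 2 * arctan (V t)"
    and g: "g \<in> H" "c \<le> g c" "g c < c + 2 * pi"
  shows "\<exists>p q r s. 0 < p * s - q * r \<and> (\<forall>t.
        cos (\<Phi> (g t) / 2) * (r * cos (\<Phi> t / 2) + s * sin (\<Phi> t / 2)) =
        sin (\<Phi> (g t) / 2) * (p * cos (\<Phi> t / 2) + q * sin (\<Phi> t / 2)))"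
proof -
  obtain i where i: "i \<in> H" "\<And>x. i (g x) = x" "\<And>x. g (i x) = x" using H_inv[OF g(1)] by metis
  define \<kappa> where "\<kappa> = deriv g c"
  have \<kappa>: "0 < \<kappa>" unfolding \<kappa>_def by (rule H_pos[OF g(1)])
  have V': "chart (g c) (\<lambda>t. V (i t) / \<kappa>)" unfolding \<kappa>_def by (rule chart_transport[OF V g(1) i])
  obtain w C D where pos: "\<And>t. g c < t \<Longrightarrow> t < c + 2 * pi \<Longrightarrow> 0 < C - w * V t"
    and rel: "\<And>t. g c < t \<Longrightarrow> t < c + 2 * pi \<Longrightarrow>
       V (i t) / \<kappa> = (if w = 0 then V t / C\<^sup>2 else 1 / (w * (C - w * V t))) + D"
    using charts_moebius_related[OF K V' V g(3)] g by (metis add_le_cancel_right order_refl)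
  have "\<exists>p q r s. 0 < p * s - q * r \<and>
    (\<forall>t. g c < t \<longrightarrow> t < c + 2 * pi \<longrightarrow> V (i t) * (r * V t + s) = \<kappa> * (p * V t + q))"
  proof (cases "w = 0")
    case True
    have "C \<noteq> 0" using pos[of "(g c + (c + 2 * pi)) / 2"] g(3) True by simp
    then show ?thesis using rel True \<kappa>
      by (intro exI[of _ "1 / C\<^sup>2"] exI[of _ D] exI[of _ 0] exI[of _ 1]) (auto simp: field_simps)
  next
    case False
    show ?thesis
    \<comment> \<open>The witnesses are the coefficients of \<open>1 / (w * (C - w * X)) + D\<close>
      over the common denominator \<open>w * (C - w * X)\<close>.\<close>
    proof (intro exI conjI allI impI)
      have "(- D * w\<^sup>2) * (w * C) - (D * w * C + 1) * (- w\<^sup>2) = w\<^sup>2" by (simp add: algebra_simps)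
      then show "0 < (- D * w\<^sup>2) * (w * C) - (D * w * C + 1) * (- w\<^sup>2)" using False by simp
      fix t assume t: "g c < t" "t < c + 2 * pi"
      have nz: "w * (C - w * V t) \<noteq> 0" using pos[OF t] False by simp
      have "V (i t) = \<kappa> * (1 / (w * (C - w * V t)) + D)" using rel[OF t] False \<kappa> by (simp add: field_simps)
      moreover have "- w\<^sup>2 * V t + w * C = w * (C - w * V t)" by (simp add: algebra_simps power2_eq_square)
      ultimately have "V (i t) * (- w\<^sup>2 * V t + w * C) = \<kappa> * (1 + D * (w * (C - w * V t)))"
        using nz by (simp add: distrib_right distrib_left)
      then show "V (i t) * (- w\<^sup>2 * V t + w * C) = \<kappa> * (- D * w\<^sup>2 * V t + (D * w * C + 1))"
        by (simp add: algebra_simps power2_eq_square)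
    qed
  qed
  then obtain p q r s where det: "0 < p * s - q * r"
    and eq: "\<And>t. g c < t \<Longrightarrow> t < c + 2 * pi \<Longrightarrow> V (i t) * (r * V t + s) = \<kappa> * (p * V t + q)" by metis
  define \<Psi> where "\<Psi> t = sin (\<Phi> t / 2) * (r * sin (\<Phi> (g t) / 2) + s * cos (\<Phi> (g t) / 2))
      - \<kappa> * cos (\<Phi> t / 2) * (p * sin (\<Phi> (g t) / 2) + q * cos (\<Phi> (g t) / 2))" for t
  have sin_\<Phi>: "sin (\<Phi> t / 2) = V t * cos (\<Phi> t / 2)" if "c < t" "t < c + 2 * pi" for t
  proof -
    have "tan (\<Phi> t / 2) = V t" by (simp add: \<Phi>V[OF that] tan_arctan)
    moreover have "cos (\<Phi> t / 2) \<noteq> 0" by (simp add: \<Phi>V[OF that] cos_arctan_not_zero)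
    ultimately show ?thesis by (simp add: tan_def field_simps)
  qed
  have icv: "c < i (c + 2 * pi)" "i (c + 2 * pi) \<le> c + 2 * pi"
    using H_less[OF i(1), of "g c" "c + 2 * pi"] H_le[OF i(1), of c "g c"] H_per[OF i(1), of c] g i(2)[of c] by simp_all
  have J: "\<Psi> t = 0" if t: "c < t" "t < i (c + 2 * pi)" for t
  proof -
    have gt: "g c < g t" "g t < c + 2 * pi" using t H_less[OF g(1), of t "i (c + 2 * pi)"] g(1) i(3) by simp_all
    have t2: "t < c + 2 * pi" using t icv by simp
    have gt1: "c < g t" using gt g(2) by simp
    have "\<Psi> t = cos (\<Phi> t / 2) * cos (\<Phi> (g t) / 2) * (V t * (r * V (g t) + s) - \<kappa> * (p * V (g t) + q))"
      unfolding \<Psi>_def sin_\<Phi>[OF t(1) t2] sin_\<Phi>[OF gt1 gt(2)] by (simp add: algebra_simps)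
    then show ?thesis using eq[OF gt] by (simp add: i)
  qed
  have ra\<Phi>: "real_analytic_at (\<lambda>t. \<Phi> t / 2) t" for t
    by (rule real_analytic_at_divide[OF ra real_analytic_at_const]) simp
  have ra\<Phi>g: "real_analytic_at (\<lambda>t. \<Phi> (g t) / 2) t" for t
    by (rule real_analytic_at_compose[OF H_ra[OF g(1)] ra\<Phi>])
  have \<Psi>0: "\<Psi> t = 0" for t
  proof (rule real_analytic_identity[of UNIV \<Psi> "(c + i (c + 2 * pi)) / 2"])
    fix t
    note S = real_analytic_at_sin[OF ra\<Phi>] and C = real_analytic_at_cos[OF ra\<Phi>]
      and Sg = real_analytic_at_sin[OF ra\<Phi>g] and Cg = real_analytic_at_cos[OF ra\<Phi>g]
    note k = real_analytic_at_mult[OF real_analytic_at_const]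
    show "real_analytic_at \<Psi> t" unfolding \<Psi>_def[abs_def]
      by (rule real_analytic_at_diff[OF real_analytic_at_mult[OF S real_analytic_at_add[OF k[OF Sg] k[OF Cg]]]
            real_analytic_at_mult[OF k[OF C] real_analytic_at_add[OF k[OF Sg] k[OF Cg]]]])
  next
    have "(c + i (c + 2 * pi)) / 2 islimpt {c<..<i (c + 2 * pi)}"
      using icv by (intro interior_limit_point) (simp add: interior_open)
    then show "(c + i (c + 2 * pi)) / 2 islimpt {t \<in> UNIV. \<Psi> t = 0}"
      by (rule islimpt_subset) (use J in auto)
  qed auto
  show ?thesis
  \<comment> \<open>The equation \<open>\<Psi> t = 0\<close> expresses \<open>V t\<close> through
    \<open>V (g t)\<close>; solving for the latter replaces the matrix by its adjugate up to sign,
    with \<open>\<kappa>\<close> absorbed.\<close>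
  proof (intro exI conjI allI)
    have "(- \<kappa> * p) * (- s) - r * (\<kappa> * q) = \<kappa> * (p * s - q * r)" by (simp add: algebra_simps)
    then show "0 < (- \<kappa> * p) * (- s) - r * (\<kappa> * q)" using \<kappa> det by simp
    show "cos (\<Phi> (g t) / 2) * (\<kappa> * q * cos (\<Phi> t / 2) + (- s) * sin (\<Phi> t / 2)) =
        sin (\<Phi> (g t) / 2) * ((- \<kappa> * p) * cos (\<Phi> t / 2) + r * sin (\<Phi> t / 2))" for t
      using \<Psi>0[of t] unfolding \<Psi>_def by (simp add: algebra_simps)
  qed
qed

text \<open>Inside a turn from \<open>c\<close> the coordinate is \<open>2 * arctan V\<close>.
  Across the lifts of \<open>c\<close>, where \<open>V\<close> jumps from plus to minus infinity,
  the inversion formula for \<open>arctan\<close> rewrites it through the chart at \<open>a\<close>;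
  this is one formula on both sides because \<open>chart_complement\<close> gives the same
  \<open>k\<close>.\<close>

lemma nonfree_projective_chart:
  assumes "\<not> free"
  shows "\<exists>\<Phi>. projective_chart \<Phi>"
proof -
  obtain d x where K: "\<And>s t. s < t \<Longrightarrow> t < s + 2 * pi \<Longrightarrow> K s t = d" and x: "complete x"
    using K_constant_and_complete[OF assms] by metis
  obtain c a b where cab: "complete c" "complete a" "complete b" "c < a" "a < b" "b < c + 2 * pi"
    using three_complete_points[OF x] by metis
  obtain V0 Va Vb where V0: "chart c V0" "onto c V0" and Va: "chart a Va" "onto a Va"
    and Vb: "chart b Vb" "onto b Vb" using cab unfolding complete_def onto_def by metis
  define m where "m = Va (c + 2 * pi)"
  define V where "V t = V0 t - V0 a" for t
  have V: "chart c V" unfolding V_def[abs_def] by (rule chart_shift[OF V0(1)])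
  have Va0: "V a = 0" by (simp add: V_def)
  obtain k where k: "0 < k" and k12:
    "\<And>t. a < t \<Longrightarrow> t < c + 2 * pi \<Longrightarrow> (Va t - Va (c + 2 * pi)) * (V0 t - V0 a) = - k"
    "\<And>t. c + 2 * pi < t \<Longrightarrow> t < a + 2 * pi \<Longrightarrow> (Va t - Va (c + 2 * pi)) * (V0 (t - 2 * pi) - V0 a) = - k"
  proof (rule chart_complement[OF K V0 Va Vb cab(4-6)])
    fix k :: real
    assume "0 < k" "\<And>t. a < t \<Longrightarrow> t < c + 2 * pi \<Longrightarrow> (Va t - Va (c + 2 * pi)) * (V0 t - V0 a) = - k"
      "\<And>t. c + 2 * pi < t \<Longrightarrow> t < a + 2 * pi \<Longrightarrow>
        (Va t - Va (c + 2 * pi)) * (V0 (t - 2 * pi) - V0 a) = - k"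
    then show thesis by (rule that)
  qed
  note k1 = k12(1)[folded m_def V_def] and k2 = k12(2)[folded m_def V_def]
  define N where "N t = \<lfloor>(t - c) / (2 * pi)\<rfloor>" for t
  \<comment> \<open>\<open>N\<close> counts full turns from \<open>c\<close>, and
    \<open>- pi\<close> is the limit of \<open>2 * arctan V\<close> at the lower end of the
    turn.\<close>
  define \<Phi> where "\<Phi> t = (if t - 2 * pi * N t = c then - pi else 2 * arctan (V (t - 2 * pi * N t))) + 2 * pi * N t"
    for t
  have N: "N t = j" if "c + 2 * pi * of_int j \<le> t" "t < c + 2 * pi * of_int j + 2 * pi" for t and j :: int
    unfolding N_def by (rule floor_unique) (use that in \<open>simp_all add: field_simps\<close>)
  have \<Phi>_per: "\<Phi> (t + 2 * pi) = \<Phi> t + 2 * pi" for t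
  proof -
    have "(t + 2 * pi - c) / (2 * pi) = (t - c) / (2 * pi) + 1" by (simp add: field_simps)
    then have "N (t + 2 * pi) = N t + 1" unfolding N_def by simp
    moreover from this have "t + 2 * pi - 2 * pi * N (t + 2 * pi) = t - 2 * pi * N t" by (simp add: algebra_simps)
    ultimately show ?thesis unfolding \<Phi>_def by (simp add: algebra_simps)
  qed
  have \<Phi>V: "\<Phi> t = 2 * arctan (V t)" if "c < t" "t < c + 2 * pi" for t
    using N[of 0 t] that by (simp add: \<Phi>_def)
  have arctan_inv: "arctan (k / y) = (if 0 < y then pi / 2 else - pi / 2) - arctan (y / k)" if "y \<noteq> 0" for y
  proof -
    have "arctan (k / y) = arctan (1 / (y / k))" by simp
    also have "\<dots> = sgn (y / k) * pi / 2 - arctan (y / k)"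
      by (rule Transcendental.arctan_inverse) (use that k in simp)
    also have "sgn (y / k) * pi / 2 = (if 0 < y then pi / 2 else - pi / 2)"
      using that k by (simp add: sgn_if zero_less_divide_iff)
    finally show ?thesis .
  qed
  have \<Phi>Va: "\<Phi> t = pi + 2 * arctan ((Va t - m) / k)" if t: "a < t" "t < a + 2 * pi" for t
  proof -
    have cin: "a < c + 2 * pi" "c + 2 * pi < a + 2 * pi" using cab by simp_all
    consider "t < c + 2 * pi" | "t = c + 2 * pi" | "c + 2 * pi < t" by linarith
    then show ?thesis
    proof cases
      case 1
      have less: "0 < m - Va t" unfolding m_def using chart_less[OF Va(1) t(1) 1 cin(2)] by simp
      have Vt: "V t = k / (m - Va t)" using k1[OF t(1) 1] less by (simp add: field_simps)
      have "\<Phi> t = 2 * arctan (V t)" by (rule \<Phi>V) (use t 1 cab in auto)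
      also have "\<dots> = pi - 2 * arctan ((m - Va t) / k)"
        using arctan_inv[of "m - Va t"] less by (simp add: Vt)
      also have "(m - Va t) / k = - ((Va t - m) / k)" by (simp add: minus_divide_left)
      finally show ?thesis by (simp only: arctan_minus)
    next
      case 2
      then have "N t = 1" by (intro N) auto
      then have "\<Phi> t = pi" using 2 by (simp add: \<Phi>_def)
      then show ?thesis using 2 by (simp add: m_def)
    next
      case 3
      have less: "m - Va t < 0" unfolding m_def using chart_less[OF Va(1) cin(1) 3 t(2)] by simp
      have Vt: "V (t - 2 * pi) = k / (m - Va t)" using k2[OF 3 t(2)] less by (simp add: field_simps)
      have "\<Phi> t = 2 * arctan (V (t - 2 * pi)) + 2 * pi"
        using \<Phi>_per[of "t - 2 * pi"] \<Phi>V[of "t - 2 * pi"] t 3 cab by simp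
      also have "\<dots> = pi - 2 * arctan ((m - Va t) / k)"
        using arctan_inv[of "m - Va t"] less by (simp add: Vt)
      also have "(m - Va t) / k = - ((Va t - m) / k)" by (simp add: minus_divide_left)
      finally show ?thesis by (simp only: arctan_minus)
    qed
  qed
  have good1: "real_analytic_at \<Phi> t \<and> 0 < deriv \<Phi> t" if t: "c < t" "t < c + 2 * pi" for t
  proof
    have ev: "\<forall>\<^sub>F s in nhds t. 2 * arctan (V s) = \<Phi> s"
      unfolding eventually_nhds by (rule exI[of _ "{c<..<c + 2 * pi}"]) (use t \<Phi>V in auto)
    show "real_analytic_at \<Phi> t"
      by (rule real_analytic_at_cong[OF ev real_analytic_at_mult[OF real_analytic_at_const
              real_analytic_at_arctan[OF chart_real_analytic[OF V t]]]])
    have "((\<lambda>s. 2 * arctan (V s)) has_real_derivative 2 * (inverse (1 + (V t)\<^sup>2) * \<Omega> c t)) (at t)"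
      by (rule DERIV_cmult[OF DERIV_chain2[OF DERIV_arctan chartD[OF V t]]])
    then have "(\<Phi> has_real_derivative 2 * (inverse (1 + (V t)\<^sup>2) * \<Omega> c t)) (at t)"
      by (rule has_field_derivative_transform_within_open[of _ _ _ "{c<..<c + 2 * pi}"]) (use t \<Phi>V in auto)
    then have "deriv \<Phi> t = 2 * (inverse (1 + (V t)\<^sup>2) * \<Omega> c t)" by (rule DERIV_imp_deriv)
    then show "0 < deriv \<Phi> t" using Om_pos[OF cis_neq[OF t]] by (simp add: add_pos_nonneg)
  qed
  have good2: "real_analytic_at \<Phi> t \<and> 0 < deriv \<Phi> t" if t: "a < t" "t < a + 2 * pi" for t
  proof
    have ev: "\<forall>\<^sub>F s in nhds t. pi + 2 * arctan ((Va s - m) / k) = \<Phi> s"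
      unfolding eventually_nhds by (rule exI[of _ "{a<..<a + 2 * pi}"]) (use t \<Phi>Va in auto)
    have "real_analytic_at (\<lambda>s. (Va s - m) / k) t"
      by (rule real_analytic_at_divide[OF real_analytic_at_diff[OF chart_real_analytic[OF Va(1) t]
            real_analytic_at_const] real_analytic_at_const]) (use k in simp)
    from real_analytic_at_add[OF real_analytic_at_const real_analytic_at_mult[OF real_analytic_at_const
              real_analytic_at_arctan[OF this]]]
    show "real_analytic_at \<Phi> t" by (rule real_analytic_at_cong[OF ev])
    have "((\<lambda>s. (Va s - m) / k) has_real_derivative \<Omega> a t / k) (at t)"
      using DERIV_cdivide[OF DERIV_diff[OF chartD[OF Va(1) t] DERIV_const], of m k] by simp
    from DERIV_add[OF DERIV_const DERIV_cmult[OF DERIV_chain2[OF DERIV_arctan this]]]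
    have "((\<lambda>s. pi + 2 * arctan ((Va s - m) / k)) has_real_derivative
        0 + 2 * (inverse (1 + ((Va t - m) / k)\<^sup>2) * (\<Omega> a t / k))) (at t)" .
    then have "(\<Phi> has_real_derivative 0 + 2 * (inverse (1 + ((Va t - m) / k)\<^sup>2) * (\<Omega> a t / k))) (at t)"
      by (rule has_field_derivative_transform_within_open[of _ _ _ "{a<..<a + 2 * pi}"]) (use t \<Phi>Va in auto)
    then have "deriv \<Phi> t = 0 + 2 * (inverse (1 + ((Va t - m) / k)\<^sup>2) * (\<Omega> a t / k))"
      by (rule DERIV_imp_deriv)
    then show "0 < deriv \<Phi> t" using Om_pos[OF cis_neq[OF t]] k by (simp add: add_pos_nonneg)
  qed
  have good: "real_analytic_at \<Phi> t \<and> 0 < deriv \<Phi> t" for t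
  proof -
    \<comment> \<open>The representative is taken in a turn that contains its upper end: the
      exceptional point is then \<open>c + 2 * pi\<close>, which lies inside the open turn after
      \<open>a\<close>.\<close>
    obtain j :: int where j: "c < t + 2 * pi * of_int j" "t + 2 * pi * of_int j \<le> c + 2 * pi"
    proof -
      obtain j :: int where "- (c + 2 * pi) \<le> - t + 2 * pi * of_int j" "- t + 2 * pi * of_int j < - (c + 2 * pi) + 2 * pi"
        using representative[of "- (c + 2 * pi)" "- t"] by metis
      then show thesis using that[of "- j"] by simp
    qed
    define y where "y = t + 2 * pi * of_int j"
    have y: "real_analytic_at \<Phi> y \<and> 0 < deriv \<Phi> y"
    proof (cases "y = c + 2 * pi")
      case True then show ?thesis using good2[of y] cab by simp
    next
      case False then show ?thesis using good1[of y] j by (simp add: y_def)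
    qed
    have eq: "\<Phi> = (\<lambda>s. \<Phi> (s + 2 * pi * of_int j) + - (2 * pi * of_int j))"
      using per_int[of \<Phi> "2 * pi"] \<Phi>_per by (simp add: fun_eq_iff)
    have "real_analytic_at (\<lambda>s. s + 2 * pi * of_int j) t"
      by (rule real_analytic_at_add[OF real_analytic_at_ident real_analytic_at_const])
    then have "real_analytic_at (\<lambda>s. \<Phi> (s + 2 * pi * of_int j)) t"
      by (rule real_analytic_at_compose) (use y in \<open>simp add: y_def\<close>)
    from real_analytic_at_add[OF this real_analytic_at_const, of "- (2 * pi * of_int j)"]
    have 1: "real_analytic_at \<Phi> t" by (subst eq)
    have "(\<Phi> has_real_derivative deriv \<Phi> y) (at (t + 2 * pi * of_int j))"
      using real_analytic_at_DERIV y unfolding y_def by metis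
    then have "((\<lambda>s. \<Phi> (s + 2 * pi * of_int j)) has_real_derivative deriv \<Phi> y) (at t)"
      using DERIV_shift[of \<Phi> _ t] by metis
    from DERIV_add[OF this DERIV_const, of "- (2 * pi * of_int j)"]
    have "((\<lambda>s. \<Phi> (s + 2 * pi * of_int j) + - (2 * pi * of_int j)) has_real_derivative deriv \<Phi> y) (at t)" by simp
    then have "(\<Phi> has_real_derivative deriv \<Phi> y) (at t)" by (subst eq)
    then have "deriv \<Phi> t = deriv \<Phi> y" by (rule DERIV_imp_deriv)
    then show ?thesis using 1 y by simp
  qed
  have "projective_chart \<Phi>"
    unfolding projective_chart_def
  proof (intro conjI allI ballI)
    fix f assume f: "f \<in> H"
    obtain j :: int where j: "c \<le> f c + 2 * pi * of_int j" "f c + 2 * pi * of_int j < c + 2 * pi"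
      using representative[of c "f c"] by metis
    define g where "g t = f t + 2 * pi * of_int j" for t
    have g: "g \<in> H" unfolding g_def[abs_def] by (rule H_comp[OF H_shift_int f])
    obtain p q r s where det: "0 < p * s - q * r" and eq: "\<And>t.
        cos (\<Phi> (g t) / 2) * (r * cos (\<Phi> t / 2) + s * sin (\<Phi> t / 2)) =
        sin (\<Phi> (g t) / 2) * (p * cos (\<Phi> t / 2) + q * sin (\<Phi> t / 2))"
      using projective_bilinear[OF K V _ \<Phi>V g] good j unfolding g_def by metis
    \<comment> \<open>Shifting \<open>f\<close> by \<open>j\<close> turns shifts the half angle by
      \<open>pi * j\<close>, which multiplies cosine and sine by the same sign; the homogeneous
      relation is unaffected.\<close>
    have half: "\<Phi> (g t) / 2 = \<Phi> (f t) / 2 + pi * of_int j" for t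
      using per_int[of \<Phi> "2 * pi" "f t" j] \<Phi>_per by (simp add: g_def add_divide_distrib)
    have sj: "sin (pi * of_int j) = 0" by (simp add: sin_zero_iff_int2 mult.commute)
    have cj: "cos (pi * of_int j) \<noteq> 0" using sj sin_zero_abs_cos_one by fastforce
    have "cos (\<Phi> (f t) / 2) * (r * cos (\<Phi> t / 2) + s * sin (\<Phi> t / 2)) =
        sin (\<Phi> (f t) / 2) * (p * cos (\<Phi> t / 2) + q * sin (\<Phi> t / 2))" for t
    proof -
      have "cos (pi * of_int j) * (cos (\<Phi> (f t) / 2) * (r * cos (\<Phi> t / 2) + s * sin (\<Phi> t / 2))) =
        cos (pi * of_int j) * (sin (\<Phi> (f t) / 2) * (p * cos (\<Phi> t / 2) + q * sin (\<Phi> t / 2)))"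
        using eq[of t] unfolding half cos_add sin_add sj by (simp add: mult_ac)
      then show ?thesis using cj by simp
    qed
    then show "\<exists>p q r s. 0 < p * s - q * r \<and> (\<forall>t.
        cos (\<Phi> (f t) / 2) * (r * cos (\<Phi> t / 2) + s * sin (\<Phi> t / 2)) =
        sin (\<Phi> (f t) / 2) * (p * cos (\<Phi> t / 2) + q * sin (\<Phi> t / 2)))" using det by metis
  qed (use good \<Phi>_per in auto)
  then show ?thesis by metis
qed

theorem projective_chart_exists: "\<exists>\<Phi>. projective_chart \<Phi>"
  using free_projective_chart nonfree_projective_chart by metis

end

subsection \<open>Back to the circle\<close>

lemma circle_cis_cases:
  assumes "z \<in> circle"
  obtains t where "z = cis t"
  using assms cis_Arg[of z] by (metis div_by_1 mem_sphere_0 norm_eq_zero norm_sgn scaleR_one sgn_div_norm inverse_1 zero_neq_one)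

lemma circle_lift_eq: "circle_lift F f \<Longrightarrow> f (cis t) = cis (F t)"
  unfolding circle_lift_def by metis

text \<open>The difference in units of \<open>2 * pi\<close> is continuous and integer-valued, hence
  constant.\<close>

lemma circle_lift_unique:
  assumes F: "circle_lift F f" and G: "circle_lift G f"
  obtains k :: int where "\<And>t. G t = F t + 2 * pi * of_int k"
proof -
  define D where "D t = (G t - F t) / (2 * pi)" for t
  have int: "\<exists>k::int. D t = of_int k" for t
  proof -
    have "cis (G t) = cis (F t)" using circle_lift_eq[OF F, of t] circle_lift_eq[OF G, of t] by simp
    then obtain k :: int where "G t = F t + 2 * pi * of_int k" unfolding cis_eq_iff by metis
    then show ?thesis unfolding D_def by (intro exI[of _ k]) simp
  qed
  have "D constant_on UNIV"
  proof (rule continuous_discrete_range_constant)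
    show "continuous_on UNIV D"
      using F G unfolding D_def[abs_def] circle_lift_def by (intro continuous_intros) auto
    fix x
    have "1 \<le> norm (D y - D x)" if "D y \<noteq> D x" for y
    proof -
      obtain j k :: int where jk: "D y = of_int j" "D x = of_int k" using int by metis
      then have "1 \<le> \<bar>j - k\<bar>" using that by auto
      then have "real_of_int 1 \<le> real_of_int \<bar>j - k\<bar>" by (simp only: of_int_le_iff)
      then show ?thesis by (simp add: jk)
    qed
    then show "\<exists>e>0. \<forall>y. y \<in> UNIV \<and> D y \<noteq> D x \<longrightarrow> e \<le> norm (D y - D x)" by (intro exI[of _ 1]) simp
  qed simp
  then obtain c where c: "\<And>t. D t = c" unfolding constant_on_def by auto
  obtain k :: int where "c = of_int k" using int[of 0] c by metis
  then have "G t = F t + 2 * pi * of_int k" for t using c[of t] by (simp add: D_def field_simps)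
  then show thesis by (rule that)
qed

lemma Diff_omegaD:
  assumes "f \<in> carrier Diff_omega"
  shows "f \<in> Bij circle" "circle_analytic f" "circle_analytic (inv_into circle f)" "orientation_preserving f"
  using assms unfolding Diff_omega_def by simp_all

lemma Bij_circle:
  assumes "f \<in> Bij circle"
  shows "f \<in> extensional circle" "bij_betw f circle circle"
  using assms unfolding Bij_def by auto

lemma Diff_omega_mult:
  "f \<in> Bij circle \<Longrightarrow> g \<in> Bij circle \<Longrightarrow> f \<otimes>\<^bsub>Diff_omega\<^esub> g = compose circle f g"
  unfolding Diff_omega_def BijGroup_def by simp

lemma Diff_omega_one: "\<one>\<^bsub>Diff_omega\<^esub> = (\<lambda>z\<in>circle. z)"
  unfolding Diff_omega_def BijGroup_def by simp

context
  fixes f F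
  assumes f: "f \<in> carrier Diff_omega" and F: "circle_lift F f" and mono: "strict_mono F"
begin

text \<open>A full turn shifts \<open>F\<close> by some \<open>2 * pi * k\<close>. Monotonicity
  gives \<open>0 < k\<close>, and \<open>1 < k\<close> would make \<open>f\<close> repeat a value
  within one turn, against injectivity.\<close>

lemma lift_per: "F (t + 2 * pi) = F t + 2 * pi"
proof -
  have inj: "inj_on f circle" using Bij_circle(2)[OF Diff_omegaD(1)[OF f]] by (simp add: bij_betw_def)
  have cont: "continuous_on A F" for A using F unfolding circle_lift_def by (metis continuous_on_subset subset_UNIV)
  have "circle_lift (\<lambda>t. F (t + 2 * pi)) f"
    unfolding circle_lift_def
  proof (intro conjI allI)
    show "continuous_on UNIV (\<lambda>t. F (t + 2 * pi))"
      by (intro continuous_on_compose2[OF cont[of UNIV]] continuous_intros) auto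
    fix t
    have "cis t = cis (t + 2 * pi)" unfolding cis_eq_iff by (rule exI[of _ "-1"]) simp
    then show "f (cis t) = cis (F (t + 2 * pi))" using circle_lift_eq[OF F, of "t + 2 * pi"] by simp
  qed
  then obtain k :: int where k: "\<And>t. F (t + 2 * pi) = F t + 2 * pi * of_int k"
    using circle_lift_unique[OF F] by metis
  have "F t < F (t + 2 * pi)" using mono by (simp add: strict_mono_def)
  then have "0 < 2 * pi * real_of_int k" using k[of t] by simp
  then have "0 < k" by (simp add: zero_less_mult_iff)
  moreover have "\<not> 1 < k"
  proof
    assume "1 < k"
    then have "2 * pi * 1 < 2 * pi * real_of_int k" by (intro mult_strict_left_mono) auto
    then have less: "F t + 2 * pi < F (t + 2 * pi)" using k[of t] by simp
    obtain s where s: "t \<le> s" "s \<le> t + 2 * pi" "F s = F t + 2 * pi"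
      using IVT'[of F t "F t + 2 * pi" "t + 2 * pi"] less cont by auto
    have "s \<noteq> t" "s \<noteq> t + 2 * pi" using s less by auto
    then have "cis t \<noteq> cis s" using s cis_neq[of t s] by simp
    moreover have "f (cis t) = f (cis s)"
      unfolding circle_lift_eq[OF F] cis_eq_iff s(3) by (rule exI[of _ "-1"]) simp
    then have "cis t = cis s" by (rule inj_onD[OF inj]) auto
    ultimately show False by simp
  qed
  ultimately have "k = 1" by simp
  then show ?thesis using k by simp
qed

lemma lift_real_analytic: "real_analytic_at F t"
proof -
  obtain G where G: "circle_lift G f" "\<And>t. real_analytic_at G t"
    using Diff_omegaD(2)[OF f] unfolding circle_analytic_def by metis
  obtain k :: int where "\<And>t. F t = G t + 2 * pi * of_int k" using circle_lift_unique[OF G(1) F] by metis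
  then have "F = (\<lambda>t. G t + 2 * pi * of_int k)" by (rule ext)
  then show ?thesis using real_analytic_at_add[OF G(2) real_analytic_at_const] by simp
qed

text \<open>Analyticity of the inverse map enters here: the chain rule for
  \<open>G (F t) = t + 2 * pi * k\<close> excludes zeros of the derivative, which a monotone
  analytic bijection may have, as \<open>t ^ 3\<close> does.\<close>

lemma lift_deriv_pos: "0 < deriv F t"
proof -
  obtain G where G: "circle_lift G (inv_into circle f)" "\<And>t. real_analytic_at G t"
    using Diff_omegaD(3)[OF f] unfolding circle_analytic_def by metis
  have inj: "inj_on f circle" using Bij_circle(2)[OF Diff_omegaD(1)[OF f]] by (simp add: bij_betw_def)
  have FD: "(F has_real_derivative deriv F t) (at t)" by (rule real_analytic_at_DERIV[OF lift_real_analytic])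
  have contF: "continuous_on A F" for A using F unfolding circle_lift_def by (metis continuous_on_subset subset_UNIV)
  have contG: "continuous_on A G" for A using G unfolding circle_lift_def by (metis continuous_on_subset subset_UNIV)
  have 1: "circle_lift (\<lambda>t. G (F t)) (\<lambda>z. z)"
    unfolding circle_lift_def
  proof (intro conjI allI)
    show "continuous_on UNIV (\<lambda>t. G (F t))"
      by (rule continuous_on_compose2[OF contG contF]) auto
    fix t
    have "cis (G (F t)) = inv_into circle f (f (cis t))"
      using circle_lift_eq[OF G(1)] circle_lift_eq[OF F] by simp
    also have "\<dots> = cis t" by (rule inv_into_f_f[OF inj]) simp
    finally show "cis t = cis (G (F t))" by simp
  qed
  have 2: "circle_lift (\<lambda>t. t) (\<lambda>z. z)" unfolding circle_lift_def by simp
  obtain k :: int where k: "\<And>t. G (F t) = t + 2 * pi * of_int k" using circle_lift_unique[OF 2 1] by metis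
  have "((\<lambda>t. G (F t)) has_real_derivative deriv G (F t) * deriv F t) (at t)"
    by (rule DERIV_chain2[OF real_analytic_at_DERIV[OF G(2)] FD])
  moreover have "((\<lambda>t. G (F t)) has_real_derivative 1) (at t)"
    unfolding k by (auto intro!: derivative_eq_intros)
  ultimately have "deriv G (F t) * deriv F t = 1" by (rule DERIV_unique)
  then have "deriv F t \<noteq> 0" by auto
  moreover have "0 \<le> deriv F t"
  proof (rule ccontr)
    assume "\<not> 0 \<le> deriv F t"
    then have "deriv F t < 0" by simp
    from DERIV_neg_dec_right[OF FD this] obtain d where "0 < d" "\<forall>h>0. h < d \<longrightarrow> F (t + h) < F t" by metis
    then have "F (t + d / 2) < F t" by simp
    moreover have "F t < F (t + d / 2)" using mono \<open>0 < d\<close> by (simp add: strict_mono_def)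
    ultimately show False by simp
  qed
  ultimately show ?thesis by simp
qed

end

section \<open>Circle maps built from periodic lifts\<close>

definition circle_map :: "(real \<Rightarrow> real) \<Rightarrow> complex \<Rightarrow> complex" where
  "circle_map F = (\<lambda>z\<in>circle. cis (F (Arg z)))"

text \<open>Periodicity makes the angle chosen by \<open>Arg\<close> irrelevant.\<close>

lemma circle_map_cis:
  assumes "\<And>t. F (t + 2 * pi) = F t + 2 * pi"
  shows "circle_map F (cis t) = cis (F t)"
proof -
  have "cis (Arg (cis t)) = cis t" by (simp add: cis_Arg sgn_div_norm)
  then obtain k :: int where "Arg (cis t) = t + 2 * pi * of_int k" unfolding cis_eq_iff by metis
  then have "F (Arg (cis t)) = F t + 2 * pi * of_int k" using per_int[of F, OF assms] by simp
  then have "cis (F (Arg (cis t))) = cis (F t)" unfolding cis_eq_iff by metis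
  then show ?thesis by (simp add: circle_map_def)
qed

lemma circle_map_Diff_omega:
  assumes F: "\<And>t. F (t + 2 * pi) = F t + 2 * pi" "\<And>t. real_analytic_at F t" "strict_mono F"
    and G: "\<And>t. G (t + 2 * pi) = G t + 2 * pi" "\<And>t. real_analytic_at G t"
    and inv: "\<And>t. G (F t) = t" "\<And>t. F (G t) = t"
  shows "circle_map F \<in> carrier Diff_omega"
proof -
  have cont: "continuous_on UNIV F" "continuous_on UNIV G"
    using F(2) G(2) by (auto intro!: continuous_at_imp_continuous_on real_analytic_at_isCont)
  note Fc = circle_map_cis[of F, OF F(1)] and Gc = circle_map_cis[of G, OF G(1)]
  have bij: "bij_betw (circle_map F) circle circle"
  proof (rule bij_betwI[where g = "circle_map G"])
    show "circle_map F \<in> circle \<rightarrow> circle" "circle_map G \<in> circle \<rightarrow> circle"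
      by (auto simp: circle_map_def)
    show "circle_map G (circle_map F z) = z" if "z \<in> circle" for z
      by (rule circle_cis_cases[OF that]) (simp add: Fc Gc inv)
    show "circle_map F (circle_map G z) = z" if "z \<in> circle" for z
      by (rule circle_cis_cases[OF that]) (simp add: Fc Gc inv)
  qed
  have liftF: "circle_lift F (circle_map F)" unfolding circle_lift_def using cont Fc by simp
  have "inv_into circle (circle_map F) (cis t) = cis (G t)" for t
  proof (rule inv_into_f_eq)
    show "inj_on (circle_map F) circle" using bij by (simp add: bij_betw_def)
    show "circle_map F (cis (G t)) = cis t" by (simp add: Fc inv)
  qed simp
  then have liftG: "circle_lift G (inv_into circle (circle_map F))"
    unfolding circle_lift_def using cont by simp
  have "circle_map F \<in> Bij circle"
    using bij unfolding Bij_def by (simp add: circle_map_def)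
  then show ?thesis
    using liftF liftG F(2,3) G(2)
    unfolding Diff_omega_def circle_analytic_def orientation_preserving_def by auto
qed

lemma Diff_omega_inv:
  assumes h: "h \<in> carrier Diff_omega" and g: "g \<in> carrier Diff_omega"
    and gh: "\<And>z. z \<in> circle \<Longrightarrow> g (h z) = z" and hg: "\<And>z. z \<in> circle \<Longrightarrow> h (g z) = z"
  shows "inv\<^bsub>Diff_omega\<^esub> h = g"
  unfolding m_inv_def
proof (rule the_equality)
  note hB = Diff_omegaD(1)[OF h] and gB = Diff_omegaD(1)[OF g]
  show "g \<in> carrier Diff_omega \<and> h \<otimes>\<^bsub>Diff_omega\<^esub> g = \<one>\<^bsub>Diff_omega\<^esub> \<and> g \<otimes>\<^bsub>Diff_omega\<^esub> h = \<one>\<^bsub>Diff_omega\<^esub>"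
    unfolding Diff_omega_mult[OF hB gB] Diff_omega_mult[OF gB hB] Diff_omega_one
    using g gh hg by (auto simp: compose_def restrict_def)
  fix y
  assume y: "y \<in> carrier Diff_omega \<and> h \<otimes>\<^bsub>Diff_omega\<^esub> y = \<one>\<^bsub>Diff_omega\<^esub> \<and> y \<otimes>\<^bsub>Diff_omega\<^esub> h = \<one>\<^bsub>Diff_omega\<^esub>"
  then have yB: "y \<in> Bij circle" using Diff_omegaD(1) by metis
  have "compose circle h y = (\<lambda>z\<in>circle. z)"
    using y unfolding Diff_omega_mult[OF hB yB] Diff_omega_one by simp
  then have hy: "h (y z) = z" if "z \<in> circle" for z using that by (metis compose_eq restrict_apply')
  show "y = g"
  proof (rule extensionalityI[of _ circle])
    fix z :: complex assume z: "z \<in> circle"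
    have "y z \<in> circle" using Bij_circle(2)[OF yB] z by (meson bij_betwE)
    then show "y z = g z" using gh[of "y z"] hy[OF z] by simp
  qed (use Bij_circle(1) yB gB in auto)
qed

text \<open>The square in \<open>line_to_circle\<close> doubles angles; this is the origin of the
  half angles in \<open>projective_chart\<close>.\<close>

lemma line_to_circle_half_angle:
  "line_to_circle (vector [cos (s / 2), sin (s / 2)]) = cis s"
proof -
  have "Complex ((vector [cos (s / 2), sin (s / 2)] :: real ^ 2) $ 1)
      ((vector [cos (s / 2), sin (s / 2)] :: real ^ 2) $ 2) = cis (s / 2)"
    by (simp add: complex_eq_iff)
  then show ?thesis
    by (simp add: line_to_circle_def sgn_div_norm Complex.DeMoivre)
qed

lemma projective_action_PSL2R:
  assumes f: "f \<in> extensional circle" and det: "0 < p * s - q * r"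
    and fc: "\<And>t. f (cis t) = cis (F t)"
    and eq: "\<And>t. cos (F t / 2) * (r * cos (t / 2) + s * sin (t / 2)) =
        sin (F t / 2) * (p * cos (t / 2) + q * sin (t / 2))"
  shows "f \<in> PSL2R"
proof -
  \<comment> \<open>The determinant is only known to be positive; dividing the matrix by
    \<open>\<delta>\<close> makes it one.\<close>
  define \<delta> where "\<delta> = sqrt (p * s - q * r)"
  have \<delta>: "0 < \<delta>" "\<delta> * \<delta> = p * s - q * r" using det by (simp_all add: \<delta>_def)
  define A :: "real ^ 2 ^ 2" where "A = vector [vector [p / \<delta>, q / \<delta>], vector [r / \<delta>, s / \<delta>]]"
  have A: "A $ 1 $ 1 = p / \<delta>" "A $ 1 $ 2 = q / \<delta>" "A $ 2 $ 1 = r / \<delta>" "A $ 2 $ 2 = s / \<delta>"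
    by (simp_all add: A_def)
  have "det A = (p * s - q * r) / (\<delta> * \<delta>)"
    by (simp add: det_2 A diff_divide_distrib mult.commute)
  then have detA: "det A = 1" using \<delta> det by simp
  have nz: "A *v v \<noteq> 0" if "v \<noteq> 0" for v
    using detA that invertible_det_nz[of A] matrix_left_invertible_ker[of A]
      invertible_left_inverse[of A] by auto
  have "f (line_to_circle v) = line_to_circle (A *v v)" if v: "v \<noteq> 0" for v
  proof -
    have "line_to_circle v \<in> circle" using v line_to_circle_image by auto
    then obtain t where t: "line_to_circle v = cis t" by (rule circle_cis_cases)
    define u :: "real \<Rightarrow> real ^ 2" where "u x = vector [cos (x / 2), sin (x / 2)]" for x
    have u_line: "line_to_circle (u x) = cis x" for x unfolding u_def by (rule line_to_circle_half_angle)
    have u12: "u x $ 1 = cos (x / 2)" "u x $ 2 = sin (x / 2)" for x by (simp_all add: u_def)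
    have u_nz: "u x \<noteq> 0" for x
    proof
      assume "u x = 0"
      then have "cos (x / 2) = 0" "sin (x / 2) = 0" using u12[of x] by simp_all
      then show False using sin_cos_squared_add[of "x / 2"] by simp
    qed
    obtain k where k: "k \<noteq> 0" "v = k *\<^sub>R u t"
      using line_to_circle_eq_iff[OF u_nz v, of t] t u_line by metis
    define x where "x = A *v u t"
    have x_nz: "x \<noteq> 0" unfolding x_def by (rule nz[OF u_nz])
    have x12: "x $ 1 = (p * cos (t / 2) + q * sin (t / 2)) / \<delta>"
      "x $ 2 = (r * cos (t / 2) + s * sin (t / 2)) / \<delta>"
      by (simp_all add: x_def matrix_vector_mult_def sum_2 A u12 add_divide_distrib)
    have cross: "cos (F t / 2) * x $ 2 = sin (F t / 2) * x $ 1"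
      using eq[of t] by (simp add: x12)
    \<comment> \<open>This is the component of \<open>x\<close> along the unit vector
      \<open>u (F t)\<close>; by \<open>cross\<close> the orthogonal component vanishes.\<close>
    define c where "c = cos (F t / 2) * x $ 1 + sin (F t / 2) * x $ 2"
    have sc: "(cos (F t / 2))\<^sup>2 + (sin (F t / 2))\<^sup>2 = 1" by simp
    have "c * cos (F t / 2) = (cos (F t / 2))\<^sup>2 * x $ 1 + sin (F t / 2) * (cos (F t / 2) * x $ 2)"
      by (simp add: c_def algebra_simps power2_eq_square)
    also have "\<dots> = ((cos (F t / 2))\<^sup>2 + (sin (F t / 2))\<^sup>2) * x $ 1"
      unfolding cross by algebra
    finally have 1: "x $ 1 = c * cos (F t / 2)" unfolding sc by simp
    have "c * sin (F t / 2) = cos (F t / 2) * (sin (F t / 2) * x $ 1) + (sin (F t / 2))\<^sup>2 * x $ 2"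
      by (simp add: c_def algebra_simps power2_eq_square)
    also have "\<dots> = ((cos (F t / 2))\<^sup>2 + (sin (F t / 2))\<^sup>2) * x $ 2"
      unfolding cross[symmetric] by algebra
    finally have 2: "x $ 2 = c * sin (F t / 2)" unfolding sc by simp
    have x_u: "x = c *\<^sub>R u (F t)" using 1 2 by (simp add: vec_eq_iff forall_2 u12)
    then have "c \<noteq> 0" using x_nz by auto
    have Av: "A *v v = (k * c) *\<^sub>R u (F t)"
      using x_u unfolding x_def by (subst k(2)) (simp add: matrix_vector_mult_scaleR)
    have "line_to_circle (u (F t)) = line_to_circle (A *v v)"
      using line_to_circle_eq_iff[OF u_nz nz[OF v], of "F t"] Av k(1) \<open>c \<noteq> 0\<close>
      by (metis mult_eq_0_iff)
    then show ?thesis by (simp add: t fc u_line)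
  qed
  then show ?thesis unfolding PSL2R_def using f detA by blast
qed

theorem theorem1p9:
  fixes \<Gamma> :: "('g, 'm) monoid_scheme" and \<rho> :: "'g \<Rightarrow> complex \<Rightarrow> complex"
  assumes "group \<Gamma>"
    and "\<rho> \<in> hom \<Gamma> Diff_omega"
    and "non_elementary \<Gamma> \<rho>"
    and "\<exists>\<omega>. analytic_volume_form \<omega> \<and> preserves_volume_form \<Gamma> \<rho> \<omega>"
  shows "analytically_Fuchsian \<Gamma> \<rho>"
proof -
  interpret \<Gamma>: group \<Gamma> by (rule assms(1))
  obtain \<omega> where \<omega>: "analytic_volume_form \<omega>" "preserves_volume_form \<Gamma> \<rho> \<omega>" using assms(4) by metis
  have carrier: "\<rho> x \<in> carrier Diff_omega" if "x \<in> carrier \<Gamma>" for x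
    using assms(2) that by (rule hom_in_carrier)
  note Bij = Diff_omegaD(1)[OF carrier]
  have circle: "\<rho> x z \<in> circle" if "x \<in> carrier \<Gamma>" "z \<in> circle" for x z
    using Bij_circle(2)[OF Bij[OF that(1)]] that(2) by (meson bij_betwE)
  have mult: "\<rho> (x \<otimes>\<^bsub>\<Gamma>\<^esub> y) z = \<rho> x (\<rho> y z)" if "x \<in> carrier \<Gamma>" "y \<in> carrier \<Gamma>" "z \<in> circle" for x y z
    using hom_mult[OF assms(2) that(1,2)] Diff_omega_mult[OF Bij[OF that(1)] Bij[OF that(2)]] that(3)
    by (simp add: compose_eq)
  \<comment> \<open>An injective idempotent map is the identity.\<close>
  have one: "\<rho> \<one>\<^bsub>\<Gamma>\<^esub> z = z" if "z \<in> circle" for z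
  proof -
    have "\<rho> \<one>\<^bsub>\<Gamma>\<^esub> (\<rho> \<one>\<^bsub>\<Gamma>\<^esub> z) = \<rho> \<one>\<^bsub>\<Gamma>\<^esub> z" using mult[of "\<one>\<^bsub>\<Gamma>\<^esub>" "\<one>\<^bsub>\<Gamma>\<^esub>" z] that by simp
    moreover have "inj_on (\<rho> \<one>\<^bsub>\<Gamma>\<^esub>) circle"
      using Bij_circle(2)[OF Bij[OF \<Gamma>.one_closed]] by (simp add: bij_betw_def)
    ultimately show ?thesis using that circle[OF \<Gamma>.one_closed that] by (meson inj_onD)
  qed
  define \<Omega> where "\<Omega> s t = \<omega> (cis s) (cis t)" for s t
  \<comment> \<open>All increasing lifts of all group elements are taken; the deck translations are
    among them as lifts of the neutral element.\<close>
  define H where "H = {F. strict_mono F \<and> (\<exists>x\<in>carrier \<Gamma>. circle_lift F (\<rho> x))}"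
  have H_E: "\<exists>x\<in>carrier \<Gamma>. circle_lift F (\<rho> x)" "strict_mono F" if "F \<in> H" for F
    using that unfolding H_def by auto
  have H_I: "F \<in> H" if "strict_mono F" "x \<in> carrier \<Gamma>" "continuous_on UNIV F" "\<And>t. \<rho> x (cis t) = cis (F t)" for F x
    using that unfolding H_def circle_lift_def by auto
  have cont: "continuous_on A F" if "F \<in> H" for F A
    using H_E(1)[OF that] unfolding circle_lift_def by (metis continuous_on_subset subset_UNIV)
  have lift: "\<exists>F\<in>H. circle_lift F (\<rho> x)" if "x \<in> carrier \<Gamma>" for x
    using Diff_omegaD(4)[OF carrier[OF that]] that unfolding orientation_preserving_def H_def by auto
  have shift: "(\<lambda>t. t + 2 * pi * of_int k) \<in> H" for k
  proof (rule H_I[OF _ \<Gamma>.one_closed])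
    show "\<rho> \<one>\<^bsub>\<Gamma>\<^esub> (cis t) = cis (t + 2 * pi * of_int k)" for t
      using cis_eq_iff[of "t + 2 * pi * of_int k" t] by (auto simp: one)
  qed (auto simp: strict_mono_def intro!: continuous_intros)
  have comp: "(\<lambda>t. F (G t)) \<in> H" if F: "F \<in> H" and G: "G \<in> H" for F G
  proof -
    obtain x y where x: "x \<in> carrier \<Gamma>" "circle_lift F (\<rho> x)" and y: "y \<in> carrier \<Gamma>" "circle_lift G (\<rho> y)"
      using H_E(1) F G by metis
    show ?thesis
    proof (rule H_I[of _ "x \<otimes>\<^bsub>\<Gamma>\<^esub> y"])
      show "strict_mono (\<lambda>t. F (G t))" using H_E(2)[OF F] H_E(2)[OF G] by (simp add: strict_mono_def)
      show "continuous_on UNIV (\<lambda>t. F (G t))" by (rule continuous_on_compose2[OF cont[OF F] cont[OF G]]) auto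
      show "\<rho> (x \<otimes>\<^bsub>\<Gamma>\<^esub> y) (cis t) = cis (F (G t))" for t
        using mult[OF x(1) y(1)] circle_lift_eq[OF x(2)] circle_lift_eq[OF y(2)] by simp
    qed (use x y in simp)
  qed
  interpret H: circle_action H \<Omega>
  proof
    fix F G :: "real \<Rightarrow> real" and t s :: real
    show "(\<lambda>t. t + 2 * pi) \<in> H" using shift[of 1] by simp
    show "\<Omega> (s + 2 * pi) t = \<Omega> s t" "\<Omega> s (t + 2 * pi) = \<Omega> s t"
      unfolding \<Omega>_def by (simp_all flip: cis_mult)
    show "infinite ((\<lambda>F. cis (F t)) ` H)"
    proof
      assume fin: "finite ((\<lambda>F. cis (F t)) ` H)"
      have "{f (cis t) |f. f \<in> \<rho> ` carrier \<Gamma>} \<subseteq> (\<lambda>F. cis (F t)) ` H"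
      proof
        fix z assume "z \<in> {f (cis t) |f. f \<in> \<rho> ` carrier \<Gamma>}"
        then obtain x where x: "x \<in> carrier \<Gamma>" "z = \<rho> x (cis t)" by auto
        obtain F where "F \<in> H" "circle_lift F (\<rho> x)" using lift[OF x(1)] by metis
        then show "z \<in> (\<lambda>F. cis (F t)) ` H" using x(2) circle_lift_eq by auto
      qed
      then have "finite {f (cis t) |f. f \<in> \<rho> ` carrier \<Gamma>}" using fin by (rule finite_subset)
      then show False using assms(3) unfolding non_elementary_def by auto
    qed
    show "0 < \<Omega> s t" if "cis s \<noteq> cis t"
      using \<omega>(1) that unfolding analytic_volume_form_def \<Omega>_def by simp
    show "real_analytic2_at \<Omega> s t" if "cis s \<noteq> cis t"
      using \<omega>(1) that unfolding analytic_volume_form_def \<Omega>_def[abs_def] by simp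
    assume F: "F \<in> H"
    then obtain x where x: "x \<in> carrier \<Gamma>" "circle_lift F (\<rho> x)" using H_E(1) by metis
    note L = carrier[OF x(1)] x(2) H_E(2)[OF F]
    show "F (t + 2 * pi) = F t + 2 * pi" by (rule lift_per[OF L])
    show ra: "real_analytic_at F t" by (rule lift_real_analytic[OF L])
    show "0 < deriv F t" by (rule lift_deriv_pos[OF L])
    show "(\<lambda>t. F (G t)) \<in> H" if "G \<in> H" using comp F that .
    show "\<Omega> (F s) (F t) * deriv F s * deriv F t = \<Omega> s t" if "cis s \<noteq> cis t"
    proof -
      have d: "circle_deriv (\<rho> x) (cis u) = deriv F u" for u
        by (rule circle_deriv_lift[OF x(2) real_analytic_at_DERIV[OF lift_real_analytic[OF L]]])
      have "\<omega> (\<rho> x (cis s)) (\<rho> x (cis t)) * circle_deriv (\<rho> x) (cis s) * circle_deriv (\<rho> x) (cis t)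
          = \<omega> (cis s) (cis t)"
        using \<omega>(2) x(1) that unfolding preserves_volume_form_def by simp
      then show ?thesis unfolding d \<Omega>_def circle_lift_eq[OF x(2)] .
    qed
    show "\<exists>G\<in>H. \<forall>t. G (F t) = t \<and> F (G t) = t"
    proof -
      have inv: "inv\<^bsub>\<Gamma>\<^esub> x \<in> carrier \<Gamma>" using x(1) by simp
      obtain G0 where G0: "G0 \<in> H" "circle_lift G0 (\<rho> (inv\<^bsub>\<Gamma>\<^esub> x))" using lift[OF inv] by metis
      have id: "circle_lift (\<lambda>t. t) (\<lambda>z. z)" unfolding circle_lift_def by simp
      have "circle_lift (\<lambda>t. G0 (F t)) (\<lambda>z. z)"
        unfolding circle_lift_def
      proof (intro conjI allI)
        show "continuous_on UNIV (\<lambda>t. G0 (F t))" by (rule cont[OF comp[OF G0(1) F]])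
        fix t
        show "cis t = cis (G0 (F t))"
          using mult[OF inv x(1), of "cis t"] x(1) circle_lift_eq[OF G0(2)] circle_lift_eq[OF x(2)] by (simp add: one)
      qed
      then obtain k :: int where k: "\<And>t. G0 (F t) = t + 2 * pi * of_int k"
        using circle_lift_unique[OF id] by metis
      have "circle_lift (\<lambda>t. F (G0 t)) (\<lambda>z. z)"
        unfolding circle_lift_def
      proof (intro conjI allI)
        show "continuous_on UNIV (\<lambda>t. F (G0 t))" by (rule cont[OF comp[OF F G0(1)]])
        fix t
        show "cis t = cis (F (G0 t))"
          using mult[OF x(1) inv, of "cis t"] x(1) circle_lift_eq[OF G0(2)] circle_lift_eq[OF x(2)] by (simp add: one)
      qed
      then obtain j :: int where j: "\<And>t. F (G0 t) = t + 2 * pi * of_int j"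
        using circle_lift_unique[OF id] by metis
      \<comment> \<open>A lift of the inverse element inverts \<open>F\<close> only up to a deck
        translation. It is corrected on one side here, and the other side then has to agree.\<close>
      define G where "G t = G0 t + 2 * pi * of_int (- k)" for t
      have G: "G \<in> H" unfolding G_def[abs_def] by (rule comp[OF shift G0(1)])
      have Fper: "F (t + 2 * pi * of_int m) = F t + 2 * pi * of_int m" for t m
        using per_int[of F "2 * pi"] lift_per[OF L] by simp
      have 1: "G (F t) = t" for t by (simp add: G_def k)
      have 2: "F (G t) = t + 2 * pi * of_int (j - k)" for t
        unfolding G_def Fper j by (simp add: algebra_simps)
      have "j - k = 0" using 2[of "F 0"] 1[of 0] by simp
      then show ?thesis using 1 2 G by (metis add.right_neutral mult_zero_right of_int_0)
    qed
  qed
  obtain \<Phi> where \<Phi>: "H.projective_chart \<Phi>" using H.projective_chart_exists by metis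
  have ra: "real_analytic_at \<Phi> t" and dpos: "0 < deriv \<Phi> t" and per: "\<Phi> (t + 2 * pi) = \<Phi> t + 2 * pi" for t
    using \<Phi> unfolding H.projective_chart_def by simp_all
  have mono: "strict_mono \<Phi>"
    unfolding strict_mono_def by (meson DERIV_pos_imp_increasing real_analytic_at_DERIV ra dpos)
  have "surj \<Phi>"
    unfolding surj_def
  proof
    fix y
    obtain k :: int where k: "\<Phi> 0 \<le> y + 2 * pi * of_int k" "y + 2 * pi * of_int k < \<Phi> 0 + 2 * pi"
      using representative[of "\<Phi> 0" y] by metis
    have "continuous_on {0..2 * pi} \<Phi>"
      by (intro continuous_at_imp_continuous_on ballI real_analytic_at_isCont ra)
    then obtain x where "\<Phi> x = y + 2 * pi * of_int k"
      using IVT'[of \<Phi> 0 "y + 2 * pi * of_int k" "2 * pi"] k per[of 0] by auto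
    then have "\<Phi> (x + 2 * pi * of_int (- k)) = y" using per_int[of \<Phi>, OF per, of x "- k"] by simp
    then show "\<exists>x. y = \<Phi> x" by metis
  qed
  define \<Psi> where "\<Psi> = inv_into UNIV \<Phi>"
  have inv1: "\<Psi> (\<Phi> t) = t" for t unfolding \<Psi>_def using mono by (simp add: strict_mono_imp_inj_on)
  have inv2: "\<Phi> (\<Psi> t) = t" for t unfolding \<Psi>_def using \<open>surj \<Phi>\<close> by (simp add: surj_f_inv_f)
  have mono': "strict_mono \<Psi>"
    unfolding strict_mono_def using strict_mono_less[OF mono] by (metis inv2)
  have per': "\<Psi> (t + 2 * pi) = \<Psi> t + 2 * pi" for t
    using per[of "\<Psi> t"] inv1 inv2 by metis
  have ra': "real_analytic_at \<Psi> t" for t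
  proof -
    have "isCont \<Psi> (\<Phi> (\<Psi> t))"
      by (rule isCont_inverse_function[of 1]) (auto intro: inv1 real_analytic_at_isCont[OF ra])
    then have "real_analytic_at \<Psi> (\<Phi> (\<Psi> t))"
      using real_analytic_at_inverse_function[of \<Phi> "\<Psi> t" \<Psi>, OF ra] dpos[of "\<Psi> t"] inv1 inv2 by simp
    then show ?thesis by (simp add: inv2)
  qed
  \<comment> \<open>The conjugating map is the inverse of the new coordinate, so that the conjugate
    of \<open>f\<close> has the lift \<open>\<Phi> \<circ> F \<circ> \<Psi>\<close>.\<close>
  define h where "h = circle_map \<Psi>"
  define g where "g = circle_map \<Phi>"
  have h: "h \<in> carrier Diff_omega"
    unfolding h_def by (rule circle_map_Diff_omega[OF per' ra' mono' per ra inv2 inv1])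
  have g: "g \<in> carrier Diff_omega"
    unfolding g_def by (rule circle_map_Diff_omega[OF per ra mono per' ra' inv1 inv2])
  have hc: "h (cis t) = cis (\<Psi> t)" and gc: "g (cis t) = cis (\<Phi> t)" for t
    unfolding h_def g_def using circle_map_cis[of \<Psi>, OF per'] circle_map_cis[of \<Phi>, OF per] by simp_all
  have inv: "inv\<^bsub>Diff_omega\<^esub> h = g"
  proof (rule Diff_omega_inv[OF h g])
    show "g (h z) = z" "h (g z) = z" if "z \<in> circle" for z
      using circle_cis_cases[OF that] by (metis hc gc inv1 inv2)+
  qed
  show ?thesis
    unfolding analytically_Fuchsian_def
  proof (intro bexI[OF _ h] image_subsetI)
    fix f assume "f \<in> \<rho> ` carrier \<Gamma>"
    then obtain x where x: "x \<in> carrier \<Gamma>" "f = \<rho> x" by auto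
    obtain F where F: "F \<in> H" "circle_lift F (\<rho> x)" using lift[OF x(1)] by metis
    obtain p q r s where det: "0 < p * s - q * r" and eq: "\<And>t.
        cos (\<Phi> (F t) / 2) * (r * cos (\<Phi> t / 2) + s * sin (\<Phi> t / 2)) =
        sin (\<Phi> (F t) / 2) * (p * cos (\<Phi> t / 2) + q * sin (\<Phi> t / 2))"
      using \<Phi> F(1) unfolding H.projective_chart_def by metis
    have fB: "f \<in> Bij circle" and hB: "h \<in> Bij circle" and gB: "g \<in> Bij circle"
      using Diff_omegaD(1) h g carrier x by metis+
    have eq_comp: "inv\<^bsub>Diff_omega\<^esub> h \<otimes>\<^bsub>Diff_omega\<^esub> f \<otimes>\<^bsub>Diff_omega\<^esub> h = compose circle (compose circle g f) h"
      unfolding inv by (simp only: Diff_omega_mult[OF gB fB] Diff_omega_mult[OF compose_Bij[OF gB fB] hB])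
    show "inv\<^bsub>Diff_omega\<^esub> h \<otimes>\<^bsub>Diff_omega\<^esub> f \<otimes>\<^bsub>Diff_omega\<^esub> h \<in> PSL2R"
      unfolding eq_comp
    proof (rule projective_action_PSL2R[OF _ det])
      show "compose circle (compose circle g f) h (cis t) = cis (\<Phi> (F (\<Psi> t)))" for t
        by (simp add: compose_eq hc gc x(2) circle_lift_eq[OF F(2)])
      show "cos (\<Phi> (F (\<Psi> t)) / 2) * (r * cos (t / 2) + s * sin (t / 2)) =
          sin (\<Phi> (F (\<Psi> t)) / 2) * (p * cos (t / 2) + q * sin (t / 2))" for t
        using eq[of "\<Psi> t"] by (simp add: inv2)
    qed (simp add: compose_def)
  qed
qed

end
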